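(* Suppose that $f:[-1,1]\to\mathbb{C}$ and $g:[-1,1]\to\mathbb{R}$ admit extensions to infinitely differentiable functions in a neighborhood of $[-1,1]$, and that $$G_1=\max_{-1\le x\le1}|g'(x)|<\frac12.$$ Let $0<\epsilon<1$ be given, and define the integer $n$ by $$n=\left\lfloor\frac{\log(\epsilon)}{\log(2G_1)}\right\rfloor.$$ Then there exists $p_b\in C^\infty(\mathbb{R})$ such that: 1. $\widehat{p_b}$ is a tempered distribution of order at most $1$ supported on the interval $\left[-c_f(\epsilon)-n\,c_{g'}(\epsilon),\;c_f(\epsilon)+n\,c_{g'}(\epsilon)\right]$; 2. $\left|p_b'(x)+ig'(x)p_b(x)-f(x)\right|\le 2\epsilon\left(1+\dfrac{G_1}{1-2G_1}\right)\|f\|_{L^\infty([-1,1])}$ for all $x\in[-1,1]$; 3. $\|p_b\|_{L^\infty([-1,1])}\le\dfrac{2}{1-2G_1}\|f\|_{L^\infty([-1,1])}$; 4. $\|p_b'\|_{L^\infty([-1,1])}\le 4\left(1+\dfrac{G_1}{1-2G_1}\right)\|f\|_{L^\infty([-1,1])}$.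
   Context: Fourier transform convention: for $\varphi\in S(\mathbb{R})$ (Schwartz space), $\widehat{\varphi}(\xi)=\frac1{2\pi}\int_{-\infty}^\infty \varphi(x)e^{-i\xi x}\,dx$, so that $\varphi(x)=\int_{-\infty}^\infty\widehat\varphi(\xi)e^{i\xi x}\,d\xi$; it is extended to tempered distributions $S'(\mathbb{R})$ by $\langle\widehat\varphi,\psi\rangle=\langle\varphi,\widehat\psi\rangle$. The order of a tempered distribution $\varphi$ is the least nonnegative integer $n$ such that for each compact $K\subset\mathbb{R}$ there is a constant $M_K$ with $|\langle\varphi,\psi\rangle|\le M_K\sup_{0\le k\le n}\sup_{x\in K}|D^k\psi(x)|$ for every $\psi\in S(\mathbb{R})$ supported in $K$. A tempered distribution has bandlimit $c$ if its Fourier transform is supported in $[-c,c]$ ($c$ is not required to be the smallest such number). Definition of $c_F(\epsilon)$: if $F:[-1,1]\to\mathbb{C}$ admits an infinitely differentiable extension to an open interval containing $[-1,1]$ and $0<\epsilon<1$, then $c_F(\epsilon)$ is the smallest positive real number $c$ such that there exists $F_b\in S(\mathbb{R})$ of bandlimit $c$ with: (1) $\|F-F_b\|_{L^\infty([-1,1])}\le\epsilon\|F\|_{L^\infty([-1,1])}$; (2) $\|F_b\|_{L^\infty(\mathbb{R})}\le 4\|F\|_{L^\infty([-1,1])}$; (3) $\|\widehat{F_b}\|_{L^\infty(\mathbb{R})}\le 4\|F\|_{L^\infty([-1,1])}$; (4) $\|\widehat{F_b}'\|_{L^\infty(\mathbb{R})}\le 4\|F\|_{L^\infty([-1,1])}$.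 In the claim this is applied with $F=f$ and $F=g'$. *)

theory Defs
  imports "HOL-Analysis.Analysis" "HOL-Probability.Essential_Supremum"
    "HOL-Library.Extended_Nat"
begin

section \<open>Smooth functions and the Schwartz space\<close>

definition iter_deriv :: "nat \<Rightarrow> (real \<Rightarrow> 'a::real_normed_vector) \<Rightarrow> real \<Rightarrow> 'a" where
  "iter_deriv k f = ((\<lambda>h x. vector_derivative h (at x)) ^^ k) f"

text \<open>Meant for open \<open>S\<close> only, because the derivatives are two-sided.\<close>
definition smooth_on :: "real set \<Rightarrow> (real \<Rightarrow> 'a::real_normed_vector) \<Rightarrow> bool" where
  "smooth_on S f \<longleftrightarrow> (\<forall>k. \<forall>x\<in>S. iter_deriv k f differentiable (at x))"

text \<open>A function on \<open>[-1,1]\<close> is represented by a total function whose values outside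
  \<open>[-1,1]\<close> are irrelevant.\<close>
definition smoothly_extendable :: "(real \<Rightarrow> 'a::real_normed_vector) \<Rightarrow> bool" where
  "smoothly_extendable F \<longleftrightarrow>
     (\<exists>a b h. a < -1 \<and> 1 < b \<and> smooth_on {a<..<b} h \<and> (\<forall>x\<in>{-1..1}. h x = F x))"

text \<open>The derivative of a function on \<open>[-1,1]\<close>, one-sided at the end points.\<close>
definition unit_deriv :: "(real \<Rightarrow> 'a::real_normed_vector) \<Rightarrow> real \<Rightarrow> 'a" where
  "unit_deriv F x = vector_derivative F (at x within {-1..1})"

definition schwartz :: "(real \<Rightarrow> complex) set" where
  "schwartz = {\<phi>. smooth_on UNIV \<phi> \<and>
     (\<forall>j k. bounded (range (\<lambda>x. x ^ j *\<^sub>R iter_deriv k \<phi> x)))}"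

definition schwartz_seminorm :: "nat \<Rightarrow> nat \<Rightarrow> (real \<Rightarrow> complex) \<Rightarrow> real" where
  "schwartz_seminorm j k \<phi> = (SUP x. norm (x ^ j *\<^sub>R iter_deriv k \<phi> x))"

definition fun_support :: "(real \<Rightarrow> complex) \<Rightarrow> real set" where
  "fun_support \<phi> = closure {x. \<phi> x \<noteq> 0}"

definition fourier :: "(real \<Rightarrow> complex) \<Rightarrow> real \<Rightarrow> complex" where
  "fourier \<phi> \<xi> = complex_of_real (1 / (2 * pi)) *
     (LINT x|lborel. \<phi> x * exp (- \<i> * complex_of_real (\<xi> * x)))"

section \<open>Tempered distributions\<close>

text \<open>Tempered distributions are total functionals of which only the values on the Schwartz
  space matter.\<close>
type_synonym distribution = "(real \<Rightarrow> complex) \<Rightarrow> complex"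

definition tempered_distribution :: "distribution \<Rightarrow> bool" where
  "tempered_distribution T \<longleftrightarrow>
     (\<forall>\<phi>\<in>schwartz. \<forall>\<psi>\<in>schwartz. T (\<lambda>x. \<phi> x + \<psi> x) = T \<phi> + T \<psi>) \<and>
     (\<forall>a. \<forall>\<psi>\<in>schwartz. T (\<lambda>x. a * \<psi> x) = a * T \<psi>) \<and>
     (\<exists>C N. \<forall>\<psi>\<in>schwartz. norm (T \<psi>) \<le> C * (\<Sum>j\<le>N. \<Sum>k\<le>N. schwartz_seminorm j k \<psi>))"

definition dist_of :: "(real \<Rightarrow> complex) \<Rightarrow> distribution" where
  "dist_of \<phi> \<psi> = (LINT x|lborel. \<phi> x * \<psi> x)"

text \<open>Integrability has to be demanded separately, since the Bochner integral of a
  non-integrable function is \<open>0\<close>.\<close>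
definition tempered_function :: "(real \<Rightarrow> complex) \<Rightarrow> bool" where
  "tempered_function \<phi> \<longleftrightarrow>
     (\<forall>\<psi>\<in>schwartz. integrable lborel (\<lambda>x. \<phi> x * \<psi> x)) \<and> tempered_distribution (dist_of \<phi>)"

definition dist_fourier :: "distribution \<Rightarrow> distribution" where
  "dist_fourier T \<psi> = T (fourier \<psi>)"

definition dist_support :: "distribution \<Rightarrow> real set" where
  "dist_support T = - \<Union>{U. open U \<and>
     (\<forall>\<psi>\<in>schwartz. compact (fun_support \<psi>) \<and> fun_support \<psi> \<subseteq> U \<longrightarrow> T \<psi> = 0)}"

definition order_bound :: "distribution \<Rightarrow> nat \<Rightarrow> bool" where
  "order_bound T n \<longleftrightarrow>
     (\<forall>K. compact K \<longrightarrow>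
       (\<exists>M. \<forall>\<psi>\<in>schwartz. fun_support \<psi> \<subseteq> K \<longrightarrow>
          norm (T \<psi>) \<le> M * (SUP k\<in>{..n}. SUP x\<in>K. norm (iter_deriv k \<psi> x))))"

text \<open>The least \<open>n\<close> satisfying the bound, and \<open>\<infinity>\<close> if there is none.\<close>
definition dist_order :: "distribution \<Rightarrow> enat" where
  "dist_order T = (INF n\<in>{n. order_bound T n}. enat n)"

definition has_bandlimit :: "distribution \<Rightarrow> real \<Rightarrow> bool" where
  "has_bandlimit T c \<longleftrightarrow> dist_support (dist_fourier T) \<subseteq> {-c..c}"

section \<open>The approximate bandlimit of a function on \<open>[-1,1]\<close>\<close>

definition Linf_norm :: "real set \<Rightarrow> (real \<Rightarrow> 'a::real_normed_vector) \<Rightarrow> ereal" where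
  "Linf_norm A F = esssup (lebesgue_on A) (\<lambda>x. ereal (norm (F x)))"

definition admissible_bandlimit :: "(real \<Rightarrow> complex) \<Rightarrow> real \<Rightarrow> real \<Rightarrow> bool" where
  "admissible_bandlimit F \<epsilon> c \<longleftrightarrow> 0 < c \<and>
     (\<exists>Fb\<in>schwartz. has_bandlimit (dist_of Fb) c \<and>
        Linf_norm {-1..1} (\<lambda>x. F x - Fb x) \<le> ereal \<epsilon> * Linf_norm {-1..1} F \<and>
        Linf_norm UNIV Fb \<le> 4 * Linf_norm {-1..1} F \<and>
        Linf_norm UNIV (fourier Fb) \<le> 4 * Linf_norm {-1..1} F \<and>
        Linf_norm UNIV (\<lambda>\<xi>. vector_derivative (fourier Fb) (at \<xi>)) \<le> 4 * Linf_norm {-1..1} F)"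

text \<open>The number \<open>c\<^sub>F(\<epsilon>)\<close>. A smallest admissible value need not exist (for \<open>F = 0\<close> every
  \<open>c > 0\<close> is admissible), so the infimum is taken; by the lemma below it is the smallest
  admissible value whenever there is one.\<close>
definition approx_bandlimit :: "(real \<Rightarrow> complex) \<Rightarrow> real \<Rightarrow> real" where
  "approx_bandlimit F \<epsilon> = Inf {c. admissible_bandlimit F \<epsilon> c}"

lemma approx_bandlimit_eq_least:
  assumes "admissible_bandlimit F \<epsilon> c"
    and "\<And>c'. admissible_bandlimit F \<epsilon> c' \<Longrightarrow> c \<le> c'"
  shows "approx_bandlimit F \<epsilon> = c"
  unfolding approx_bandlimit_def using assms by (intro cInf_eq_minimum) auto

end

theory Submission
  imports Defs "HOL-Probability.Characteristic_Functions" "HOL-Probability.Sinc_Integral"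
begin

text \<open>The proof is Picard iteration with band-limited data. Replace \<open>f\<close> and \<open>g'\<close> by band-limited Schwartz
functions \<open>f\<^sub>b\<close> and \<open>h\<^sub>b\<close> that approximate them on \<open>[-1,1]\<close>. The Picard iterates of \<open>p' + i h\<^sub>b p = f\<^sub>b\<close>
with \<open>p(0) = 0\<close> are \<open>p\<^sub>0(x) = \<integral>\<^sub>0\<^sup>x f\<^sub>b\<close> and \<open>p\<^sub>k\<^sub>+\<^sub>1(x) = \<integral>\<^sub>0\<^sup>x (f\<^sub>b - i h\<^sub>b p\<^sub>k)\<close>. Integration does not enlarge the band, and
multiplication by \<open>h\<^sub>b\<close> enlarges it by the bandwidth of \<open>h\<^sub>b\<close>, so \<open>p\<^sub>n\<close> has the bandwidth of \<open>f\<^sub>b\<close> plus \<open>n\<close> times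
that of \<open>h\<^sub>b\<close> (\<open>fourier_picard_deriv_eq_0\<close>). On \<open>[-1,1]\<close> the iteration contracts by \<open>sup |h\<^sub>b| \<le> 2 G\<^sub>1 < 1\<close>, and
the residual of \<open>p\<^sub>n\<close> in the original equation consists of the two approximation errors and a term of at most
\<open>(2 G\<^sub>1)\<^sup>n\<^sup>+\<^sup>1 \<parallel>f\<parallel>\<close> (\<open>norm_picard_residual_le\<close>); the number \<open>n\<close> is chosen such that \<open>(2 G\<^sub>1)\<^sup>n\<^sup>+\<^sup>1 \<le> \<epsilon>\<close>.

All iterates have the form \<open>P(x) = \<integral>\<^sub>0\<^sup>x u\<close> with \<open>u\<close> a Schwartz function. By Fourier inversion and Fubini, the
Fourier transform of such a \<open>P\<close> pairs with \<open>\<psi>\<close> as the integral over \<open>\<eta>\<close> of \<open>U(\<eta>) (\<psi>(\<eta>) - \<psi>(0)) / (i \<eta>)\<close>,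
where \<open>U\<close> is the transform of \<open>u\<close> (\<open>dist_fourier_antideriv\<close>). This formula carries the distributional half of
the theorem. The difference quotient is bounded by \<open>sup |\<psi>'|\<close>, so the order is at most one. It vanishes on
\<open>[-c,c]\<close> if \<open>\<psi>\<close> vanishes near that interval, so the transform is supported in \<open>[-c,c]\<close> if \<open>U\<close> vanishes
outside. And the transform of \<open>h P\<close> at \<open>\<xi>\<close> is the pairing of the transform of \<open>P\<close> with the Schwartz function
\<open>s \<mapsto> H(\<xi> - s)\<close>, where \<open>H\<close> is the transform of \<open>h\<close>, so that bandwidths add up under multiplication (\<open>fourier_mult_antideriv_eq_0\<close>).

The approximate bandlimit is an infimum over Schwartz functions that need not be attained: a limit of
admissible functions has a Lipschitz transform, which may fail to be smooth. The estimates leave room,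
however: they still hold if the approximation error \<open>\<epsilon>\<close> is relaxed to \<open>\<epsilon> + \<epsilon>(1 - \<epsilon>)/4\<close>
(\<open>slack_inequality\<close>). With this tolerance an approximation of bandwidth exactly \<open>c = c\<^sub>F(\<epsilon>)\<close> is obtained by
dilating an admissible function of bandwidth \<open>c'\<close> slightly above \<open>c\<close> by the factor \<open>c / c'\<close>, since \<open>F\<close> is
Lipschitz on \<open>[-1,1]\<close> (\<open>approx_at_approx_bandlimit\<close>). The dilation makes sense because \<open>c > 0\<close> unless \<open>F = 0\<close>
on \<open>[-1,1]\<close>: a function whose transform is bounded by \<open>4 \<parallel>F\<parallel>\<close> and has bandwidth \<open>c\<close> is itself bounded by
\<open>8 c \<parallel>F\<parallel>\<close>. That admissible functions exist at all is shown by mollifying a compactly supported extension of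
\<open>F\<close> (\<open>admissible_bandlimit_exists\<close>).\<close>

section \<open>Calculus of smooth and Schwartz functions\<close>

abbreviation (input) D :: "(real \<Rightarrow> 'a::real_normed_vector) \<Rightarrow> real \<Rightarrow> 'a" where
  "D f \<equiv> (\<lambda>x. vector_derivative f (at x))"

lemma D_eqI: "(\<And>x. (f has_vector_derivative f' x) (at x)) \<Longrightarrow> D f = f'"
  by (simp add: fun_eq_iff vector_derivative_at)

lemma iter_deriv_0 [simp]: "iter_deriv 0 f = f"
  by (simp add: iter_deriv_def)

lemma iter_deriv_Suc: "iter_deriv (Suc k) f = D (iter_deriv k f)"
  by (simp add: iter_deriv_def)

lemma iter_deriv_D: "iter_deriv k (D f) = iter_deriv (Suc k) f"
  unfolding iter_deriv_def by (simp add: funpow_Suc_right del: funpow.simps)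

lemma iter_deriv_invariant:
  assumes "A f" and "\<And>f. A f \<Longrightarrow> \<exists>f'. A f' \<and> (\<forall>x. (f has_vector_derivative f' x) (at x))"
  shows "A (iter_deriv k f)"
proof (induction k)
  case (Suc k)
  with assms(2) obtain f' where "A f'" "\<And>x. (iter_deriv k f has_vector_derivative f' x) (at x)"
    by meson
  then show ?case unfolding iter_deriv_Suc by (subst D_eqI)
qed (simp add: assms)

text \<open>Higher derivatives of composite expressions have no manageable closed form. Smoothness and
  decay are therefore always shown by exhibiting a class of functions that contains the function in
  question and is closed under differentiation.\<close>
lemma smooth_on_coinduct:
  assumes "A f" and "\<And>f. A f \<Longrightarrow> \<exists>f'. A f' \<and> (\<forall>x. (f has_vector_derivative f' x) (at x))"
  shows "smooth_on UNIV f"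
  unfolding smooth_on_def
  using iter_deriv_invariant[of A, OF assms] assms(2) by (meson differentiableI_vector)

lemma smooth_on_D: "smooth_on UNIV f \<Longrightarrow> smooth_on UNIV (D f)"
  by (simp add: smooth_on_def iter_deriv_D)

lemma smooth_on_has_vector_derivative:
  "smooth_on S f \<Longrightarrow> x \<in> S \<Longrightarrow> (f has_vector_derivative D f x) (at x)"
  unfolding smooth_on_def vector_derivative_works[symmetric]
  by (drule spec[of _ 0]) simp

lemma smooth_on_imp_continuous_on: "smooth_on UNIV f \<Longrightarrow> continuous_on S f"
  by (rule continuous_at_imp_continuous_on)
     (auto intro: has_vector_derivative_continuous smooth_on_has_vector_derivative[of UNIV])

text \<open>The multipliers of the Schwartz space: smooth functions all of whose derivatives grow at most
polynomially. Antiderivatives of Schwartz functions are of this kind, but need not be Schwartz.\<close>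
definition moderate :: "(real \<Rightarrow> 'a::real_normed_vector) \<Rightarrow> bool" where
  "moderate f \<longleftrightarrow> smooth_on UNIV f \<and>
     (\<forall>k. \<exists>C m. \<forall>x. norm (iter_deriv k f x) \<le> C * (1 + \<bar>x\<bar>) ^ m)"

lemma moderate_smooth: "moderate f \<Longrightarrow> smooth_on UNIV f"
  by (simp add: moderate_def)

lemma moderate_D: "moderate f \<Longrightarrow> moderate (D f)"
  by (simp add: moderate_def smooth_on_D iter_deriv_D)

lemma moderate_bound: "moderate f \<Longrightarrow> \<exists>C m. \<forall>x. norm (f x) \<le> C * (1 + \<bar>x\<bar>) ^ m"
  unfolding moderate_def by (drule conjunct2, drule spec[of _ 0]) simp

lemma moderate_coinduct:
  assumes "A f" and step: "\<And>f. A f \<Longrightarrow> \<exists>f'. A f' \<and> (\<forall>x. (f has_vector_derivative f' x) (at x))"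
    and "\<And>f. A f \<Longrightarrow> \<exists>C m. \<forall>x. norm (f x) \<le> C * (1 + \<bar>x\<bar>) ^ m"
  shows "moderate f"
  unfolding moderate_def
  using iter_deriv_invariant[of A, OF assms(1,2)] smooth_on_coinduct[of A, OF assms(1,2)] assms(3) by simp

lemma schwartz_iff:
  "\<phi> \<in> schwartz \<longleftrightarrow> smooth_on UNIV \<phi> \<and>
     (\<forall>j k. \<exists>C. \<forall>x. \<bar>x\<bar> ^ j * norm (iter_deriv k \<phi> x) \<le> C)"
  unfolding schwartz_def bounded_iff by (simp add: power_abs)

lemma schwartz_smooth: "\<phi> \<in> schwartz \<Longrightarrow> smooth_on UNIV \<phi>"
  by (simp add: schwartz_iff)

lemma schwartz_D: "\<phi> \<in> schwartz \<Longrightarrow> D \<phi> \<in> schwartz"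
  by (simp add: schwartz_iff smooth_on_D iter_deriv_D)

lemma schwartz_has_vector_derivative:
  "\<phi> \<in> schwartz \<Longrightarrow> (\<phi> has_vector_derivative D \<phi> x) (at x)"
  by (rule smooth_on_has_vector_derivative[of UNIV]) (simp_all add: schwartz_smooth)

lemma schwartz_bound: "\<phi> \<in> schwartz \<Longrightarrow> \<exists>C. \<forall>x. \<bar>x\<bar> ^ j * norm (\<phi> x) \<le> C"
  unfolding schwartz_iff by (drule conjunct2, drule spec[of _ j], drule spec[of _ 0]) simp

text \<open>The weight \<open>(1 + |x|)\<^sup>j\<close> absorbs polynomial growth of a factor and behaves well under affine
substitutions, which the monomials \<open>|x|\<^sup>j\<close> do not.\<close>
lemma schwartz_weighted_bound: "\<phi> \<in> schwartz \<Longrightarrow> \<exists>C. \<forall>x. (1 + \<bar>x\<bar>) ^ j * norm (\<phi> x) \<le> C"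
proof -
  assume "\<phi> \<in> schwartz"
  then obtain C0 Cj where C: "\<And>x. \<bar>x\<bar> ^ 0 * norm (\<phi> x) \<le> C0" "\<And>x. \<bar>x\<bar> ^ j * norm (\<phi> x) \<le> Cj"
    using schwartz_bound[of \<phi> 0] schwartz_bound[of \<phi> j] by blast
  have "(1 + \<bar>x\<bar>) ^ j * norm (\<phi> x) \<le> 2 ^ j * (C0 + Cj)" for x
  proof -
    have "(1 + \<bar>x\<bar>) ^ j \<le> (2 * max 1 \<bar>x\<bar>) ^ j"
      by (intro power_mono) auto
    also have "\<dots> \<le> 2 ^ j * (1 + \<bar>x\<bar> ^ j)"
      by (auto simp: power_mult_distrib max_def)
    finally have "(1 + \<bar>x\<bar>) ^ j * norm (\<phi> x) \<le> 2 ^ j * (1 + \<bar>x\<bar> ^ j) * norm (\<phi> x)"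
      by (rule mult_right_mono) simp
    also have "\<dots> \<le> 2 ^ j * (C0 + Cj)"
      using add_mono[OF C(1)[of x] C(2)[of x]] by (simp add: distrib_right mult.assoc)
    finally show ?thesis .
  qed
  then show ?thesis by blast
qed

lemma weighted_norm_add:
  fixes x :: real and a b :: complex
  assumes "\<bar>x\<bar> ^ j * norm a \<le> C" "\<bar>x\<bar> ^ j * norm b \<le> E"
  shows "\<bar>x\<bar> ^ j * norm (a + b) \<le> C + E"
proof -
  have "\<bar>x\<bar> ^ j * norm (a + b) \<le> \<bar>x\<bar> ^ j * (norm a + norm b)"
    by (intro mult_left_mono norm_triangle_ineq) simp
  with assms show ?thesis by (simp add: distrib_left)
qed

lemma schwartz_coinduct:
  assumes "A f" and "\<And>f. A f \<Longrightarrow> \<exists>f'. A f' \<and> (\<forall>x. (f has_vector_derivative f' x) (at x))"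
    and "\<And>f j. A f \<Longrightarrow> \<exists>C. \<forall>x. \<bar>x\<bar> ^ j * norm (f x) \<le> C"
  shows "f \<in> schwartz"
  unfolding schwartz_iff
  using iter_deriv_invariant[of A, OF assms(1,2)] smooth_on_coinduct[of A, OF assms(1,2)] assms(3) by simp

text \<open>The closure of products under addition; it is closed under differentiation by the product
  rule when both factors range over classes closed under differentiation.\<close>
inductive sum_of_products ::
    "((real \<Rightarrow> 'a::real_normed_algebra) \<Rightarrow> bool) \<Rightarrow> ((real \<Rightarrow> 'a) \<Rightarrow> bool) \<Rightarrow> (real \<Rightarrow> 'a) \<Rightarrow> bool"
  for A B where
  prod: "A a \<Longrightarrow> B b \<Longrightarrow> sum_of_products A B (\<lambda>x. a x * b x)"
| add: "sum_of_products A B f \<Longrightarrow> sum_of_products A B g \<Longrightarrow> sum_of_products A B (\<lambda>x. f x + g x)"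

lemma sum_of_products_derivative:
  assumes "sum_of_products A B f"
    and "\<And>a. A a \<Longrightarrow> A (D a) \<and> (\<forall>x. (a has_vector_derivative D a x) (at x))"
    and "\<And>b. B b \<Longrightarrow> B (D b) \<and> (\<forall>x. (b has_vector_derivative D b x) (at x))"
  shows "\<exists>f'. sum_of_products A B f' \<and> (\<forall>x. (f has_vector_derivative f' x) (at x))"
  using assms(1)
proof induction
  case (prod a b)
  have "sum_of_products A B (\<lambda>x. a x * D b x + D a x * b x)"
    using prod assms(2,3) by (intro sum_of_products.intros) auto
  moreover have "((\<lambda>x. a x * b x) has_vector_derivative a x * D b x + D a x * b x) (at x)" for x
    using prod assms(2,3) by (intro has_vector_derivative_mult) auto
  ultimately show ?case by (intro exI conjI allI)
next
  case (add f g)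
  then obtain f' g' where *: "sum_of_products A B f'" "sum_of_products A B g'"
    "\<And>x. (f has_vector_derivative f' x) (at x)" "\<And>x. (g has_vector_derivative g' x) (at x)"
    by meson
  then show ?case
    by (intro exI[of _ "\<lambda>x. f' x + g' x"])
       (auto intro: sum_of_products.add has_vector_derivative_add)
qed

lemma smooth_on_mult:
  fixes f g :: "real \<Rightarrow> 'a::real_normed_algebra"
  assumes "smooth_on UNIV f" "smooth_on UNIV g"
  shows "smooth_on UNIV (\<lambda>x. f x * g x)"
proof (rule smooth_on_coinduct[of "sum_of_products (smooth_on UNIV) (smooth_on UNIV)"])
  show "sum_of_products (smooth_on UNIV) (smooth_on UNIV) (\<lambda>x. f x * g x)"
    using assms by (rule sum_of_products.prod)
qed (auto intro!: sum_of_products_derivative smooth_on_D smooth_on_has_vector_derivative)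

lemma schwartz_mult_moderate:
  assumes "f \<in> schwartz" "moderate g"
  shows "(\<lambda>x. f x * g x) \<in> schwartz"
proof (rule schwartz_coinduct[of "sum_of_products (\<lambda>f. f \<in> schwartz) moderate"])
  show "sum_of_products (\<lambda>f. f \<in> schwartz) moderate (\<lambda>x. f x * g x)"
    using assms by (rule sum_of_products.prod)
next
  fix f :: "real \<Rightarrow> complex" and j
  assume "sum_of_products (\<lambda>f. f \<in> schwartz) moderate f"
  then show "\<exists>C. \<forall>x. \<bar>x\<bar> ^ j * norm (f x) \<le> C"
  proof induction
    case (prod a b)
    then obtain C m where C: "\<And>x. norm (b x) \<le> C * (1 + \<bar>x\<bar>) ^ m"
      using moderate_bound by meson
    obtain E where E: "\<And>x. (1 + \<bar>x\<bar>) ^ (j + m) * norm (a x) \<le> E"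
      using schwartz_weighted_bound prod(1) by meson
    have "0 \<le> norm (b 0)" by simp
    also have "\<dots> \<le> C" using C[of 0] by simp
    finally have "0 \<le> C" .
    have "\<bar>x\<bar> ^ j * norm (a x * b x) \<le> C * E" for x
    proof -
      have "\<bar>x\<bar> ^ j * norm (a x * b x) \<le> (1 + \<bar>x\<bar>) ^ j * (norm (a x) * (C * (1 + \<bar>x\<bar>) ^ m))"
        unfolding norm_mult by (intro mult_mono power_mono C) auto
      also have "\<dots> = C * ((1 + \<bar>x\<bar>) ^ (j + m) * norm (a x))"
        by (simp add: power_add)
      also have "\<dots> \<le> C * E"
        using E \<open>0 \<le> C\<close> by (intro mult_left_mono)
      finally show ?thesis .
    qed
    then show ?case by blast
  next
    case (add f g)
    then obtain C E where "\<And>x. \<bar>x\<bar> ^ j * norm (f x) \<le> C" "\<And>x. \<bar>x\<bar> ^ j * norm (g x) \<le> E"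
      by meson
    then have "\<bar>x\<bar> ^ j * norm (f x + g x) \<le> C + E" for x
      by (rule weighted_norm_add)
    then show ?case by blast
  qed
qed (rule sum_of_products_derivative, assumption,
     simp_all add: schwartz_D moderate_D moderate_smooth schwartz_has_vector_derivative
       smooth_on_has_vector_derivative[of UNIV])

lemma schwartz_imp_moderate: "\<phi> \<in> schwartz \<Longrightarrow> moderate \<phi>"
  unfolding moderate_def
proof (intro conjI allI)
  fix k assume "\<phi> \<in> schwartz"
  then obtain C where "\<And>x. \<bar>x\<bar> ^ 0 * norm (iter_deriv k \<phi> x) \<le> C"
    unfolding schwartz_iff by meson
  then show "\<exists>C m. \<forall>x. norm (iter_deriv k \<phi> x) \<le> C * (1 + \<bar>x\<bar>) ^ m"
    by (intro exI[of _ C] exI[of _ 0]) simp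
qed (simp add: schwartz_smooth)

lemma schwartz_zero: "(\<lambda>x. 0) \<in> schwartz"
  by (rule schwartz_coinduct[of "\<lambda>f. f = (\<lambda>x. 0)"]) auto

lemma schwartz_add:
  assumes "f \<in> schwartz" "g \<in> schwartz"
  shows "(\<lambda>x. f x + g x) \<in> schwartz"
proof (rule schwartz_coinduct[of "\<lambda>h. \<exists>f\<in>schwartz. \<exists>g\<in>schwartz. h = (\<lambda>x. f x + g x)"])
  show "\<exists>f'\<in>schwartz. \<exists>g'\<in>schwartz. (\<lambda>x. f x + g x) = (\<lambda>x. f' x + g' x)"
    using assms by blast
next
  fix h :: "real \<Rightarrow> complex"
  assume "\<exists>f\<in>schwartz. \<exists>g\<in>schwartz. h = (\<lambda>x. f x + g x)"
  then obtain f g where h: "f \<in> schwartz" "g \<in> schwartz" "h = (\<lambda>x. f x + g x)" by blast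
  then show "\<exists>h'. (\<exists>f\<in>schwartz. \<exists>g\<in>schwartz. h' = (\<lambda>x. f x + g x)) \<and>
      (\<forall>x. (h has_vector_derivative h' x) (at x))"
    by (intro exI[of _ "\<lambda>x. D f x + D g x"] conjI bexI[of _ "D f"] bexI[of _ "D g"])
       (auto intro!: has_vector_derivative_add schwartz_has_vector_derivative schwartz_D)
  fix j
  from h obtain C E where "\<And>x. \<bar>x\<bar> ^ j * norm (f x) \<le> C" "\<And>x. \<bar>x\<bar> ^ j * norm (g x) \<le> E"
    using schwartz_bound by meson
  then have "\<bar>x\<bar> ^ j * norm (f x + g x) \<le> C + E" for x
    by (rule weighted_norm_add)
  then show "\<exists>C. \<forall>x. \<bar>x\<bar> ^ j * norm (h x) \<le> C"
    unfolding h(3) by blast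
qed

lemma moderate_const: "moderate (\<lambda>x. c)"
proof (rule moderate_coinduct[of "\<lambda>f. \<exists>c. f = (\<lambda>x. c)"])
  fix f :: "real \<Rightarrow> 'a" assume "\<exists>c. f = (\<lambda>x. c)"
  then obtain c where c: "f = (\<lambda>x. c)" by blast
  then show "\<exists>f'. (\<exists>c. f' = (\<lambda>x. c)) \<and> (\<forall>x. (f has_vector_derivative f' x) (at x))"
    by (intro exI[of _ "\<lambda>x. 0"]) auto
  show "\<exists>C m. \<forall>x. norm (f x) \<le> C * (1 + \<bar>x\<bar>) ^ m"
    by (intro exI[of _ "norm c"] exI[of _ 0]) (simp add: c)
qed blast

lemma moderate_linear: "moderate (\<lambda>x. c * complex_of_real x)"
proof (rule moderate_coinduct[of "\<lambda>f. f = (\<lambda>x. c * complex_of_real x) \<or> (\<exists>c. f = (\<lambda>x. c))"])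
  fix f :: "real \<Rightarrow> complex" assume f: "f = (\<lambda>x. c * complex_of_real x) \<or> (\<exists>c. f = (\<lambda>x. c))"
  then obtain d where "\<And>x. (f has_vector_derivative d) (at x)"
  proof
    assume "f = (\<lambda>x. c * complex_of_real x)"
    then have "(f has_vector_derivative c) (at x)" for x
      by (auto intro!: derivative_eq_intros)
    then show ?thesis by (rule that)
  next
    assume "\<exists>c. f = (\<lambda>x. c)"
    then have "(f has_vector_derivative 0) (at x)" for x by auto
    then show ?thesis by (rule that)
  qed
  then show "\<exists>f'. (f' = (\<lambda>x. c * complex_of_real x) \<or> (\<exists>c. f' = (\<lambda>x. c))) \<and>
      (\<forall>x. (f has_vector_derivative f' x) (at x))"
    by (intro exI[of _ "\<lambda>x. d"]) auto
  show "\<exists>C m. \<forall>x. norm (f x) \<le> C * (1 + \<bar>x\<bar>) ^ m"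
    using f
  proof
    assume "f = (\<lambda>x. c * complex_of_real x)"
    then show ?thesis
      by (intro exI[of _ "norm c"] exI[of _ 1]) (simp add: norm_mult mult_left_mono)
  next
    assume "\<exists>c. f = (\<lambda>x. c)"
    then show ?thesis using moderate_bound[OF moderate_const] by blast
  qed
qed blast

lemma schwartz_cmult: "f \<in> schwartz \<Longrightarrow> (\<lambda>x. c * f x) \<in> schwartz"
  using schwartz_mult_moderate[OF _ moderate_const, of f c] by (simp add: mult.commute)

lemma schwartz_times_x: "f \<in> schwartz \<Longrightarrow> (\<lambda>x. c * complex_of_real x * f x) \<in> schwartz"
  using schwartz_mult_moderate[OF _ moderate_linear[of c]] by (simp add: mult.commute)

lemma schwartz_diff: "f \<in> schwartz \<Longrightarrow> g \<in> schwartz \<Longrightarrow> (\<lambda>x. f x - g x) \<in> schwartz"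
  using schwartz_add[of f "\<lambda>x. - 1 * g x"] schwartz_cmult[of g "- 1"] by simp

lemma schwartz_affine:
  assumes "\<phi> \<in> schwartz" "b \<noteq> 0"
  shows "(\<lambda>x. \<phi> (a + b * x)) \<in> schwartz"
proof (rule schwartz_coinduct[of "\<lambda>h. \<exists>\<phi>\<in>schwartz. h = (\<lambda>x. \<phi> (a + b * x))"])
  show "\<exists>\<phi>'\<in>schwartz. (\<lambda>x. \<phi> (a + b * x)) = (\<lambda>x. \<phi>' (a + b * x))"
    using assms by blast
next
  fix h :: "real \<Rightarrow> complex"
  assume "\<exists>\<phi>\<in>schwartz. h = (\<lambda>x. \<phi> (a + b * x))"
  then obtain \<phi> where h: "\<phi> \<in> schwartz" "h = (\<lambda>x. \<phi> (a + b * x))" by blast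
  have "(h has_vector_derivative b *\<^sub>R D \<phi> (a + b * x)) (at x)" for x
    unfolding h(2)
    by (rule vector_diff_chain_at[of "\<lambda>x. a + b * x", unfolded o_def])
       (auto intro!: derivative_eq_intros schwartz_has_vector_derivative h)
  moreover have "(\<lambda>x. b *\<^sub>R D \<phi> x) \<in> schwartz"
    using schwartz_cmult[OF schwartz_D[OF h(1)], of b] by (simp add: scaleR_conv_of_real)
  ultimately show "\<exists>h'. (\<exists>\<phi>\<in>schwartz. h' = (\<lambda>x. \<phi> (a + b * x))) \<and>
      (\<forall>x. (h has_vector_derivative h' x) (at x))"
    by (intro exI[of _ "\<lambda>x. b *\<^sub>R D \<phi> (a + b * x)"] conjI) auto
  fix j
  obtain C where C: "\<And>x. (1 + \<bar>x\<bar>) ^ j * norm (\<phi> x) \<le> C"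
    using schwartz_weighted_bound h(1) by meson
  define M where "M = (1 + \<bar>a\<bar>) / \<bar>b\<bar>"
  have "\<bar>x\<bar> ^ j * norm (h x) \<le> M ^ j * C" for x
  proof -
    have "\<bar>b\<bar> * \<bar>x\<bar> \<le> \<bar>a + b * x\<bar> + \<bar>a\<bar>"
      using abs_triangle_ineq4[of "a + b * x" a] by (simp add: abs_mult)
    also have "\<dots> \<le> (1 + \<bar>a\<bar>) * (1 + \<bar>a + b * x\<bar>)"
      by (simp add: algebra_simps)
    finally have "\<bar>x\<bar> \<le> M * (1 + \<bar>a + b * x\<bar>)"
      using assms(2) by (simp add: M_def field_simps)
    then have "\<bar>x\<bar> ^ j \<le> M ^ j * (1 + \<bar>a + b * x\<bar>) ^ j"
      by (metis abs_ge_zero power_mono power_mult_distrib)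
    then have "\<bar>x\<bar> ^ j * norm (h x) \<le> M ^ j * (1 + \<bar>a + b * x\<bar>) ^ j * norm (h x)"
      by (rule mult_right_mono) simp
    also have "\<dots> \<le> M ^ j * C"
      using C[of "a + b * x"] unfolding h(2) mult.assoc by (intro mult_left_mono) (auto simp: M_def)
    finally show ?thesis .
  qed
  then show "\<exists>C. \<forall>x. \<bar>x\<bar> ^ j * norm (h x) \<le> C" by blast
qed

text \<open>The induction class uses \<open>R < |x|\<close> instead of \<open>R \<le> |x|\<close>: on an open set of zeros the derivative
vanishes as well.\<close>
lemma schwartz_if_compactly_supported:
  assumes "smooth_on UNIV \<phi>" and "\<And>x. R \<le> \<bar>x\<bar> \<Longrightarrow> \<phi> x = 0"
  shows "\<phi> \<in> schwartz"
proof (rule schwartz_coinduct[of "\<lambda>f. smooth_on UNIV f \<and> (\<forall>x. R < \<bar>x\<bar> \<longrightarrow> f x = 0)"])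
  fix f :: "real \<Rightarrow> complex"
  assume f: "smooth_on UNIV f \<and> (\<forall>x. R < \<bar>x\<bar> \<longrightarrow> f x = 0)"
  have "D f x = 0" if "R < \<bar>x\<bar>" for x
  proof -
    have "open (- {- R..R})"
      by (intro open_Compl closed_atLeastAtMost)
    moreover have "0 = f y" if "y \<in> - {- R..R}" for y
      using that f by (auto simp: abs_le_iff)
    ultimately have "(f has_vector_derivative 0) (at x)"
      using that by (intro has_vector_derivative_transform_within_open[OF has_vector_derivative_const]) auto
    then show ?thesis by (simp add: vector_derivative_at)
  qed
  then show "\<exists>f'. (smooth_on UNIV f' \<and> (\<forall>x. R < \<bar>x\<bar> \<longrightarrow> f' x = 0)) \<and>
      (\<forall>x. (f has_vector_derivative f' x) (at x))"
    using f by (intro exI[of _ "D f"]) (auto simp: smooth_on_D smooth_on_has_vector_derivative)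
  fix j
  have "continuous_on {- \<bar>R\<bar>..\<bar>R\<bar>} (\<lambda>x. \<bar>x\<bar> ^ j * norm (f x))"
    using f by (intro continuous_intros smooth_on_imp_continuous_on) auto
  then have "bounded ((\<lambda>x. \<bar>x\<bar> ^ j * norm (f x)) ` {- \<bar>R\<bar>..\<bar>R\<bar>})"
    by (intro compact_imp_bounded compact_continuous_image) auto
  then obtain C where C: "\<And>x. x \<in> {- \<bar>R\<bar>..\<bar>R\<bar>} \<Longrightarrow> \<bar>x\<bar> ^ j * norm (f x) \<le> C"
    unfolding bounded_iff by fastforce
  have "\<bar>x\<bar> ^ j * norm (f x) \<le> max 0 C" for x
  proof (cases "x \<in> {- \<bar>R\<bar>..\<bar>R\<bar>}")
    case False
    then have "R < \<bar>x\<bar>" by auto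
    then show ?thesis using f by simp
  qed (use C in \<open>simp add: le_max_iff_disj\<close>)
  then show "\<exists>C. \<forall>x. \<bar>x\<bar> ^ j * norm (f x) \<le> C" by blast
qed (use assms in auto)

section \<open>The Fourier transform\<close>

lemma borel_measurable_cis [measurable]: "cis \<in> borel_measurable borel"
  by (intro borel_measurable_continuous_onI continuous_intros)

lemma vector_derivative_bound:
  fixes f :: "real \<Rightarrow> 'a::real_normed_vector"
  assumes "\<And>x. x \<in> S \<Longrightarrow> (f has_vector_derivative f' x) (at x within S)"
    and "\<And>x. x \<in> S \<Longrightarrow> norm (f' x) \<le> B" and "convex S" "a \<in> S" "b \<in> S"
  shows "norm (f b - f a) \<le> B * \<bar>b - a\<bar>"
proof -
  have "onorm (\<lambda>h. h *\<^sub>R f' x) \<le> B" if "x \<in> S" for x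
  proof (rule onorm_bound)
    show "0 \<le> B" using assms(2)[OF that] norm_ge_zero order_trans by blast
    show "norm (h *\<^sub>R f' x) \<le> B * norm h" for h :: real
      using mult_right_mono[OF assms(2)[OF that], of "\<bar>h\<bar>"] by (simp add: mult.commute)
  qed
  then show ?thesis
    using differentiable_bound[of S f "\<lambda>x h. h *\<^sub>R f' x" B b a] assms
    by (simp add: has_vector_derivative_def)
qed

text \<open>Differentiation under the integral sign, by dominated convergence: the difference quotients are
bounded by the dominating function because of the mean value inequality.\<close>
lemma has_vector_derivative_integral:
  fixes F F' :: "real \<Rightarrow> real \<Rightarrow> complex"
  assumes F: "\<And>x. integrable lborel (F x)"
    and F': "\<And>x t. ((\<lambda>x. F x t) has_vector_derivative F' x t) (at x)"
    and F'_meas: "\<And>x. F' x \<in> borel_measurable lborel"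
    and bound: "\<And>x t. norm (F' x t) \<le> G t" and G: "integrable lborel G"
  shows "((\<lambda>x. LINT t|lborel. F x t) has_vector_derivative (LINT t|lborel. F' x t)) (at x)"
  unfolding has_vector_derivative_def has_derivative_at
proof
  have F'_int: "integrable lborel (F' x)"
    by (rule Bochner_Integration.integrable_bound[OF G F'_meas]) (use bound abs_ge_self order_trans in \<open>auto, blast\<close>)
  \<comment> \<open>\<open>Q h t\<close> is the error of the linear approximation divided by \<open>h\<close>; it tends to 0 and is at most \<open>2 G t\<close>.\<close>
  define Q where "Q h t = (F (x + h) t - F x t - h *\<^sub>R F' x t) /\<^sub>R h" for h t
  have Q_bound: "norm (Q h t) \<le> 2 * G t" if "h \<noteq> 0" for h t
  proof -
    have "norm (F (x + h) t - F x t) \<le> G t * \<bar>x + h - x\<bar>"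
      by (rule vector_derivative_bound[of UNIV _ "\<lambda>x. F' x t"]) (auto simp: F' bound)
    then have "norm (F (x + h) t - F x t - h *\<^sub>R F' x t) \<le> G t * \<bar>h\<bar> + G t * \<bar>h\<bar>"
      using bound[of x t] mult_right_mono[OF bound[of x t], of "\<bar>h\<bar>"]
      by (intro order_trans[OF norm_triangle_ineq4[of "F (x + h) t - F x t" "h *\<^sub>R F' x t"]] add_mono)
         (auto simp: mult.commute)
    moreover have "norm (Q h t) = norm (F (x + h) t - F x t - h *\<^sub>R F' x t) / \<bar>h\<bar>"
      unfolding Q_def norm_scaleR by (simp add: divide_inverse mult.commute)
    ultimately show ?thesis using that by (simp add: pos_divide_le_eq)
  qed
  have Q_lim: "(\<lambda>h. Q h t) \<midarrow>0\<rightarrow> 0" for t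
    using F'[of t x] unfolding has_vector_derivative_def has_derivative_at Q_def
    by (subst tendsto_norm_zero_iff[symmetric]) (simp add: divide_inverse mult.commute)
  have Q_int: "integrable lborel (Q h)" for h
    unfolding Q_def using F F'_int by simp
  have "(\<lambda>h. LINT t|lborel. Q h t) \<midarrow>0\<rightarrow> (LINT (t::real)|lborel. 0)"
    unfolding tendsto_at_iff_sequentially comp_def
  proof (intro allI impI)
    fix X :: "nat \<Rightarrow> real" assume X: "\<forall>i. X i \<in> UNIV - {0}" "X \<longlonglongrightarrow> 0"
    show "(\<lambda>i. LINT t|lborel. Q (X i) t) \<longlonglongrightarrow> (LINT (t::real)|lborel. 0)"
    proof (rule integral_dominated_convergence[where f = "\<lambda>t. 0" and w = "\<lambda>t. 2 * G t"
          and s = "\<lambda>i. Q (X i)"])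
      show "AE t in lborel. (\<lambda>i. Q (X i) t) \<longlonglongrightarrow> 0"
        using Q_lim X unfolding tendsto_at_iff_sequentially comp_def by auto
    qed (use Q_bound X G Q_int in \<open>auto simp: integrable_iff_bounded\<close>)
  qed
  moreover have "norm (LINT t|lborel. Q h t) =
      norm ((LINT t|lborel. F (x + h) t) - (LINT t|lborel. F x t) - h *\<^sub>R (LINT t|lborel. F' x t)) / norm h" for h
    unfolding Q_def using F F'_int by (simp add: divide_inverse mult.commute)
  ultimately show "(\<lambda>h. norm ((LINT t|lborel. F (x + h) t) - (LINT t|lborel. F x t) -
      h *\<^sub>R (LINT t|lborel. F' x t)) / norm h) \<midarrow>0\<rightarrow> 0"
    using tendsto_norm_zero by fastforce
qed (rule bounded_linear_scaleR_left)

lemma fourier_cis: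
  "fourier \<phi> \<xi> = complex_of_real (1 / (2 * pi)) * (LINT x|lborel. \<phi> x * cis (- (\<xi> * x)))"
  by (simp add: fourier_def cis_conv_exp)

lemma integrable_times_cis:
  assumes "integrable lborel w" "g \<in> borel_measurable lborel"
  shows "integrable lborel (\<lambda>x. w x * cis (g x))"
  by (rule Bochner_Integration.integrable_bound[OF assms(1)])
     (use assms borel_measurable_integrable[OF assms(1)] in \<open>auto simp: norm_mult\<close>)

lemma norm_fourier_le: "norm (fourier w \<xi>) \<le> 1 / (2 * pi) * (LINT x|lborel. norm (w x))"
proof -
  have "norm (LINT x|lborel. w x * cis (- (\<xi> * x))) \<le> (LINT x|lborel. norm (w x * cis (- (\<xi> * x))))"
    by (rule integral_norm_bound)
  then show ?thesis by (simp add: fourier_cis norm_mult norm_divide divide_right_mono)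
qed

lemma fourier_has_vector_derivative:
  assumes "integrable lborel w" "integrable lborel (\<lambda>x. complex_of_real x * w x)"
  shows "(fourier w has_vector_derivative fourier (\<lambda>x. - \<i> * complex_of_real x * w x) \<xi>) (at \<xi>)"
proof -
  have [measurable]: "w \<in> borel_measurable borel"
    using borel_measurable_integrable[OF assms(1)] by simp
  have "((\<lambda>\<xi>. LINT x|lborel. w x * cis (- (\<xi> * x))) has_vector_derivative
      (LINT x|lborel. (- \<i> * complex_of_real x * w x) * cis (- (\<xi> * x)))) (at \<xi>)"
  proof (rule has_vector_derivative_integral[where G = "\<lambda>x. norm (complex_of_real x * w x)"])
    show "((\<lambda>\<xi>. w x * cis (- (\<xi> * x))) has_vector_derivative
        (- \<i> * complex_of_real x * w x) * cis (- (\<xi> * x))) (at \<xi>)" for \<xi> x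
      unfolding has_vector_derivative_def
      by (auto intro!: derivative_eq_intros simp: scaleR_conv_of_real)
    show "integrable lborel (\<lambda>x. norm (complex_of_real x * w x))"
      using assms(2) by (rule integrable_norm)
  qed (use assms in \<open>auto intro!: integrable_times_cis simp: norm_mult\<close>)
  then show ?thesis
    unfolding fourier_cis[abs_def] by (rule has_vector_derivative_mult_right)
qed

text \<open>Integrability of all moments makes the Fourier transform smooth with bounded derivatives. Besides
Schwartz functions, this covers the merely Lipschitz functions of compact support that get mollified below.\<close>
definition rapidly_integrable :: "(real \<Rightarrow> complex) \<Rightarrow> bool" where
  "rapidly_integrable w \<longleftrightarrow> (\<forall>j. integrable lborel (\<lambda>x. complex_of_real x ^ j * w x))"

lemma rapidly_integrableD:
  assumes "rapidly_integrable w"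
  shows "integrable lborel w" "integrable lborel (\<lambda>x. complex_of_real x * w x)"
  using assms[unfolded rapidly_integrable_def, rule_format, of 0]
    assms[unfolded rapidly_integrable_def, rule_format, of 1] by simp_all

lemma moderate_fourier:
  assumes "rapidly_integrable w"
  shows "moderate (fourier w)"
proof (rule moderate_coinduct[of "\<lambda>f. \<exists>w. rapidly_integrable w \<and> f = fourier w"])
  fix f assume "\<exists>w. rapidly_integrable w \<and> f = fourier w"
  then obtain w where w: "rapidly_integrable w" "f = fourier w" by blast
  have "integrable lborel (\<lambda>x. - \<i> * (complex_of_real x ^ Suc j * w x))" for j
    using w(1) unfolding rapidly_integrable_def by (intro integrable_mult_right) blast
  then have "rapidly_integrable (\<lambda>x. - \<i> * complex_of_real x * w x)"
    unfolding rapidly_integrable_def by (simp add: mult_ac)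
  then show "\<exists>f'. (\<exists>w. rapidly_integrable w \<and> f' = fourier w) \<and>
      (\<forall>x. (f has_vector_derivative f' x) (at x))"
    using fourier_has_vector_derivative[OF rapidly_integrableD[OF w(1)]] w(2) by blast
  show "\<exists>C m. \<forall>x. norm (f x) \<le> C * (1 + \<bar>x\<bar>) ^ m"
    unfolding w(2) using norm_fourier_le
    by (intro exI[of _ "1 / (2 * pi) * (LINT x|lborel. norm (w x))"] exI[of _ 0]) simp
qed (use assms in blast)

lemma integrable_inverse_one_plus_square: "integrable lborel (\<lambda>x::real. inverse (1 + x\<^sup>2))"
  using integrable_inverse_1_plus_square by (simp add: einterval_eq_UNIV set_integrable_def)

lemma integral_inverse_one_plus_square: "(LINT x|lborel. inverse (1 + x\<^sup>2)) = pi"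
  using LBINT_inverse_1_plus_square
  by (simp add: einterval_eq_UNIV interval_lebesgue_integral_def set_lebesgue_integral_def)

lemma borel_measurable_schwartz: "\<phi> \<in> schwartz \<Longrightarrow> \<phi> \<in> borel_measurable borel"
  by (intro borel_measurable_continuous_onI smooth_on_imp_continuous_on schwartz_smooth)

text \<open>Decay like \<open>1 / (1 + x\<^sup>2)\<close>, whose integral is \<open>\<pi>\<close>, bounds the \<open>L\<^sup>1\<close> norm by Schwartz seminorms.\<close>
lemma schwartz_integrable_norm_le:
  assumes \<phi>: "\<phi> \<in> schwartz" and C: "\<And>x. (1 + x\<^sup>2) * norm (\<phi> x) \<le> C"
  shows "integrable lborel \<phi>" "(LINT x|lborel. norm (\<phi> x)) \<le> pi * C"
proof -
  have le: "norm (\<phi> x) \<le> C * inverse (1 + x\<^sup>2)" for x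
    using C[of x] by (simp add: field_simps add_pos_nonneg)
  have int: "integrable lborel (\<lambda>x::real. C * inverse (1 + x\<^sup>2))"
    using integrable_inverse_one_plus_square by simp
  show \<phi>_int: "integrable lborel \<phi>"
    by (rule Bochner_Integration.integrable_bound[OF int])
       (use le \<phi> borel_measurable_schwartz in \<open>auto intro: order_trans[OF _ abs_ge_self]\<close>)
  have "(LINT x|lborel. norm (\<phi> x)) \<le> (LINT x|lborel. C * inverse (1 + x\<^sup>2))"
    using \<phi>_int int le by (intro integral_mono) auto
  then show "(LINT x|lborel. norm (\<phi> x)) \<le> pi * C"
    by (simp add: integral_inverse_one_plus_square mult.commute)
qed

lemma schwartz_integrable:
  assumes "\<phi> \<in> schwartz"
  shows "integrable lborel \<phi>"
proof -
  obtain C where C: "\<And>x. (1 + \<bar>x\<bar>) ^ 2 * norm (\<phi> x) \<le> C"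
    using schwartz_weighted_bound[OF assms] by blast
  have "(1 + x\<^sup>2) * norm (\<phi> x) \<le> C" for x
  proof -
    have "1 + x\<^sup>2 \<le> (1 + \<bar>x\<bar>)\<^sup>2" by (simp add: power2_sum)
    from mult_right_mono[OF this norm_ge_zero] C[of x] show ?thesis by (rule order_trans)
  qed
  then show ?thesis by (rule schwartz_integrable_norm_le[OF assms])
qed

lemma schwartz_rapidly_integrable:
  assumes "\<phi> \<in> schwartz"
  shows "rapidly_integrable \<phi>"
proof -
  have "(\<lambda>x. complex_of_real x ^ j * \<phi> x) \<in> schwartz" for j
  proof (induction j)
    case (Suc j)
    show ?case using schwartz_times_x[OF Suc, of 1] by (simp add: mult.assoc)
  qed (simp add: assms)
  then show ?thesis by (simp add: rapidly_integrable_def schwartz_integrable)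
qed

lemmas schwartz_integrable_times_x = rapidly_integrableD(2)[OF schwartz_rapidly_integrable]

lemma schwartz_tendsto_zero:
  assumes "\<phi> \<in> schwartz"
  shows "(\<phi> \<longlongrightarrow> 0) at_top" "(\<phi> \<longlongrightarrow> 0) at_bot"
proof -
  obtain C where C: "\<And>x. \<bar>x\<bar> ^ 1 * norm (\<phi> x) \<le> C"
    using schwartz_bound[OF assms] by blast
  have le: "norm (\<phi> x) \<le> C / \<bar>x\<bar>" if "x \<noteq> 0" for x
    using C[of x] that by (simp add: field_simps)
  have top: "((\<lambda>x::real. C / \<bar>x\<bar>) \<longlongrightarrow> 0) at_top" and bot: "((\<lambda>x::real. C / \<bar>x\<bar>) \<longlongrightarrow> 0) at_bot"
    by (auto intro!: real_tendsto_divide_at_top[OF tendsto_const] filterlim_abs_real filterlim_at_bot_mirror[THEN iffD2])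
  show "(\<phi> \<longlongrightarrow> 0) at_top"
    by (rule Lim_null_comparison[OF _ top]) (auto intro: eventually_mono[OF eventually_gt_at_top[of 0]] le)
  show "(\<phi> \<longlongrightarrow> 0) at_bot"
    by (rule Lim_null_comparison[OF _ bot]) (auto intro: eventually_mono[OF eventually_gt_at_bot[of 0]] le)
qed

text \<open>The fundamental theorem of calculus on the whole line. Applied to \<open>\<phi>(x) e\<^sup>-\<^sup>i\<^sup>\<xi>\<^sup>x\<close>, it is the
integration by parts behind \<open>fourier_D\<close>.\<close>
lemma integral_schwartz_D_eq_zero:
  assumes "\<phi> \<in> schwartz"
  shows "(LINT x|lborel. D \<phi> x) = 0"
proof -
  have "(LBINT x=-\<infinity>..\<infinity>. D \<phi> x) = 0 - 0"
  proof (rule interval_integral_FTC_integrable[where F = \<phi>])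
    show "isCont (D \<phi>) x" for x
      using has_vector_derivative_continuous schwartz_D[OF assms] schwartz_has_vector_derivative by blast
    show "set_integrable lborel (einterval (- \<infinity>) \<infinity>) (D \<phi>)"
      by (simp add: einterval_eq_UNIV set_integrable_def schwartz_integrable schwartz_D assms)
  qed (use schwartz_tendsto_zero[OF assms] schwartz_has_vector_derivative[OF assms] in
       \<open>auto simp: ereal_tendsto_simps\<close>)
  then show ?thesis
    by (simp add: einterval_eq_UNIV interval_lebesgue_integral_def set_lebesgue_integral_def)
qed

lemma has_vector_derivative_cis_linear:
  "((\<lambda>x. cis (a * x)) has_vector_derivative \<i> * complex_of_real a * cis (a * x)) (at x)"
  unfolding has_vector_derivative_def
  by (auto intro!: derivative_eq_intros simp: scaleR_conv_of_real)

lemma moderate_cis: "moderate (\<lambda>x. cis (a * x))"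
proof (rule moderate_coinduct[of "\<lambda>f. \<exists>c. f = (\<lambda>x. c * cis (a * x))"])
  fix f :: "real \<Rightarrow> complex" assume "\<exists>c. f = (\<lambda>x. c * cis (a * x))"
  then obtain c where c: "f = (\<lambda>x. c * cis (a * x))" by blast
  have "(f has_vector_derivative (c * \<i> * complex_of_real a) * cis (a * x)) (at x)" for x
    using has_vector_derivative_mult_right[OF has_vector_derivative_cis_linear[of a x], of c]
    unfolding c by (simp add: mult.assoc)
  then show "\<exists>f'. (\<exists>c. f' = (\<lambda>x. c * cis (a * x))) \<and> (\<forall>x. (f has_vector_derivative f' x) (at x))"
    by (intro exI[of _ "\<lambda>x. (c * \<i> * complex_of_real a) * cis (a * x)"]) blast
  show "\<exists>C m. \<forall>x. norm (f x) \<le> C * (1 + \<bar>x\<bar>) ^ m"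
    by (intro exI[of _ "norm c"] exI[of _ 0]) (simp add: c norm_mult)
qed (rule exI[of _ 1], simp)

lemma fourier_D:
  assumes "\<phi> \<in> schwartz"
  shows "fourier (D \<phi>) \<xi> = \<i> * complex_of_real \<xi> * fourier \<phi> \<xi>"
proof -
  let ?e = "\<lambda>x. cis (- \<xi> * x)"
  have prod: "(\<lambda>x. \<phi> x * ?e x) \<in> schwartz"
    by (intro schwartz_mult_moderate assms moderate_cis)
  have "D (\<lambda>x. \<phi> x * ?e x) = (\<lambda>x. \<phi> x * (\<i> * complex_of_real (- \<xi>) * ?e x) + D \<phi> x * ?e x)"
    by (intro D_eqI has_vector_derivative_mult schwartz_has_vector_derivative assms
        has_vector_derivative_cis_linear)
  then have "0 = (LINT x|lborel. - \<i> * complex_of_real \<xi> * (\<phi> x * ?e x) + D \<phi> x * ?e x)"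
    using integral_schwartz_D_eq_zero[OF prod] by (simp add: mult_ac)
  also have "\<dots> = - \<i> * complex_of_real \<xi> * (LINT x|lborel. \<phi> x * ?e x) + (LINT x|lborel. D \<phi> x * ?e x)"
    using schwartz_integrable[OF prod] schwartz_integrable[OF schwartz_D[OF assms]]
    by (subst Bochner_Integration.integral_add) (auto intro!: integrable_times_cis)
  finally show ?thesis
    by (simp add: fourier_cis algebra_simps)
qed

text \<open>Differentiating the transform multiplies the function by \<open>-i x\<close>, which keeps it in the Schwartz
space; multiplying the transform by \<open>i \<xi>\<close> differentiates the function. So transforms of Schwartz functions
form a class closed under differentiation, all of whose members decay rapidly.\<close>
lemma schwartz_fourier:
  assumes "\<phi> \<in> schwartz"
  shows "fourier \<phi> \<in> schwartz"
proof (rule schwartz_coinduct[of "\<lambda>f. \<exists>\<phi>\<in>schwartz. f = fourier \<phi>"])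
  fix f assume "\<exists>\<phi>\<in>schwartz. f = fourier \<phi>"
  then obtain \<phi> where \<phi>: "\<phi> \<in> schwartz" "f = fourier \<phi>" by blast
  show "\<exists>f'. (\<exists>\<phi>\<in>schwartz. f' = fourier \<phi>) \<and> (\<forall>x. (f has_vector_derivative f' x) (at x))"
    using fourier_has_vector_derivative[OF schwartz_integrable schwartz_integrable_times_x, OF \<phi>(1) \<phi>(1)]
      schwartz_times_x[OF \<phi>(1)] \<phi>(2) by blast
  have "\<exists>C. \<forall>\<xi>. \<bar>\<xi>\<bar> ^ j * norm (fourier \<phi> \<xi>) \<le> C" if "\<phi> \<in> schwartz" for j \<phi>
    using that
  proof (induction j arbitrary: \<phi>)
    case 0
    then show ?case using norm_fourier_le by auto
  next
    case (Suc j)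
    then obtain C where "\<And>\<xi>. \<bar>\<xi>\<bar> ^ j * norm (fourier (D \<phi>) \<xi>) \<le> C"
      using schwartz_D by meson
    then show ?case
      by (intro exI[of _ C]) (simp add: fourier_D Suc norm_mult mult_ac)
  qed
  then show "\<exists>C. \<forall>x. \<bar>x\<bar> ^ j * norm (f x) \<le> C" for j
    using \<phi> by blast
qed (use assms in blast)

section \<open>Fourier inversion\<close>

lemma lborel_Fubini_dominated:
  fixes k :: "real \<Rightarrow> real \<Rightarrow> complex" and a b :: "real \<Rightarrow> real"
  assumes k: "case_prod k \<in> borel_measurable (lborel \<Otimes>\<^sub>M lborel)"
    and a: "integrable lborel a" and b: "integrable lborel b"
    and le: "\<And>x y. norm (k x y) \<le> a x * b y"
  shows "(LINT y|lborel. (LINT x|lborel. k x y)) = (LINT x|lborel. (LINT y|lborel. k x y))"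
proof (rule lborel_pair.Fubini_integral)
  have int_k: "integrable lborel (\<lambda>y. k x y)" for x
  proof (rule Bochner_Integration.integrable_bound)
    show "integrable lborel (\<lambda>y. a x * b y)" using b by simp
    show "(\<lambda>y. k x y) \<in> borel_measurable lborel"
      using measurable_compose_Pair1[OF _ k, of x] by simp
    show "AE y in lborel. norm (k x y) \<le> norm (a x * b y)"
      using le by (auto intro: order_trans[OF _ abs_ge_self])
  qed
  show "integrable (lborel \<Otimes>\<^sub>M lborel) (case_prod k)"
  proof (rule lborel_pair.Fubini_integrable[OF k])
    show "AE x in lborel. integrable lborel (\<lambda>y. case_prod k (x, y))"
      using int_k by simp
    show "integrable lborel (\<lambda>x. LINT y|lborel. norm (case_prod k (x, y)))"
    proof (rule Bochner_Integration.integrable_bound)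
      show "integrable lborel (\<lambda>x. a x * (LINT y|lborel. b y))" using a by simp
      show "(\<lambda>x. LINT y|lborel. norm (case_prod k (x, y))) \<in> borel_measurable lborel"
        using k by (intro lborel.borel_measurable_lebesgue_integral) simp
      have "(LINT y|lborel. norm (k x y)) \<le> a x * (LINT y|lborel. b y)" for x
      proof -
        have "(LINT y|lborel. norm (k x y)) \<le> (LINT y|lborel. a x * b y)"
          using int_k b le by (intro integral_mono) auto
        then show ?thesis by simp
      qed
      then show "AE x in lborel. norm (LINT y|lborel. norm (case_prod k (x, y))) \<le>
          norm (a x * (LINT y|lborel. b y))"
        by (auto intro: order_trans[OF _ abs_ge_self])
    qed
  qed
qed

text \<open>The deviation \<open>|f(x - \<delta>z) - f(x)| \<le> L \<delta> |z|\<close> is integrated against \<open>K\<close>. This linear rate serves three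
purposes: Gaussian \<open>K\<close> gives Fourier inversion, compactly supported \<open>K\<close> recovers a transform from its
pairings with test functions, and \<open>K\<close> with compactly supported transform produces band-limited
approximations.\<close>
lemma norm_approximate_identity_le:
  fixes f K :: "real \<Rightarrow> complex"
  assumes f: "\<And>x y. norm (f x - f y) \<le> L * \<bar>x - y\<bar>"
    and K: "integrable lborel K" "integrable lborel (\<lambda>z. complex_of_real z * K z)"
    and K1: "(LINT z|lborel. K z) = 1" and \<delta>: "0 \<le> \<delta>"
  shows "norm ((LINT z|lborel. f (x - \<delta> * z) * K z) - f x) \<le>
    L * \<delta> * (LINT z|lborel. norm (complex_of_real z * K z))"
proof -
  have "continuous_on UNIV f"
  proof (rule continuous_on_iff[THEN iffD2], intro ballI allI impI)
    fix x e :: real assume "0 < e"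
    have "dist (f y) (f x) < e" if "dist y x < e / (\<bar>L\<bar> + 1)" for y
    proof -
      have "dist (f y) (f x) \<le> (\<bar>L\<bar> + 1) * \<bar>y - x\<bar>"
        unfolding dist_norm by (rule order_trans[OF f mult_right_mono]) auto
      also have "\<dots> < e"
        using that by (simp add: dist_real_def pos_less_divide_eq mult.commute)
      finally show ?thesis .
    qed
    then show "\<exists>d>0. \<forall>x'\<in>UNIV. dist x' x < d \<longrightarrow> dist (f x') (f x) < e"
      using \<open>0 < e\<close> by (intro exI[of _ "e / (\<bar>L\<bar> + 1)"]) auto
  qed
  then have [measurable]: "f \<in> borel_measurable borel"
    by (rule borel_measurable_continuous_onI)
  have [measurable]: "K \<in> borel_measurable borel"
    using borel_measurable_integrable[OF K(1)] by simp
  have le: "norm ((f (x - \<delta> * z) - f x) * K z) \<le> L * \<delta> * norm (complex_of_real z * K z)" for z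
    using mult_right_mono[OF f[of "x - \<delta> * z" x], of "norm (K z)"] \<delta>
    by (simp add: norm_mult abs_mult mult.assoc)
  have intR: "integrable lborel (\<lambda>z. L * \<delta> * norm (complex_of_real z * K z))"
    using K(2) by (intro integrable_mult_right integrable_norm)
  have int1: "integrable lborel (\<lambda>z. (f (x - \<delta> * z) - f x) * K z)"
    by (rule Bochner_Integration.integrable_bound[OF intR])
       (auto intro!: AE_I2 order_trans[OF le] simp del: norm_mult)
  have int2: "integrable lborel (\<lambda>z. f (x - \<delta> * z) * K z)"
  proof -
    have "integrable lborel (\<lambda>z. (f (x - \<delta> * z) - f x) * K z + f x * K z)"
      using int1 K(1) by (intro Bochner_Integration.integrable_add) auto
    then show ?thesis by (simp add: algebra_simps)
  qed
  have "(LINT z|lborel. f (x - \<delta> * z) * K z) - f x = (LINT z|lborel. (f (x - \<delta> * z) - f x) * K z)"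
  proof -
    have "(LINT z|lborel. (f (x - \<delta> * z) - f x) * K z) = (LINT z|lborel. f (x - \<delta> * z) * K z - f x * K z)"
      by (simp add: algebra_simps)
    also have "\<dots> = (LINT z|lborel. f (x - \<delta> * z) * K z) - (LINT z|lborel. f x * K z)"
      using int2 K(1) by (intro Bochner_Integration.integral_diff) auto
    finally show ?thesis using K1 by simp
  qed
  also have "norm \<dots> \<le> (LINT z|lborel. norm ((f (x - \<delta> * z) - f x) * K z))"
    by (rule integral_norm_bound)
  also have "\<dots> \<le> (LINT z|lborel. L * \<delta> * norm (complex_of_real z * K z))"
    by (intro integral_mono integrable_norm int1 intR le)
  finally show ?thesis by simp
qed

text \<open>Damping the transform by \<open>m(\<delta>\<xi>)\<close> amounts to convolving the function with \<open>K\<close>, the inverse transform of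
\<open>m / (2\<pi>)\<close>, rescaled by \<open>\<delta>\<close>. The damping makes Fubini applicable, although the transform of \<open>f\<close> need not be
integrable.\<close>
lemma integral_fourier_times_multiplier:
  assumes f: "integrable lborel f" and m: "integrable lborel m"
    and K: "\<And>z. K z = 1 / (2 * pi) * (LINT \<xi>|lborel. m \<xi> * cis (\<xi> * z))"
    and \<delta>: "0 < \<delta>"
  shows "(LINT \<xi>|lborel. fourier f \<xi> * m (\<delta> * \<xi>) * cis (\<xi> * x)) = (LINT z|lborel. f (x - \<delta> * z) * K z)"
proof -
  have [measurable]: "f \<in> borel_measurable borel" "m \<in> borel_measurable borel"
    using borel_measurable_integrable f m by auto
  have m\<delta>: "integrable lborel (\<lambda>\<xi>. m (\<delta> * \<xi>))"
    using lborel_integrable_real_affine[OF m, of \<delta> 0] \<delta> by simp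
  have K': "K (t / \<delta>) = 1 / (2 * pi) * \<delta> * (LINT \<xi>|lborel. m (\<delta> * \<xi>) * cis (\<xi> * t))" for t
    using lborel_integral_real_affine[of \<delta> "\<lambda>\<xi>. m \<xi> * cis (\<xi> * (t / \<delta>))" 0] \<delta>
    by (simp add: K scaleR_conv_of_real)
  have cis_split: "cis (- (\<xi> * y)) * cis (\<xi> * x) = cis (\<xi> * (x - y))" for \<xi> y
    by (simp add: cis_mult algebra_simps)
  have "(LINT \<xi>|lborel. fourier f \<xi> * m (\<delta> * \<xi>) * cis (\<xi> * x)) =
      (LINT \<xi>|lborel. 1 / (2 * pi) * (LINT y|lborel. f y * m (\<delta> * \<xi>) * cis (\<xi> * (x - y))))"
  proof (rule Bochner_Integration.integral_cong[OF refl])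
    fix \<xi>
    have "(LINT y|lborel. f y * m (\<delta> * \<xi>) * cis (\<xi> * (x - y))) =
        (LINT y|lborel. m (\<delta> * \<xi>) * cis (\<xi> * x) * (f y * cis (- (\<xi> * y))))"
      unfolding cis_split[symmetric] by (simp add: mult_ac)
    then show "fourier f \<xi> * m (\<delta> * \<xi>) * cis (\<xi> * x) =
        1 / (2 * pi) * (LINT y|lborel. f y * m (\<delta> * \<xi>) * cis (\<xi> * (x - y)))"
      by (simp add: fourier_cis)
  qed
  also have "\<dots> = 1 / (2 * pi) * (LINT \<xi>|lborel. (LINT y|lborel. f y * m (\<delta> * \<xi>) * cis (\<xi> * (x - y))))"
    by (rule integral_mult_right_zero)
  also have "(LINT \<xi>|lborel. (LINT y|lborel. f y * m (\<delta> * \<xi>) * cis (\<xi> * (x - y)))) =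
      (LINT y|lborel. (LINT \<xi>|lborel. f y * m (\<delta> * \<xi>) * cis (\<xi> * (x - y))))"
    by (rule lborel_Fubini_dominated[where a = "\<lambda>y. norm (f y)" and b = "\<lambda>\<xi>. norm (m (\<delta> * \<xi>))"])
       (use f m\<delta> in \<open>auto simp: norm_mult\<close>)
  also have "\<dots> = (LINT y|lborel. f y * (2 * pi / \<delta> * K ((x - y) / \<delta>)))"
    using \<delta> by (simp add: K' mult.assoc)
  also have "\<dots> = \<delta> *\<^sub>R (LINT z|lborel. f (x - \<delta> * z) * (2 * pi / \<delta> * K z))"
    using \<delta> by (subst lborel_integral_real_affine[of "- \<delta>" _ x]) auto
  also have "1 / (2 * pi) * \<dots> = (LINT z|lborel. f (x - \<delta> * z) * K z)"
    using \<delta> by (simp add: scaleR_conv_of_real mult.assoc mult.left_commute[of "f _"])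
  finally show ?thesis .
qed

lemma schwartz_Lipschitz:
  assumes "\<phi> \<in> schwartz"
  obtains L where "\<And>x y. norm (\<phi> x - \<phi> y) \<le> L * \<bar>x - y\<bar>"
proof -
  obtain L where L: "\<And>x. \<bar>x\<bar> ^ 0 * norm (D \<phi> x) \<le> L"
    using schwartz_bound[OF schwartz_D[OF assms]] by blast
  have "norm (\<phi> x - \<phi> y) \<le> L * \<bar>x - y\<bar>" for x y
    by (rule vector_derivative_bound[of UNIV _ "D \<phi>"])
       (use L in \<open>simp_all add: schwartz_has_vector_derivative assms\<close>)
  then show ?thesis by (rule that)
qed

text \<open>The transform of the Gaussian, read off from the characteristic function of the standard normal
distribution.\<close>
lemma integral_gaussian_cis:
  "(LINT \<xi>|lborel. complex_of_real (exp (- \<xi>\<^sup>2 / 2)) * cis (\<xi> * z)) =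
     complex_of_real (2 * pi * std_normal_density z)"
proof -
  have "complex_of_real (exp (- z\<^sup>2 / 2)) = (LINT \<xi>|lborel. std_normal_density \<xi> *\<^sub>R iexp (z * \<xi>))"
    unfolding char_std_normal_distribution[THEN fun_cong, symmetric] char_def
    by (subst integral_density) (auto simp: normal_density_nonneg)
  also have "\<dots> = (LINT \<xi>|lborel. complex_of_real (1 / sqrt (2 * pi)) *
      (complex_of_real (exp (- \<xi>\<^sup>2 / 2)) * cis (\<xi> * z)))"
    by (simp add: std_normal_density_def scaleR_conv_of_real cis_conv_exp mult_ac)
  also have "\<dots> = complex_of_real (1 / sqrt (2 * pi)) *
      (LINT \<xi>|lborel. complex_of_real (exp (- \<xi>\<^sup>2 / 2)) * cis (\<xi> * z))"
    by (rule integral_mult_right_zero)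
  finally have "complex_of_real (sqrt (2 * pi)) * complex_of_real (exp (- z\<^sup>2 / 2)) =
      (LINT \<xi>|lborel. complex_of_real (exp (- \<xi>\<^sup>2 / 2)) * cis (\<xi> * z))"
    by simp
  moreover have "2 * pi * std_normal_density z = sqrt (2 * pi) * exp (- z\<^sup>2 / 2)"
    using real_sqrt_mult_self[of "2 * pi"] by (simp add: std_normal_density_def field_simps)
  ultimately show ?thesis by (metis of_real_mult)
qed

text \<open>Damp the inversion integral by a Gaussian of width \<open>1/\<delta>\<close> and let \<open>\<delta>\<close> tend to 0: the damped integrals
converge to the undamped one by dominated convergence, and to \<open>\<phi> x\<close> because they are averages of \<open>\<phi>\<close> over
a Gaussian of width \<open>\<delta>\<close> around \<open>x\<close>.\<close>
lemma fourier_inversion: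
  assumes \<phi>: "\<phi> \<in> schwartz"
  shows "(LINT \<xi>|lborel. fourier \<phi> \<xi> * cis (\<xi> * x)) = \<phi> x"
proof -
  define K where "K z = complex_of_real (std_normal_density z)" for z
  define m where "m \<xi> = complex_of_real (exp (- \<xi>\<^sup>2 / 2))" for \<xi> :: real
  define \<delta> where "\<delta> n = 1 / real (Suc n)" for n
  have \<delta>_pos: "0 < \<delta> n" for n by (simp add: \<delta>_def)
  have \<delta>_lim: "\<delta> \<longlonglongrightarrow> 0"
    unfolding \<delta>_def using LIMSEQ_inverse_real_of_nat by (simp add: inverse_eq_divide)
  have K_m: "K z = 1 / (2 * pi) * (LINT \<xi>|lborel. m \<xi> * cis (\<xi> * z))" for z
    unfolding K_def m_def integral_gaussian_cis by simp
  have m_int: "integrable lborel m"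
  proof -
    have "integrable lborel (\<lambda>\<xi>. complex_of_real (sqrt (2 * pi) * (std_normal_density \<xi> * \<xi> ^ 0)))"
      using integrable_std_normal_moment[of 0] by (intro integrable_of_real integrable_mult_right)
    then show ?thesis by (simp add: m_def[abs_def] std_normal_density_def)
  qed
  have K_int: "integrable lborel K" "integrable lborel (\<lambda>z. complex_of_real z * K z)"
    using integrable_std_normal_moment[of 0, THEN integrable_of_real[where 'a = complex]]
      integrable_std_normal_moment[of 1, THEN integrable_of_real[where 'a = complex]]
    by (simp_all add: K_def[abs_def] mult.commute)
  have K1: "(LINT z|lborel. K z) = 1"
    unfolding K_def integral_complex_of_real using integral_std_normal_moment_even[of 0] by simp
  have \<phi>'_int: "integrable lborel (fourier \<phi>)"
    by (intro schwartz_integrable schwartz_fourier \<phi>)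
  have [measurable]: "fourier \<phi> \<in> borel_measurable borel"
    using borel_measurable_integrable[OF \<phi>'_int] by simp
  have "(\<lambda>n. LINT \<xi>|lborel. fourier \<phi> \<xi> * m (\<delta> n * \<xi>) * cis (\<xi> * x)) \<longlonglongrightarrow>
      (LINT \<xi>|lborel. fourier \<phi> \<xi> * cis (\<xi> * x))"
  proof (rule integral_dominated_convergence[where w = "\<lambda>\<xi>. norm (fourier \<phi> \<xi>)"])
    show "AE \<xi> in lborel. (\<lambda>n. fourier \<phi> \<xi> * m (\<delta> n * \<xi>) * cis (\<xi> * x)) \<longlonglongrightarrow> fourier \<phi> \<xi> * cis (\<xi> * x)"
    proof (intro AE_I2)
      fix \<xi>
      have "(\<lambda>n. fourier \<phi> \<xi> * m (\<delta> n * \<xi>) * cis (\<xi> * x)) \<longlonglongrightarrow>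
          fourier \<phi> \<xi> * complex_of_real (exp (- (0 * \<xi>)\<^sup>2 / 2)) * cis (\<xi> * x)"
        unfolding m_def by (intro tendsto_intros \<delta>_lim) auto
      then show "(\<lambda>n. fourier \<phi> \<xi> * m (\<delta> n * \<xi>) * cis (\<xi> * x)) \<longlonglongrightarrow> fourier \<phi> \<xi> * cis (\<xi> * x)"
        by simp
    qed
    show "AE \<xi> in lborel. norm (fourier \<phi> \<xi> * m (\<delta> n * \<xi>) * cis (\<xi> * x)) \<le> norm (fourier \<phi> \<xi>)" for n
      by (intro AE_I2) (simp add: norm_mult m_def mult_left_le)
  qed (use \<phi>'_int in \<open>auto simp: m_def[abs_def]\<close>)
  moreover have "(\<lambda>n. LINT \<xi>|lborel. fourier \<phi> \<xi> * m (\<delta> n * \<xi>) * cis (\<xi> * x)) \<longlonglongrightarrow> \<phi> x"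
  proof -
    obtain L where L: "\<And>x y. norm (\<phi> x - \<phi> y) \<le> L * \<bar>x - y\<bar>"
      using schwartz_Lipschitz[OF \<phi>] by blast
    have "(\<lambda>n. L * \<delta> n * (LINT z|lborel. norm (complex_of_real z * K z))) \<longlonglongrightarrow>
        L * 0 * (LINT z|lborel. norm (complex_of_real z * K z))"
      by (intro tendsto_intros \<delta>_lim)
    then have lim: "(\<lambda>n. L * \<delta> n * (LINT z|lborel. norm (complex_of_real z * K z))) \<longlonglongrightarrow> 0" by simp
    have "(\<lambda>n. (LINT z|lborel. \<phi> (x - \<delta> n * z) * K z) - \<phi> x) \<longlonglongrightarrow> 0"
      by (rule Lim_null_comparison[OF always_eventually lim])
         (intro allI norm_approximate_identity_le L K_int K1 less_imp_le[OF \<delta>_pos])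
    then show ?thesis
      unfolding integral_fourier_times_multiplier[OF schwartz_integrable[OF \<phi>] m_int K_m \<delta>_pos]
      by (simp add: LIM_zero_iff)
  qed
  ultimately show ?thesis by (rule LIMSEQ_unique)
qed

lemma integral_fourier_mult_swap:
  assumes a: "integrable lborel a" and b: "integrable lborel b"
  shows "(LINT \<xi>|lborel. fourier a \<xi> * b \<xi>) = (LINT x|lborel. a x * fourier b x)"
proof -
  have [measurable]: "a \<in> borel_measurable borel" "b \<in> borel_measurable borel"
    using borel_measurable_integrable a b by auto
  have "(LINT \<xi>|lborel. fourier a \<xi> * b \<xi>) =
      (LINT \<xi>|lborel. 1 / (2 * pi) * (LINT x|lborel. a x * b \<xi> * cis (- (\<xi> * x))))"
    by (simp add: fourier_cis mult_ac flip: integral_mult_right_zero)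
  also have "\<dots> = 1 / (2 * pi) * (LINT \<xi>|lborel. (LINT x|lborel. a x * b \<xi> * cis (- (\<xi> * x))))"
    by (rule integral_mult_right_zero)
  also have "(LINT \<xi>|lborel. (LINT x|lborel. a x * b \<xi> * cis (- (\<xi> * x)))) =
      (LINT x|lborel. (LINT \<xi>|lborel. a x * b \<xi> * cis (- (\<xi> * x))))"
    by (rule lborel_Fubini_dominated[where a = "\<lambda>x. norm (a x)" and b = "\<lambda>\<xi>. norm (b \<xi>)"])
       (use a b in \<open>auto simp: norm_mult\<close>)
  also have "1 / (2 * pi) * \<dots> = (LINT x|lborel. 1 / (2 * pi) * (LINT \<xi>|lborel. a x * b \<xi> * cis (- (\<xi> * x))))"
    by (rule integral_mult_right_zero[symmetric])
  also have "\<dots> = (LINT x|lborel. a x * fourier b x)"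
    by (simp add: fourier_cis mult_ac flip: integral_mult_right_zero)
  finally show ?thesis .
qed

definition inverse_fourier :: "(real \<Rightarrow> complex) \<Rightarrow> real \<Rightarrow> complex" where
  "inverse_fourier m x = (LINT \<xi>|lborel. m \<xi> * cis (\<xi> * x))"

lemma inverse_fourier_eq: "inverse_fourier m x = 2 * pi * fourier m (- x)"
  by (simp add: inverse_fourier_def fourier_cis mult.commute)

lemma schwartz_inverse_fourier: "m \<in> schwartz \<Longrightarrow> inverse_fourier m \<in> schwartz"
  using schwartz_cmult[OF schwartz_affine[OF schwartz_fourier, of m "-1" 0], of "2 * pi"]
  by (simp add: inverse_fourier_eq[abs_def])

lemma fourier_inverse_fourier:
  assumes "m \<in> schwartz"
  shows "fourier (inverse_fourier m) = m"
proof
  fix \<xi>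
  have "fourier (inverse_fourier m) \<xi> = (LINT x|lborel. fourier m (- x) * cis (\<xi> * - x))"
    by (simp add: fourier_cis inverse_fourier_eq mult.assoc)
  also have "\<dots> = (LINT x|lborel. fourier m x * cis (\<xi> * x))"
    using lborel_integral_real_affine[of "-1" "\<lambda>x. fourier m x * cis (\<xi> * x)" 0] by simp
  finally show "fourier (inverse_fourier m) \<xi> = m \<xi>"
    using fourier_inversion[OF assms] by (simp add: mult.commute)
qed

section \<open>Bump functions\<close>

text \<open>With \<open>q = 1\<close> this is the classical function \<open>exp(-1/x)\<close>, extended by zero. The polynomial factor in \<open>1/x\<close>
makes the family closed under differentiation.\<close>
definition flat :: "real poly \<Rightarrow> real \<Rightarrow> real" where
  "flat q x = (if 0 < x then poly q (1 / x) * exp (- (1 / x)) else 0)"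

lemma tendsto_flat_zero: "(flat q \<longlongrightarrow> 0) (at 0)"
proof (rule filterlim_split_at)
  have "((\<lambda>y. \<Sum>i\<le>degree q. coeff q i * (y ^ i / exp y)) \<longlongrightarrow> (\<Sum>i\<le>degree q. coeff q i * 0)) at_top"
    by (intro tendsto_intros tendsto_power_div_exp_0)
  then have "((\<lambda>y. poly q y * exp (- y)) \<longlongrightarrow> 0) at_top"
    by (simp add: poly_altdef sum_distrib_right exp_minus divide_inverse mult.assoc)
  then have "((\<lambda>x. poly q (inverse x) * exp (- inverse x)) \<longlongrightarrow> 0) (at_right 0)"
    by (rule filterlim_compose[OF _ filterlim_inverse_at_top_right])
  then show "(flat q \<longlongrightarrow> 0) (at_right 0)"
    by (rule Lim_transform_eventually)
       (auto simp: flat_def inverse_eq_divide intro!: eventually_mono[OF eventually_at_right_less[of 0]])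
  show "(flat q \<longlongrightarrow> 0) (at_left 0)"
    by (rule Lim_transform_eventually[OF tendsto_const])
       (auto simp: flat_def eventually_at_filter)
qed

definition flat_deriv_poly :: "real poly \<Rightarrow> real poly" where
  "flat_deriv_poly q = pCons 0 (pCons 0 (q - pderiv q))"

lemma flat_has_real_derivative:
  "(flat q has_real_derivative flat (flat_deriv_poly q) x) (at x)"
proof -
  consider "x < 0" | "x = 0" | "0 < x" by linarith
  then show ?thesis
  proof cases
    case 1
    have "((\<lambda>x. 0 :: real) has_real_derivative flat (flat_deriv_poly q) x) (at x)"
      using 1 by (simp add: flat_def)
    then show ?thesis
      by (rule DERIV_cong_ev[OF refl _ refl, THEN iffD1, rotated])
         (use 1 eventually_nhds_in_open[of "{..<0}" x] in
          \<open>auto simp: flat_def elim!: eventually_mono\<close>)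
  next
    case 2
    have "((\<lambda>h. (flat q (0 + h) - flat q 0) / h) \<longlongrightarrow> 0) (at 0)"
      by (rule Lim_transform_eventually[OF tendsto_flat_zero[of "pCons 0 q"]])
         (auto simp: flat_def eventually_at_filter)
    then show ?thesis
      using 2 by (simp add: DERIV_def flat_def)
  next
    case 3
    have "((\<lambda>x. poly q (1 / x) * exp (- (1 / x))) has_real_derivative
        poly q (1 / x) * (exp (- (1 / x)) * (1 / x\<^sup>2)) + poly (pderiv q) (1 / x) * (- 1 / x\<^sup>2) * exp (- (1 / x))) (at x)"
      using 3
      by (auto intro!: derivative_eq_intros DERIV_chain2[OF poly_DERIV] simp: power2_eq_square field_simps)
    also have "poly q (1 / x) * (exp (- (1 / x)) * (1 / x\<^sup>2)) + poly (pderiv q) (1 / x) * (- 1 / x\<^sup>2) * exp (- (1 / x)) =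
        flat (flat_deriv_poly q) x"
      using 3 by (simp add: flat_def flat_deriv_poly_def power2_eq_square field_simps)
    finally show ?thesis
      by (rule DERIV_cong_ev[OF refl _ refl, THEN iffD1, rotated])
         (use 3 eventually_nhds_in_open[of "{0<..}" x] in
          \<open>auto simp: flat_def elim!: eventually_mono\<close>)
  qed
qed

lemma smooth_on_flat_affine: "smooth_on UNIV (\<lambda>x. complex_of_real (flat q (a + b * x)))"
proof (rule smooth_on_coinduct[of "\<lambda>f. \<exists>q. f = (\<lambda>x. complex_of_real (flat q (a + b * x)))"])
  fix f assume "\<exists>q. f = (\<lambda>x. complex_of_real (flat q (a + b * x)))"
  then obtain q where f: "f = (\<lambda>x. complex_of_real (flat q (a + b * x)))" by blast
  have "((\<lambda>x. flat q (a + b * x)) has_real_derivative flat (smult b (flat_deriv_poly q)) (a + b * x)) (at x)" for x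
  proof -
    have "((\<lambda>x. flat q (a + b * x)) has_real_derivative flat (flat_deriv_poly q) (a + b * x) * b) (at x)"
      by (rule DERIV_chain2[OF flat_has_real_derivative]) (auto intro!: derivative_eq_intros)
    moreover have "flat (flat_deriv_poly q) (a + b * x) * b = flat (smult b (flat_deriv_poly q)) (a + b * x)"
      by (simp add: flat_def)
    ultimately show ?thesis by metis
  qed
  then have "(f has_vector_derivative complex_of_real (flat (smult b (flat_deriv_poly q)) (a + b * x))) (at x)" for x
    unfolding f by (simp add: has_vector_derivative_complex_iff)
  then show "\<exists>f'. (\<exists>q. f' = (\<lambda>x. complex_of_real (flat q (a + b * x)))) \<and>
      (\<forall>x. (f has_vector_derivative f' x) (at x))"
    by blast
qed blast

text \<open>The factor \<open>exp 2\<close> normalises the value at 0, which is the maximum, to 1.\<close>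
definition bump :: "real \<Rightarrow> real" where
  "bump x = exp 2 * (flat 1 (1 + x) * flat 1 (1 - x))"

lemma bump_eq: "\<bar>x\<bar> < 1 \<Longrightarrow> bump x = exp (2 - 2 / (1 - x\<^sup>2))"
proof -
  assume "\<bar>x\<bar> < 1"
  then have x: "0 < 1 + x" "0 < 1 - x" by auto
  have "2 + (- (1 / (1 + x)) + - (1 / (1 - x))) = 2 - 2 / (1 - x\<^sup>2)"
    using x by (simp add: field_simps power2_eq_square)
  then show ?thesis
    using x by (simp add: bump_def flat_def flip: exp_add)
qed

lemma bump_eq_0: "1 \<le> \<bar>x\<bar> \<Longrightarrow> bump x = 0"
  by (auto simp: bump_def flat_def)

lemma bump_0 [simp]: "bump 0 = 1"
  by (simp add: bump_eq)

lemma bump_nonneg: "0 \<le> bump x"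
  by (simp add: bump_def flat_def)

lemma bump_le_1: "bump x \<le> 1"
proof (cases "\<bar>x\<bar> < 1")
  case True
  then have "0 < 1 - x\<^sup>2" by (simp add: abs_square_less_1)
  then have "2 \<le> 2 / (1 - x\<^sup>2)" by (simp add: field_simps)
  then show ?thesis using True by (simp add: bump_eq)
qed (simp add: bump_eq_0)

lemma schwartz_bump: "(\<lambda>x. complex_of_real (bump x)) \<in> schwartz"
proof -
  have "(\<lambda>x. complex_of_real (flat 1 (1 + 1 * x)) * complex_of_real (flat 1 (1 + - 1 * x))) \<in> schwartz"
    by (rule schwartz_if_compactly_supported[where R = 1, OF smooth_on_mult[OF
            smooth_on_flat_affine smooth_on_flat_affine]]) (auto simp: flat_def)
  from schwartz_cmult[OF this, of "complex_of_real (exp 2)"] show ?thesis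
    by (simp only: bump_def of_real_mult mult_1 mult_minus1 diff_conv_add_uminus)
qed

lemma integral_bump_neq_0: "(LINT x|lborel. complex_of_real (bump x)) \<noteq> 0"
proof
  assume "(LINT x|lborel. complex_of_real (bump x)) = 0"
  then have "(LINT x|lborel. bump x) = 0" by simp
  moreover have "integrable lborel bump"
    using integrable_Re[OF schwartz_integrable[OF schwartz_bump]] by simp
  ultimately have "AE x in lborel. bump x = 0"
    by (subst (asm) integral_nonneg_eq_0_iff_AE) (auto simp: bump_nonneg)
  then have ae: "AE x in lebesgue. x \<in> {x. complex_of_real (bump x) = 0}"
    by (auto dest: AE_completion)
  have "closed {x. complex_of_real (bump x) = 0}"
    by (rule closed_Collect_eq[OF smooth_on_imp_continuous_on[OF schwartz_smooth[OF schwartz_bump]]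
          continuous_on_const])
  from mem_closed_if_AE_lebesgue[OF this ae, of 0] show False by simp
qed

section \<open>Band-limited Schwartz functions\<close>

lemma dist_support_subsetI:
  assumes "closed C"
    and "\<And>\<psi>. \<psi> \<in> schwartz \<Longrightarrow> fun_support \<psi> \<inter> C = {} \<Longrightarrow> T \<psi> = 0"
  shows "dist_support T \<subseteq> C"
proof -
  have "- C \<in> {U. open U \<and> (\<forall>\<psi>\<in>schwartz. compact (fun_support \<psi>) \<and> fun_support \<psi> \<subseteq> U \<longrightarrow> T \<psi> = 0)}"
    using assms by auto
  then show ?thesis unfolding dist_support_def by blast
qed

lemma eq_0_if_not_in_fun_support: "x \<notin> fun_support \<psi> \<Longrightarrow> \<psi> x = 0"
  using closure_subset[of "{x. \<psi> x \<noteq> 0}"] by (auto simp: fun_support_def)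

lemma dist_fourier_of_schwartz:
  assumes "\<phi> \<in> schwartz" "\<psi> \<in> schwartz"
  shows "dist_fourier (dist_of \<phi>) \<psi> = (LINT \<xi>|lborel. fourier \<phi> \<xi> * \<psi> \<xi>)"
  using integral_fourier_mult_swap[of \<phi> \<psi>] assms
  by (simp add: dist_fourier_def dist_of_def schwartz_integrable)

text \<open>By \<open>integral_fourier_mult_swap\<close>, the distributional Fourier transform of \<open>\<phi>\<close> is
integration against the function \<open>fourier \<phi>\<close>. If \<open>\<xi>\<close> lies outside the support, test functions concentrated
at \<open>\<xi>\<close> annihilate \<open>fourier \<phi>\<close>; shrinking them forces its value at \<open>\<xi>\<close> to be 0.\<close>
lemma has_bandlimit_iff_fourier_eq_0:
  assumes \<phi>: "\<phi> \<in> schwartz"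
  shows "has_bandlimit (dist_of \<phi>) c \<longleftrightarrow> (\<forall>\<xi>. c < \<bar>\<xi>\<bar> \<longrightarrow> fourier \<phi> \<xi> = 0)"
proof
  assume zero: "\<forall>\<xi>. c < \<bar>\<xi>\<bar> \<longrightarrow> fourier \<phi> \<xi> = 0"
  show "has_bandlimit (dist_of \<phi>) c"
    unfolding has_bandlimit_def
  proof (rule dist_support_subsetI)
    fix \<psi> assume \<psi>: "\<psi> \<in> schwartz" "fun_support \<psi> \<inter> {-c..c} = {}"
    have "fourier \<phi> \<xi> * \<psi> \<xi> = 0" for \<xi>
    proof (cases "c < \<bar>\<xi>\<bar>")
      case False
      then have "\<xi> \<in> {-c..c}" by auto
      then have "\<xi> \<notin> fun_support \<psi>" using \<psi>(2) by blast
      then show ?thesis by (simp add: eq_0_if_not_in_fun_support)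
    qed (simp add: zero)
    then show "dist_fourier (dist_of \<phi>) \<psi> = 0"
      unfolding dist_fourier_of_schwartz[OF \<phi> \<psi>(1)] using \<open>\<And>\<xi>. fourier \<phi> \<xi> * \<psi> \<xi> = 0\<close>
      by (simp only: integral_zero)
  qed simp
next
  assume bl: "has_bandlimit (dist_of \<phi>) c"
  show "\<forall>\<xi>. c < \<bar>\<xi>\<bar> \<longrightarrow> fourier \<phi> \<xi> = 0"
  proof (intro allI impI)
    fix \<xi> assume "c < \<bar>\<xi>\<bar>"
    then have "\<xi> \<notin> {-c..c}" by auto
    then have "\<xi> \<notin> dist_support (dist_fourier (dist_of \<phi>))"
      using bl by (auto simp: has_bandlimit_def)
    then obtain U where U: "open U" "\<xi> \<in> U"
      "\<And>\<psi>. \<psi> \<in> schwartz \<Longrightarrow> compact (fun_support \<psi>) \<Longrightarrow> fun_support \<psi> \<subseteq> U \<Longrightarrow>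
        dist_fourier (dist_of \<phi>) \<psi> = 0"
      unfolding dist_support_def by blast
    obtain e where e: "0 < e" "cball \<xi> e \<subseteq> U"
      using U(1,2) open_contains_cball by blast
    define I where "I = (LINT x|lborel. complex_of_real (bump x))"
    define K where "K z = inverse I * complex_of_real (bump z)" for z
    have K: "K \<in> schwartz"
      unfolding K_def[abs_def] by (intro schwartz_cmult schwartz_bump)
    have K1: "(LINT z|lborel. K z) = 1"
      using integral_bump_neq_0 unfolding K_def I_def by (subst integral_mult_right_zero) simp
    \<comment> \<open>The integral is, up to the factor \<open>\<delta>\<close>, the pairing with a test function supported in \<open>[\<xi> - \<delta>, \<xi> + \<delta>]\<close>.\<close>
    have vanish: "(LINT z|lborel. fourier \<phi> (\<xi> - \<delta> * z) * K z) = 0" if \<delta>: "0 < \<delta>" "\<delta> < e" for \<delta>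
    proof -
      define \<psi> where "\<psi> s = K (\<xi> / \<delta> + (- 1 / \<delta>) * s)" for s
      have \<psi>: "\<psi> \<in> schwartz"
        unfolding \<psi>_def[abs_def] using \<delta> by (intro schwartz_affine K) auto
      have "{s. \<psi> s \<noteq> 0} \<subseteq> cball \<xi> e"
      proof
        fix s assume "s \<in> {s. \<psi> s \<noteq> 0}"
        then have "\<bar>\<xi> / \<delta> + (- 1 / \<delta>) * s\<bar> < 1"
          using bump_eq_0[of "\<xi> / \<delta> + (- 1 / \<delta>) * s"] by (force simp: \<psi>_def K_def)
        also have "\<xi> / \<delta> + (- 1 / \<delta>) * s = (\<xi> - s) / \<delta>" using \<delta> by (simp add: field_simps)
        finally show "s \<in> cball \<xi> e" using \<delta> by (simp add: dist_real_def field_simps)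
      qed
      then have supp: "fun_support \<psi> \<subseteq> cball \<xi> e"
        unfolding fun_support_def by (rule closure_minimal) simp
      have "compact (fun_support \<psi>)"
        using compact_Int_closed[of "cball \<xi> e" "fun_support \<psi>"] supp
        by (simp add: Int_absorb1 fun_support_def)
      then have "(LINT s|lborel. fourier \<phi> s * \<psi> s) = 0"
        using U(3)[OF \<psi>] supp e(2) dist_fourier_of_schwartz[OF \<phi> \<psi>] by auto
      moreover have "(LINT s|lborel. fourier \<phi> s * \<psi> s) = \<delta> *\<^sub>R (LINT z|lborel. fourier \<phi> (\<xi> - \<delta> * z) * K z)"
        using \<delta> by (subst lborel_integral_real_affine[of "- \<delta>" _ \<xi>]) (auto simp: \<psi>_def field_simps)
      ultimately show ?thesis using \<delta> by simp
    qed
    obtain L where L: "\<And>x y. norm (fourier \<phi> x - fourier \<phi> y) \<le> L * \<bar>x - y\<bar>"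
      using schwartz_Lipschitz[OF schwartz_fourier[OF \<phi>]] by blast
    define M where "M = (LINT z|lborel. norm (complex_of_real z * K z))"
    have le: "norm (fourier \<phi> \<xi>) \<le> L * \<delta> * M" if "0 < \<delta>" "\<delta> < e" for \<delta>
      using norm_approximate_identity_le[OF L schwartz_integrable[OF K] schwartz_integrable_times_x[OF K] K1,
          of \<delta> \<xi>] vanish[OF that] that by (simp add: M_def)
    have "((\<lambda>\<delta>. L * \<delta> * M) \<longlongrightarrow> L * 0 * M) (at_right 0)"
      by (intro tendsto_intros)
    then have "norm (fourier \<phi> \<xi>) \<le> L * 0 * M"
      by (rule tendsto_lowerbound)
         (use le e(1) in \<open>auto simp: eventually_at_right_field intro!: exI[of _ e]\<close>)
    then show "fourier \<phi> \<xi> = 0" by simp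
  qed
qed

section \<open>Antiderivatives of Schwartz functions as tempered distributions\<close>

text \<open>The antiderivative of \<open>e\<^sup>i\<^sup>\<eta>\<^sup>x\<close> in \<open>x\<close> that vanishes at 0. At \<open>\<eta> = 0\<close> it takes its limit, so that it is an
antiderivative for every \<open>\<eta>\<close>.\<close>
definition cis_antideriv :: "real \<Rightarrow> real \<Rightarrow> complex" where
  "cis_antideriv \<eta> x =
     (if \<eta> = 0 then complex_of_real x else (cis (\<eta> * x) - 1) / (\<i> * complex_of_real \<eta>))"

lemma cis_antideriv_has_vector_derivative:
  "(cis_antideriv \<eta> has_vector_derivative cis (\<eta> * x)) (at x)"
proof (cases "\<eta> = 0")
  case True
  then show ?thesis
    by (auto simp: cis_antideriv_def[abs_def] intro!: derivative_eq_intros)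
next
  case False
  have "((\<lambda>x. (cis (\<eta> * x) - 1) * inverse (\<i> * complex_of_real \<eta>)) has_vector_derivative
      (\<i> * complex_of_real \<eta> * cis (\<eta> * x) - 0) * inverse (\<i> * complex_of_real \<eta>)) (at x)"
    by (intro has_vector_derivative_mult_left has_vector_derivative_diff
        has_vector_derivative_cis_linear has_vector_derivative_const)
  moreover have "(\<i> * complex_of_real \<eta> * cis (\<eta> * x) - 0) * inverse (\<i> * complex_of_real \<eta>) = cis (\<eta> * x)"
    using False by (simp add: field_simps)
  moreover have "(\<lambda>x. (cis (\<eta> * x) - 1) * inverse (\<i> * complex_of_real \<eta>)) = cis_antideriv \<eta>"
    using False by (simp add: cis_antideriv_def[abs_def] divide_inverse)
  ultimately show ?thesis by metis
qed

lemma cis_antideriv_0 [simp]: "cis_antideriv \<eta> 0 = 0"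
  by (simp add: cis_antideriv_def)

lemma norm_cis_antideriv_le: "norm (cis_antideriv \<eta> x) \<le> \<bar>x\<bar>"
proof -
  have "norm (cis_antideriv \<eta> x - cis_antideriv \<eta> 0) \<le> 1 * \<bar>x - 0\<bar>"
    by (rule vector_derivative_bound[of UNIV _ "\<lambda>x. cis (\<eta> * x)"])
       (simp_all add: cis_antideriv_has_vector_derivative)
  then show ?thesis by simp
qed

lemma borel_measurable_cis_antideriv [measurable]:
  "(\<lambda>(\<eta>, x). cis_antideriv \<eta> x) \<in> borel_measurable (borel \<Otimes>\<^sub>M borel)"
  unfolding cis_antideriv_def[abs_def] by measurable

text \<open>The function \<open>\<integral>\<^sub>0\<^sup>x u\<close>, written as a superposition of the antiderivatives of the frequencies of \<open>u\<close>.
This form makes its Fourier transform accessible; that the derivative is \<open>u\<close> is then Fourier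
inversion.\<close>
definition antideriv :: "(real \<Rightarrow> complex) \<Rightarrow> real \<Rightarrow> complex" where
  "antideriv u x = (LINT \<eta>|lborel. fourier u \<eta> * cis_antideriv \<eta> x)"

lemma antideriv_0 [simp]: "antideriv u 0 = 0"
  by (simp add: antideriv_def)

lemma integrable_fourier_cis_antideriv:
  assumes "u \<in> schwartz"
  shows "integrable lborel (\<lambda>\<eta>. fourier u \<eta> * cis_antideriv \<eta> x)"
proof (rule Bochner_Integration.integrable_bound)
  show "integrable lborel (\<lambda>\<eta>. \<bar>x\<bar> * norm (fourier u \<eta>))"
    by (intro integrable_mult_right integrable_norm schwartz_integrable schwartz_fourier assms)
  have [measurable]: "fourier u \<in> borel_measurable borel"
    by (intro borel_measurable_schwartz schwartz_fourier assms)
  show "(\<lambda>\<eta>. fourier u \<eta> * cis_antideriv \<eta> x) \<in> borel_measurable lborel"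
    by measurable
  show "AE \<eta> in lborel. norm (fourier u \<eta> * cis_antideriv \<eta> x) \<le> norm (\<bar>x\<bar> * norm (fourier u \<eta>))"
    using mult_right_mono[OF norm_cis_antideriv_le norm_ge_zero]
    by (auto simp: norm_mult mult.commute)
qed

lemma antideriv_has_vector_derivative:
  assumes u: "u \<in> schwartz"
  shows "(antideriv u has_vector_derivative u x) (at x)"
proof -
  have [measurable]: "fourier u \<in> borel_measurable borel"
    by (intro borel_measurable_schwartz schwartz_fourier u)
  have "(antideriv u has_vector_derivative (LINT \<eta>|lborel. fourier u \<eta> * cis (\<eta> * x))) (at x)"
    unfolding antideriv_def[abs_def]
  proof (rule has_vector_derivative_integral[where G = "\<lambda>\<eta>. norm (fourier u \<eta>)"])
    show "integrable lborel (\<lambda>\<eta>. norm (fourier u \<eta>))"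
      by (intro integrable_norm schwartz_integrable schwartz_fourier u)
  qed (auto simp: norm_mult integrable_fourier_cis_antideriv u
        intro!: has_vector_derivative_mult_right cis_antideriv_has_vector_derivative)
  then show ?thesis by (simp add: fourier_inversion u)
qed

lemma D_antideriv: "u \<in> schwartz \<Longrightarrow> D (antideriv u) = u"
  by (intro D_eqI antideriv_has_vector_derivative)

lemma norm_antideriv_le:
  assumes "u \<in> schwartz"
  shows "norm (antideriv u x) \<le> \<bar>x\<bar> * (LINT \<eta>|lborel. norm (fourier u \<eta>))"
proof -
  have "norm (antideriv u x) \<le> (LINT \<eta>|lborel. norm (fourier u \<eta> * cis_antideriv \<eta> x))"
    unfolding antideriv_def by (rule integral_norm_bound)
  also have "\<dots> \<le> (LINT \<eta>|lborel. \<bar>x\<bar> * norm (fourier u \<eta>))"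
  proof (rule integral_mono)
    show "integrable lborel (\<lambda>\<eta>. \<bar>x\<bar> * norm (fourier u \<eta>))"
      by (intro integrable_mult_right integrable_norm schwartz_integrable schwartz_fourier assms)
    show "integrable lborel (\<lambda>\<eta>. norm (fourier u \<eta> * cis_antideriv \<eta> x))"
      by (intro integrable_norm integrable_fourier_cis_antideriv assms)
    show "norm (fourier u \<eta> * cis_antideriv \<eta> x) \<le> \<bar>x\<bar> * norm (fourier u \<eta>)" for \<eta>
      using mult_right_mono[OF norm_cis_antideriv_le norm_ge_zero]
      by (simp add: norm_mult mult.commute)
  qed
  finally show ?thesis by simp
qed

text \<open>All derivatives are derivatives of the Schwartz function \<open>u\<close>, and the function itself grows at most
linearly.\<close>
lemma moderate_antideriv:
  assumes "u \<in> schwartz"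
  shows "moderate (antideriv u)"
proof (rule moderate_coinduct[of "\<lambda>f. f = antideriv u \<or> f \<in> schwartz"])
  fix f assume f: "f = antideriv u \<or> f \<in> schwartz"
  show "\<exists>f'. (f' = antideriv u \<or> f' \<in> schwartz) \<and> (\<forall>x. (f has_vector_derivative f' x) (at x))"
    using f antideriv_has_vector_derivative[OF assms] schwartz_D schwartz_has_vector_derivative assms
    by blast
  show "\<exists>C m. \<forall>x. norm (f x) \<le> C * (1 + \<bar>x\<bar>) ^ m"
    using f
  proof
    assume f: "f = antideriv u"
    let ?A = "LINT \<eta>|lborel. norm (fourier u \<eta>)"
    have "norm (f x) \<le> ?A * (1 + \<bar>x\<bar>) ^ 1" for x
      using norm_antideriv_le[OF assms, of x] by (simp add: f algebra_simps add_increasing)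
    then show ?thesis by blast
  qed (use moderate_bound schwartz_imp_moderate in blast)
qed simp

lemma schwartz_mult_antideriv:
  "h \<in> schwartz \<Longrightarrow> u \<in> schwartz \<Longrightarrow> (\<lambda>x. h x * antideriv u x) \<in> schwartz"
  by (intro schwartz_mult_moderate moderate_antideriv)

text \<open>The value at \<open>\<eta> = 0\<close> is the limit, which keeps the quotient bounded by \<open>sup |\<psi>'|\<close> everywhere.\<close>
definition diff_quotient_0 :: "(real \<Rightarrow> complex) \<Rightarrow> real \<Rightarrow> complex" where
  "diff_quotient_0 \<psi> \<eta> = (if \<eta> = 0 then D \<psi> 0 else (\<psi> \<eta> - \<psi> 0) / complex_of_real \<eta>)"

lemma norm_diff_quotient_0_le:
  assumes "\<psi> \<in> schwartz" "\<And>x. norm (D \<psi> x) \<le> B"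
  shows "norm (diff_quotient_0 \<psi> \<eta>) \<le> B"
proof (cases "\<eta> = 0")
  case False
  have "norm (\<psi> \<eta> - \<psi> 0) \<le> B * \<bar>\<eta> - 0\<bar>"
    by (rule vector_derivative_bound[of UNIV _ "D \<psi>"])
       (simp_all add: schwartz_has_vector_derivative assms)
  then show ?thesis
    using False by (simp add: diff_quotient_0_def norm_divide pos_divide_le_eq)
qed (simp add: diff_quotient_0_def assms)

text \<open>Fourier inversion of \<open>\<psi>\<close> at \<open>\<eta>\<close> and at 0, or of \<open>\<psi>'\<close> at 0 in the limiting case.\<close>
lemma integral_cis_antideriv_fourier:
  assumes \<psi>: "\<psi> \<in> schwartz"
  shows "(LINT x|lborel. cis_antideriv \<eta> x * fourier \<psi> x) = - \<i> * diff_quotient_0 \<psi> \<eta>"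
proof (cases "\<eta> = 0")
  case True
  have "(LINT x|lborel. \<i> * (complex_of_real x * fourier \<psi> x)) = D \<psi> 0"
    using fourier_inversion[OF schwartz_D[OF \<psi>], of 0] by (simp add: fourier_D \<psi> mult.assoc)
  then have "\<i> * (LINT x|lborel. complex_of_real x * fourier \<psi> x) = D \<psi> 0"
    by (simp only: integral_mult_right_zero)
  then have "- \<i> * D \<psi> 0 = - \<i> * (\<i> * (LINT x|lborel. complex_of_real x * fourier \<psi> x))"
    by simp
  then show ?thesis
    using True by (simp add: cis_antideriv_def diff_quotient_0_def)
next
  case False
  have int: "integrable lborel (\<lambda>x. fourier \<psi> x * cis (a * x))" for a
    by (intro integrable_times_cis schwartz_integrable schwartz_fourier \<psi>) simp
  have inv: "(LINT x|lborel. fourier \<psi> x * cis (a * x)) = \<psi> a" for a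
    using fourier_inversion[OF \<psi>, of a] by (simp add: mult.commute[of a])
  have "(LINT x|lborel. cis_antideriv \<eta> x * fourier \<psi> x) =
      (LINT x|lborel. inverse (\<i> * complex_of_real \<eta>) *
        (fourier \<psi> x * cis (\<eta> * x) - fourier \<psi> x * cis (0 * x)))"
    using False by (simp add: cis_antideriv_def field_simps)
  also have "\<dots> = inverse (\<i> * complex_of_real \<eta>) * (\<psi> \<eta> - \<psi> 0)"
    unfolding integral_mult_right_zero Bochner_Integration.integral_diff[OF int int] inv ..
  finally show ?thesis
    using False by (simp add: diff_quotient_0_def divide_inverse)
qed

text \<open>The explicit form of the Fourier transform of an antiderivative, by Fubini. It is the principal
value of \<open>fourier u / (i \<eta>)\<close> together with the multiple of the Dirac measure that is fixed by the value 0 of the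
antiderivative at 0.\<close>
lemma dist_fourier_antideriv:
  assumes u: "u \<in> schwartz" and \<psi>: "\<psi> \<in> schwartz"
  shows "dist_fourier (dist_of (antideriv u)) \<psi> =
    (LINT \<eta>|lborel. fourier u \<eta> * (- \<i> * diff_quotient_0 \<psi> \<eta>))"
proof -
  have [measurable]: "fourier u \<in> borel_measurable borel" "fourier \<psi> \<in> borel_measurable borel"
    by (intro borel_measurable_schwartz schwartz_fourier u \<psi>)+
  have "dist_fourier (dist_of (antideriv u)) \<psi> =
      (LINT x|lborel. (LINT \<eta>|lborel. fourier u \<eta> * cis_antideriv \<eta> x * fourier \<psi> x))"
    by (simp add: dist_fourier_def dist_of_def antideriv_def)
  also have "\<dots> = (LINT \<eta>|lborel. (LINT x|lborel. fourier u \<eta> * cis_antideriv \<eta> x * fourier \<psi> x))"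
  proof (rule lborel_Fubini_dominated)
    show "integrable lborel (\<lambda>\<eta>. norm (fourier u \<eta>))"
      by (intro integrable_norm schwartz_integrable schwartz_fourier u)
    show "integrable lborel (\<lambda>x. norm (complex_of_real x * fourier \<psi> x))"
      by (intro integrable_norm schwartz_integrable_times_x schwartz_fourier \<psi>)
    show "norm (fourier u \<eta> * cis_antideriv \<eta> x * fourier \<psi> x) \<le>
        norm (fourier u \<eta>) * norm (complex_of_real x * fourier \<psi> x)" for \<eta> x
      by (simp add: norm_mult mult.assoc mult_left_mono mult_right_mono norm_cis_antideriv_le)
  qed measurable
  also have "\<dots> = (LINT \<eta>|lborel. fourier u \<eta> * (- \<i> * diff_quotient_0 \<psi> \<eta>))"
    unfolding mult.assoc integral_mult_right_zero integral_cis_antideriv_fourier[OF \<psi>] ..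
  finally show ?thesis .
qed

lemma norm_dist_fourier_antideriv_le:
  assumes u: "u \<in> schwartz" and \<psi>: "\<psi> \<in> schwartz" and B: "\<And>x. norm (D \<psi> x) \<le> B"
  shows "norm (dist_fourier (dist_of (antideriv u)) \<psi>) \<le> (LINT \<eta>|lborel. norm (fourier u \<eta>)) * B"
proof -
  have B': "norm (fourier u \<eta> * (- \<i> * diff_quotient_0 \<psi> \<eta>)) \<le> norm (fourier u \<eta>) * B" for \<eta>
    using norm_diff_quotient_0_le[OF \<psi> B] by (simp add: norm_mult mult_left_mono)
  have int: "integrable lborel (\<lambda>\<eta>. norm (fourier u \<eta>) * B)"
    by (intro integrable_mult_left integrable_norm schwartz_integrable schwartz_fourier u)
  have "norm (dist_fourier (dist_of (antideriv u)) \<psi>) \<le>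
      (LINT \<eta>|lborel. norm (fourier u \<eta> * (- \<i> * diff_quotient_0 \<psi> \<eta>)))"
    unfolding dist_fourier_antideriv[OF u \<psi>] by (rule integral_norm_bound)
  also have "\<dots> \<le> (LINT \<eta>|lborel. norm (fourier u \<eta>) * B)"
    by (rule integral_mono'[OF int B']) (use order_trans[OF norm_ge_zero B] in simp)
  finally show ?thesis by simp
qed

text \<open>The hypothesis that \<open>\<psi>\<close> vanishes on a neighbourhood of the interval, and not just on the interval
itself, matters in the case \<open>c = 0\<close>, where the value \<open>\<psi>' 0\<close> of the quotient has to be 0 too.\<close>
lemma dist_fourier_antideriv_eq_0:
  assumes u: "u \<in> schwartz" and \<psi>: "\<psi> \<in> schwartz"
    and supp: "\<And>\<eta>. c < \<bar>\<eta>\<bar> \<Longrightarrow> fourier u \<eta> = 0"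
    and U: "open U" "{-c..c} \<subseteq> U" "\<And>\<eta>. \<eta> \<in> U \<Longrightarrow> \<psi> \<eta> = 0"
  shows "dist_fourier (dist_of (antideriv u)) \<psi> = 0"
proof -
  have "fourier u \<eta> * (- \<i> * diff_quotient_0 \<psi> \<eta>) = 0" for \<eta>
  proof (cases "c < \<bar>\<eta>\<bar>")
    case False
    then have "\<eta> \<in> {-c..c}" "0 \<in> {-c..c}" by auto
    then have \<eta>: "\<eta> \<in> U" and 0: "0 \<in> U"
      using U(2) by blast+
    have "(\<psi> has_vector_derivative 0) (at 0)"
      by (rule has_vector_derivative_transform_within_open[OF has_vector_derivative_const U(1) 0])
         (simp add: U(3))
    then have "D \<psi> 0 = 0" by (simp add: vector_derivative_at)
    then show ?thesis using U(3)[OF \<eta>] U(3)[OF 0] by (simp add: diff_quotient_0_def)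
  qed (simp add: supp)
  then show ?thesis
    unfolding dist_fourier_antideriv[OF u \<psi>] by (simp only: integral_zero)
qed

lemma schwartz_seminorm_upper:
  assumes "\<psi> \<in> schwartz"
  shows "\<bar>x\<bar> ^ j * norm (iter_deriv k \<psi> x) \<le> schwartz_seminorm j k \<psi>"
proof -
  have "bdd_above (range (\<lambda>x. norm (x ^ j *\<^sub>R iter_deriv k \<psi> x)))"
    using assms by (auto simp: schwartz_iff bdd_above_def power_abs)
  then have "norm (x ^ j *\<^sub>R iter_deriv k \<psi> x) \<le> schwartz_seminorm j k \<psi>"
    unfolding schwartz_seminorm_def by (intro cSUP_upper) auto
  then show ?thesis by (simp add: power_abs)
qed

lemma schwartz_seminorm_nonneg: "\<psi> \<in> schwartz \<Longrightarrow> 0 \<le> schwartz_seminorm j k \<psi>"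
  by (rule order_trans[OF _ schwartz_seminorm_upper[of \<psi> 0 j k]]) simp_all

lemma schwartz_seminorm_le_sum:
  assumes "\<psi> \<in> schwartz" "j \<le> N" "k \<le> N"
  shows "schwartz_seminorm j k \<psi> \<le> (\<Sum>j\<le>N. \<Sum>k\<le>N. schwartz_seminorm j k \<psi>)"
proof -
  have "schwartz_seminorm j k \<psi> \<le> (\<Sum>k\<le>N. schwartz_seminorm j k \<psi>)"
    using assms by (intro member_le_sum) (auto simp: schwartz_seminorm_nonneg)
  also have "\<dots> \<le> (\<Sum>j\<le>N. \<Sum>k\<le>N. schwartz_seminorm j k \<psi>)"
    using assms by (intro member_le_sum[of j _ "\<lambda>j. \<Sum>k\<le>N. schwartz_seminorm j k \<psi>"])
      (auto intro!: sum_nonneg simp: schwartz_seminorm_nonneg)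
  finally show ?thesis .
qed

lemma dist_of_antideriv_add_cmult:
  assumes "u \<in> schwartz" "\<phi> \<in> schwartz" "\<psi> \<in> schwartz"
  shows "dist_of (antideriv u) (\<lambda>x. \<phi> x + \<psi> x) = dist_of (antideriv u) \<phi> + dist_of (antideriv u) \<psi>"
    and "dist_of (antideriv u) (\<lambda>x. a * \<psi> x) = a * dist_of (antideriv u) \<psi>"
proof -
  have "integrable lborel (\<lambda>x. antideriv u x * \<phi> x)" if "\<phi> \<in> schwartz" for \<phi>
    using schwartz_integrable[OF schwartz_mult_antideriv[OF that assms(1)]] by (simp add: mult.commute)
  then show "dist_of (antideriv u) (\<lambda>x. \<phi> x + \<psi> x) = dist_of (antideriv u) \<phi> + dist_of (antideriv u) \<psi>"
    using assms by (simp add: dist_of_def distrib_left)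
  show "dist_of (antideriv u) (\<lambda>x. a * \<psi> x) = a * dist_of (antideriv u) \<psi>"
    by (simp add: dist_of_def mult.left_commute[of _ a])
qed

text \<open>Since \<open>|P x| \<le> A |x|\<close>, the pairing with \<open>\<psi>\<close> is at most \<open>A\<close> times the \<open>L\<^sup>1\<close> norm of \<open>x \<psi>\<close>, which the
seminorms with weights \<open>x\<close> and \<open>x\<^sup>3\<close> control.\<close>
lemma tempered_function_antideriv:
  assumes u: "u \<in> schwartz"
  shows "tempered_function (antideriv u)"
  unfolding tempered_function_def tempered_distribution_def
proof (intro conjI ballI allI)
  let ?A = "LINT \<eta>|lborel. norm (fourier u \<eta>)"
  have "norm (dist_of (antideriv u) \<psi>) \<le> 2 * pi * ?A * (\<Sum>j\<le>3. \<Sum>k\<le>3. schwartz_seminorm j k \<psi>)"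
    if \<psi>: "\<psi> \<in> schwartz" for \<psi>
  proof -
    let ?S = "\<Sum>j\<le>3. \<Sum>k\<le>3. schwartz_seminorm j k \<psi>"
    have x\<psi>: "(\<lambda>x. complex_of_real x * \<psi> x) \<in> schwartz"
      using schwartz_times_x[OF \<psi>, of 1] by simp
    have "(1 + x\<^sup>2) * norm (complex_of_real x * \<psi> x) \<le> 2 * ?S" for x
    proof -
      have "(1 + x\<^sup>2) * norm (complex_of_real x * \<psi> x) =
          \<bar>x\<bar> ^ 1 * norm (iter_deriv 0 \<psi> x) + \<bar>x\<bar> ^ 3 * norm (iter_deriv 0 \<psi> x)"
        by (simp add: norm_mult power3_eq_cube algebra_simps power2_eq_square flip: abs_mult)
      also have "\<dots> \<le> ?S + ?S"
        by (intro add_mono order_trans[OF schwartz_seminorm_upper schwartz_seminorm_le_sum] \<psi>) auto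
      finally show ?thesis by simp
    qed
    then have L1: "(LINT x|lborel. norm (complex_of_real x * \<psi> x)) \<le> pi * (2 * ?S)"
      by (rule schwartz_integrable_norm_le[OF x\<psi>])
    have "norm (dist_of (antideriv u) \<psi>) \<le> (LINT x|lborel. norm (antideriv u x * \<psi> x))"
      unfolding dist_of_def by (rule integral_norm_bound)
    also have "\<dots> \<le> (LINT x|lborel. ?A * norm (complex_of_real x * \<psi> x))"
    proof (rule integral_mono')
      show "integrable lborel (\<lambda>x. ?A * norm (complex_of_real x * \<psi> x))"
        by (intro integrable_mult_right integrable_norm schwartz_integrable x\<psi>)
      show "norm (antideriv u x * \<psi> x) \<le> ?A * norm (complex_of_real x * \<psi> x)" for x
        using mult_right_mono[OF norm_antideriv_le[OF u, of x] norm_ge_zero[of "\<psi> x"]]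
        by (simp add: norm_mult mult_ac)
    qed simp
    also have "\<dots> = ?A * (LINT x|lborel. norm (complex_of_real x * \<psi> x))"
      by simp
    also have "\<dots> \<le> ?A * (pi * (2 * ?S))"
      by (intro mult_left_mono L1 integral_nonneg_AE) simp
    finally show ?thesis by (simp add: mult_ac)
  qed
  then show "\<exists>C N. \<forall>\<psi>\<in>schwartz. norm (dist_of (antideriv u) \<psi>) \<le>
      C * (\<Sum>j\<le>N. \<Sum>k\<le>N. schwartz_seminorm j k \<psi>)"
    by blast
  show "integrable lborel (\<lambda>x. antideriv u x * \<psi> x)" if "\<psi> \<in> schwartz" for \<psi>
    using schwartz_integrable[OF schwartz_mult_antideriv[OF that u]] by (simp add: mult.commute)
qed (auto intro: dist_of_antideriv_add_cmult u)

lemma fourier_add_cmult: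
  assumes "\<phi> \<in> schwartz" "\<psi> \<in> schwartz"
  shows "fourier (\<lambda>x. \<phi> x + \<psi> x) = (\<lambda>\<xi>. fourier \<phi> \<xi> + fourier \<psi> \<xi>)"
    and "fourier (\<lambda>x. a * \<psi> x) = (\<lambda>\<xi>. a * fourier \<psi> \<xi>)"
proof -
  have int: "integrable lborel (\<lambda>x. \<phi> x * cis (- (\<xi> * x)))" if "\<phi> \<in> schwartz" for \<phi> \<xi>
    by (intro integrable_times_cis schwartz_integrable that) simp
  show "fourier (\<lambda>x. \<phi> x + \<psi> x) = (\<lambda>\<xi>. fourier \<phi> \<xi> + fourier \<psi> \<xi>)"
    using int assms by (simp add: fourier_cis[abs_def] distrib_left distrib_right add_divide_distrib)
  show "fourier (\<lambda>x. a * \<psi> x) = (\<lambda>\<xi>. a * fourier \<psi> \<xi>)"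
    by (simp add: fourier_cis[abs_def] mult.assoc mult.left_commute[of _ a])
qed

lemma tempered_distribution_fourier_antideriv:
  assumes u: "u \<in> schwartz"
  shows "tempered_distribution (dist_fourier (dist_of (antideriv u)))"
  unfolding tempered_distribution_def
proof (intro conjI ballI allI)
  let ?A = "LINT \<eta>|lborel. norm (fourier u \<eta>)"
  have "norm (dist_fourier (dist_of (antideriv u)) \<psi>) \<le>
      ?A * (\<Sum>j\<le>1. \<Sum>k\<le>1. schwartz_seminorm j k \<psi>)" if \<psi>: "\<psi> \<in> schwartz" for \<psi>
  proof (rule norm_dist_fourier_antideriv_le[OF u \<psi>])
    fix x
    have "norm (D \<psi> x) = \<bar>x\<bar> ^ 0 * norm (iter_deriv (Suc 0) \<psi> x)"
      by (simp add: iter_deriv_Suc)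
    also have "\<dots> \<le> (\<Sum>j\<le>1. \<Sum>k\<le>1. schwartz_seminorm j k \<psi>)"
      by (intro order_trans[OF schwartz_seminorm_upper schwartz_seminorm_le_sum] \<psi>) auto
    finally show "norm (D \<psi> x) \<le> (\<Sum>j\<le>1. \<Sum>k\<le>1. schwartz_seminorm j k \<psi>)" .
  qed
  then show "\<exists>C N. \<forall>\<psi>\<in>schwartz. norm (dist_fourier (dist_of (antideriv u)) \<psi>) \<le>
      C * (\<Sum>j\<le>N. \<Sum>k\<le>N. schwartz_seminorm j k \<psi>)"
    by blast
qed (simp_all add: dist_fourier_def fourier_add_cmult dist_of_antideriv_add_cmult u schwartz_fourier)

text \<open>The pairing is bounded by a multiple of \<open>sup |\<psi>'|\<close>, and \<open>\<psi>'\<close> vanishes off the support of \<open>\<psi>\<close>.\<close>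
lemma dist_order_fourier_antideriv_le_1:
  assumes u: "u \<in> schwartz"
  shows "dist_order (dist_fourier (dist_of (antideriv u))) \<le> 1"
proof -
  let ?T = "dist_fourier (dist_of (antideriv u))"
  let ?A = "LINT \<eta>|lborel. norm (fourier u \<eta>)"
  have "order_bound ?T 1"
    unfolding order_bound_def
  proof (intro allI impI)
    fix K :: "real set" assume "compact K"
    show "\<exists>M. \<forall>\<psi>\<in>schwartz. fun_support \<psi> \<subseteq> K \<longrightarrow>
        norm (?T \<psi>) \<le> M * (SUP k\<in>{..1}. SUP x\<in>K. norm (iter_deriv k \<psi> x))"
    \<comment> \<open>The supremum over the empty set is unspecified, but then \<open>\<psi> = 0\<close>.\<close>
    proof (cases "K = {}")
      case True
      have "?T \<psi> = 0" if "\<psi> \<in> schwartz" "fun_support \<psi> \<subseteq> K" for \<psi>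
      proof -
        have "\<psi> x = 0" for x
          using that True eq_0_if_not_in_fun_support by blast
        then have "\<psi> = (\<lambda>x. 0)" by blast
        then show ?thesis by (simp add: dist_fourier_def dist_of_def fourier_def)
      qed
      then show ?thesis by (intro exI[of _ 0]) auto
    next
      case False
      then obtain x0 where x0: "x0 \<in> K" by blast
      have "norm (?T \<psi>) \<le> ?A * (SUP k\<in>{..1}. SUP x\<in>K. norm (iter_deriv k \<psi> x))"
        if \<psi>: "\<psi> \<in> schwartz" and supp: "fun_support \<psi> \<subseteq> K" for \<psi>
      proof (rule norm_dist_fourier_antideriv_le[OF u \<psi>])
        let ?S = "SUP k\<in>{..1::nat}. SUP x\<in>K. norm (iter_deriv k \<psi> x)"
        obtain C where "\<And>x. \<bar>x\<bar> ^ 0 * norm (iter_deriv (Suc 0) \<psi> x) \<le> C"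
          using \<psi> unfolding schwartz_iff by blast
        then have bdd: "bdd_above ((\<lambda>x. norm (iter_deriv 1 \<psi> x)) ` K)"
          by (auto simp: bdd_above_def)
        have K_le: "norm (D \<psi> x) \<le> ?S" if "x \<in> K" for x
        proof -
          have "norm (D \<psi> x) = norm (iter_deriv 1 \<psi> x)" by (simp add: iter_deriv_Suc)
          also have "\<dots> \<le> (SUP x\<in>K. norm (iter_deriv 1 \<psi> x))"
            using that bdd by (rule cSUP_upper)
          also have "\<dots> \<le> ?S" by (rule cSUP_upper) auto
          finally show ?thesis .
        qed
        fix x
        show "norm (D \<psi> x) \<le> ?S"
        proof (cases "x \<in> fun_support \<psi>")
          case True
          then show ?thesis using supp K_le by blast
        next
          case False
          have "open (- fun_support \<psi>)" by (simp add: fun_support_def open_Compl)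
          then have "(\<psi> has_vector_derivative 0) (at x)"
            by (rule has_vector_derivative_transform_within_open[OF has_vector_derivative_const])
               (use False in \<open>auto simp: eq_0_if_not_in_fun_support\<close>)
          then have "D \<psi> x = 0" by (simp add: vector_derivative_at)
          then show ?thesis using order_trans[OF norm_ge_zero K_le[OF x0]] by simp
        qed
      qed
      then show ?thesis by blast
    qed
  qed
  then show ?thesis
    unfolding dist_order_def one_enat_def by (intro INF_lower) simp
qed

lemma dist_support_fourier_antideriv:
  assumes u: "u \<in> schwartz" and supp: "\<And>\<eta>. c < \<bar>\<eta>\<bar> \<Longrightarrow> fourier u \<eta> = 0"
  shows "dist_support (dist_fourier (dist_of (antideriv u))) \<subseteq> {-c..c}"
proof (rule dist_support_subsetI)
  fix \<psi> assume \<psi>: "\<psi> \<in> schwartz" "fun_support \<psi> \<inter> {-c..c} = {}"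
  show "dist_fourier (dist_of (antideriv u)) \<psi> = 0"
  proof (rule dist_fourier_antideriv_eq_0[OF u \<psi>(1) supp])
    show "open (- fun_support \<psi>)" by (simp add: fun_support_def open_Compl)
  qed (use \<psi>(2) eq_0_if_not_in_fun_support in auto)
qed simp

text \<open>Frequencies add under multiplication. By inversion, \<open>h(x) e\<^sup>-\<^sup>i\<^sup>\<xi>\<^sup>x\<close> is \<open>2\<pi>\<close> times the transform of
\<open>\<psi>(s) = fourier h (\<xi> - s)\<close>, so the left-hand side is the pairing of the transform of the antiderivative with
\<open>\<psi>\<close>; and \<open>\<psi>\<close> vanishes near \<open>[-c,c]\<close> when \<open>|\<xi>| > d + c\<close>.\<close>
lemma fourier_mult_antideriv_eq_0:
  assumes h: "h \<in> schwartz" and h_supp: "\<And>\<eta>. d < \<bar>\<eta>\<bar> \<Longrightarrow> fourier h \<eta> = 0"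
    and u: "u \<in> schwartz" and u_supp: "\<And>\<eta>. c < \<bar>\<eta>\<bar> \<Longrightarrow> fourier u \<eta> = 0"
    and \<xi>: "d + c < \<bar>\<xi>\<bar>"
  shows "fourier (\<lambda>x. h x * antideriv u x) \<xi> = 0"
proof -
  define \<psi> where "\<psi> s = fourier h (\<xi> + - 1 * s)" for s
  have \<psi>: "\<psi> \<in> schwartz"
    unfolding \<psi>_def[abs_def] by (intro schwartz_affine schwartz_fourier h) simp
  have f\<psi>: "h x * cis (- (\<xi> * x)) = 2 * pi * fourier \<psi> x" for x
  proof -
    have "2 * pi * fourier \<psi> x = (LINT s|lborel. fourier h (\<xi> + - 1 * s) * cis (- (x * s)))"
      by (simp add: fourier_cis \<psi>_def)
    also have "\<dots> = (LINT s|lborel. fourier h s * cis (- (x * (\<xi> - s))))"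
      by (subst lborel_integral_real_affine[of "- 1" _ \<xi>]) auto
    also have "\<dots> = (LINT s|lborel. cis (- (\<xi> * x)) * (fourier h s * cis (s * x)))"
    proof -
      have "cis (- (x * (\<xi> - s))) = cis (- (\<xi> * x)) * cis (s * x)" for s
        by (simp add: cis_mult algebra_simps)
      then show ?thesis by (simp add: mult.left_commute)
    qed
    also have "\<dots> = cis (- (\<xi> * x)) * h x"
      by (simp add: fourier_inversion h)
    finally show ?thesis by (simp add: mult.commute)
  qed
  have "fourier (\<lambda>x. h x * antideriv u x) \<xi> =
      1 / (2 * pi) * (LINT x|lborel. antideriv u x * (h x * cis (- (\<xi> * x))))"
    by (simp add: fourier_cis mult_ac)
  also have "\<dots> = dist_fourier (dist_of (antideriv u)) \<psi>"
  proof -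
    have "(LINT x|lborel. antideriv u x * (2 * pi * fourier \<psi> x)) =
        (LINT x|lborel. 2 * pi * (antideriv u x * fourier \<psi> x))"
      by (simp only: mult.left_commute)
    then show ?thesis
      unfolding f\<psi> by (simp add: dist_fourier_def dist_of_def)
  qed
  also have "\<dots> = 0"
  proof (rule dist_fourier_antideriv_eq_0[OF u \<psi> u_supp])
    have "open ((\<lambda>s. \<bar>\<xi> - s\<bar>) -` {d<..})"
      by (intro open_vimage continuous_intros)
    then show "open {s. d < \<bar>\<xi> - s\<bar>}" by (simp add: vimage_def)
    show "{-c..c} \<subseteq> {s. d < \<bar>\<xi> - s\<bar>}" using \<xi> by auto
    show "\<psi> s = 0" if "s \<in> {s. d < \<bar>\<xi> - s\<bar>}" for s
      using that h_supp[of "\<xi> - s"] by (simp add: \<psi>_def)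
  qed
  finally show ?thesis .
qed

section \<open>Essential suprema of continuous functions\<close>

text \<open>For a continuous function, a bound that holds almost everywhere holds on the interior, hence on its
closure.\<close>
lemma Linf_norm_le_iff:
  fixes F :: "real \<Rightarrow> 'a::real_normed_vector"
  assumes F: "continuous_on A F" and A: "closed A" "A \<subseteq> closure (interior A)"
  shows "Linf_norm A F \<le> ereal c \<longleftrightarrow> (\<forall>x\<in>A. norm (F x) \<le> c)"
proof
  have meas: "A \<in> sets lebesgue" using A(1) by (simp add: borel_closed)
  show "Linf_norm A F \<le> ereal c" if "\<forall>x\<in>A. norm (F x) \<le> c"
    unfolding Linf_norm_def
  proof (rule esssup_I)
    have "(\<lambda>x. norm (F x)) \<in> borel_measurable (lebesgue_on A)"
      using F meas by (intro continuous_imp_measurable_on_sets_lebesgue continuous_intros)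
    then show "(\<lambda>x. ereal (norm (F x))) \<in> borel_measurable (lebesgue_on A)"
      by (rule borel_measurable_ereal)
    show "AE x in lebesgue_on A. ereal (norm (F x)) \<le> ereal c"
      using that by (intro AE_I2) (simp add: space_restrict_space)
  qed
  assume le: "Linf_norm A F \<le> ereal c"
  let ?C = "A \<inter> (\<lambda>x. norm (F x)) -` {..c}"
  have "AE x in lebesgue_on A. ereal (norm (F x)) \<le> Linf_norm A F"
    unfolding Linf_norm_def by (rule esssup_AE)
  then have "AE x in lebesgue_on A. norm (F x) \<le> c"
    by eventually_elim (use order_trans[OF _ le] in force)
  then have "AE x in lebesgue. x \<in> A \<longrightarrow> norm (F x) \<le> c"
    using meas by (subst (asm) AE_restrict_space_iff) auto
  then have ae: "AE x\<in>interior A in lebesgue. x \<in> ?C"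
    by eventually_elim (use interior_subset in auto)
  have closed: "closed ?C"
    using F A(1) by (intro continuous_closed_preimage continuous_intros) auto
  have "interior A \<subseteq> ?C"
    using mem_closed_if_AE_lebesgue_open[OF open_interior closed ae] by blast
  then have "A \<subseteq> ?C"
    using A(2) closure_minimal[OF _ closed] by blast
  then show "\<forall>x\<in>A. norm (F x) \<le> c" by auto
qed

lemmas Linf_norm_UNIV_le_iff = Linf_norm_le_iff[where A = UNIV, simplified]

lemma Linf_norm_unit_le_iff:
  "continuous_on {-1..1} F \<Longrightarrow> Linf_norm {-1..1} F \<le> ereal c \<longleftrightarrow> (\<forall>x\<in>{-1..1}. norm (F x) \<le> c)"
  by (rule Linf_norm_le_iff) (simp_all add: interior_atLeastAtMost_real)

definition unit_sup :: "(real \<Rightarrow> 'a::real_normed_vector) \<Rightarrow> real" where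
  "unit_sup F = (SUP x\<in>{-1..1}. norm (F x))"

lemma unit_sup_attained:
  assumes "continuous_on {-1..1} F"
  shows "\<exists>x\<in>{-1..1}. unit_sup F = norm (F x) \<and> (\<forall>y\<in>{-1..1}. norm (F y) \<le> norm (F x))"
proof -
  have "\<exists>x\<in>{-1..1}. \<forall>y\<in>{-1..1}. norm (F y) \<le> norm (F x)"
    by (rule continuous_attains_sup) (auto intro!: continuous_intros assms)
  then obtain x where x: "x \<in> {-1..1}" "\<And>y. y \<in> {-1..1} \<Longrightarrow> norm (F y) \<le> norm (F x)" by blast
  have "unit_sup F = norm (F x)"
    unfolding unit_sup_def by (rule cSup_eq_maximum) (use x in auto)
  then show ?thesis using x by blast
qed

lemma norm_le_unit_sup:
  assumes "continuous_on {-1..1} F" "x \<in> {-1..1}"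
  shows "norm (F x) \<le> unit_sup F"
proof -
  from unit_sup_attained[OF assms(1)] obtain y
    where "unit_sup F = norm (F y)" "\<forall>x\<in>{-1..1}. norm (F x) \<le> norm (F y)" by (elim bexE conjE)
  with assms(2) show ?thesis by simp
qed

lemma unit_sup_nonneg: "continuous_on {-1..1} F \<Longrightarrow> 0 \<le> unit_sup F"
  by (rule order_trans[OF norm_ge_zero norm_le_unit_sup[of F 0]]) simp_all

lemma Linf_norm_unit_eq:
  assumes "continuous_on {-1..1} F"
  shows "Linf_norm {-1..1} F = ereal (unit_sup F)"
proof (rule antisym)
  show "Linf_norm {-1..1} F \<le> ereal (unit_sup F)"
    using norm_le_unit_sup[OF assms] by (simp add: Linf_norm_unit_le_iff[OF assms])
  obtain x where "x \<in> {-1..1}" "unit_sup F = norm (F x)"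
    using unit_sup_attained[OF assms] by (elim bexE conjE)
  then show "ereal (unit_sup F) \<le> Linf_norm {-1..1} F"
    by - (rule ereal_le_real, simp add: Linf_norm_unit_le_iff[OF assms])
qed

lemma unit_deriv_eq_D_extension:
  assumes "smooth_on {a<..<b} h" "a < -1" "1 < b" "\<And>x. x \<in> {-1..1} \<Longrightarrow> h x = F x" "x \<in> {-1..1}"
  shows "unit_deriv F x = D h x"
proof -
  have "x \<in> {a<..<b}" using assms(2,3,5) by auto
  then have "(h has_vector_derivative D h x) (at x within {-1..1})"
    by (rule has_vector_derivative_at_within[OF smooth_on_has_vector_derivative[OF assms(1)]])
  then have "(F has_vector_derivative D h x) (at x within {-1..1})"
    by (rule has_vector_derivative_transform[OF assms(5), rotated]) (simp add: assms(4))
  moreover have "at x within {-1..1} \<noteq> bot"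
    using islimpt_Icc[of "-1" "1::real" x] assms(5) by (simp add: trivial_limit_within)
  ultimately show ?thesis
    unfolding unit_deriv_def by (rule vector_derivative_within[rotated])
qed

lemma lipschitz_on_unit_interval:
  assumes F': "\<And>x. x \<in> {-1..1} \<Longrightarrow> (F has_vector_derivative F' x) (at x)"
    and "continuous_on {-1..1} F'"
  shows "\<exists>L. L-lipschitz_on {-1..1} F"
proof -
  have "norm (F y - F x) \<le> unit_sup F' * \<bar>y - x\<bar>" if "x \<in> {-1..1}" "y \<in> {-1..1}" for x y
    using assms that
    by (intro vector_derivative_bound[of "{-1..1}" F F'])
       (auto intro: has_vector_derivative_at_within norm_le_unit_sup)
  then have "(unit_sup F')-lipschitz_on {-1..1} F"
    using assms(2) by (intro lipschitz_onI) (auto simp: dist_norm unit_sup_nonneg)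
  then show ?thesis by blast
qed

lemma smooth_on_iter_deriv_has_vector_derivative:
  "smooth_on S h \<Longrightarrow> x \<in> S \<Longrightarrow> (iter_deriv k h has_vector_derivative iter_deriv (Suc k) h x) (at x)"
  unfolding smooth_on_def iter_deriv_Suc by (simp add: vector_derivative_works)

lemma smooth_on_iter_deriv_lipschitz:
  assumes "smooth_on {a<..<b} h" "a < -1" "1 < b"
  shows "\<exists>L. L-lipschitz_on {-1..1} (iter_deriv k h)"
proof (rule lipschitz_on_unit_interval)
  have *: "(iter_deriv k h has_vector_derivative iter_deriv (Suc k) h x) (at x)" if "x \<in> {-1..1}" for k x
    using that assms by (intro smooth_on_iter_deriv_has_vector_derivative[OF assms(1)]) auto
  then show "(iter_deriv k h has_vector_derivative iter_deriv (Suc k) h x) (at x)" if "x \<in> {-1..1}" for x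
    using that by blast
  show "continuous_on {-1..1} (iter_deriv (Suc k) h)"
    using * by (intro continuous_at_imp_continuous_on) (blast intro: has_vector_derivative_continuous)
qed

lemma smoothly_extendable_lipschitz:
  assumes "smoothly_extendable F"
  shows "\<exists>L. L-lipschitz_on {-1..1} F" "\<exists>L. L-lipschitz_on {-1..1} (unit_deriv F)"
proof -
  obtain a b h where h: "a < -1" "1 < b" "smooth_on {a<..<b} h" "\<And>x. x \<in> {-1..1} \<Longrightarrow> h x = F x"
    using assms unfolding smoothly_extendable_def by blast
  obtain L0 where L0: "L0-lipschitz_on {-1..1} (iter_deriv 0 h)"
    using smooth_on_iter_deriv_lipschitz[OF h(3,1,2), of 0] by (elim exE)
  obtain L1 where L1: "L1-lipschitz_on {-1..1} (iter_deriv 1 h)"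
    using smooth_on_iter_deriv_lipschitz[OF h(3,1,2), of 1] by (elim exE)
  have "L0-lipschitz_on {-1..1} F"
    by (rule lipschitz_on_transform[OF L0]) (simp add: h(4))
  then show "\<exists>L. L-lipschitz_on {-1..1} F" by (rule exI)
  have "L1-lipschitz_on {-1..1} (unit_deriv F)"
  proof (rule lipschitz_on_transform[OF L1])
    show "unit_deriv F x = iter_deriv 1 h x" if "x \<in> {-1..1}" for x
      using unit_deriv_eq_D_extension[OF h(3,1,2,4) that] by (simp add: iter_deriv_Suc)
  qed
  then show "\<exists>L. L-lipschitz_on {-1..1} (unit_deriv F)" by (rule exI)
qed

section \<open>Existence of band-limited approximations\<close>

lemma continuous_on_schwartz: "\<phi> \<in> schwartz \<Longrightarrow> continuous_on A \<phi>"
  by (intro smooth_on_imp_continuous_on schwartz_smooth)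

text \<open>What the iteration requires of an approximation: its band and its error on \<open>[-1,1]\<close>, relative to the
supremum of \<open>|F|\<close>.\<close>
definition unit_bandlimited_approx ::
    "(real \<Rightarrow> complex) \<Rightarrow> real \<Rightarrow> real \<Rightarrow> (real \<Rightarrow> complex) \<Rightarrow> bool" where
  "unit_bandlimited_approx F \<epsilon> c Fb \<longleftrightarrow> Fb \<in> schwartz \<and> (\<forall>\<xi>. c < \<bar>\<xi>\<bar> \<longrightarrow> fourier Fb \<xi> = 0) \<and>
     (\<forall>x\<in>{-1..1}. norm (F x - Fb x) \<le> \<epsilon> * unit_sup F)"

lemma admissible_bandlimit_iff:
  assumes F: "continuous_on {-1..1} F"
  shows "admissible_bandlimit F \<epsilon> c \<longleftrightarrow> 0 < c \<and> (\<exists>Fb. unit_bandlimited_approx F \<epsilon> c Fb \<and>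
     (\<forall>x. norm (Fb x) \<le> 4 * unit_sup F) \<and> (\<forall>\<xi>. norm (fourier Fb \<xi>) \<le> 4 * unit_sup F) \<and>
     (\<forall>\<xi>. norm (D (fourier Fb) \<xi>) \<le> 4 * unit_sup F))"
proof -
  have four: "4 * ereal r = ereal (4 * r)" for r by simp
  define P where "P Fb \<longleftrightarrow> has_bandlimit (dist_of Fb) c \<and>
      Linf_norm {-1..1} (\<lambda>x. F x - Fb x) \<le> ereal \<epsilon> * Linf_norm {-1..1} F \<and>
      Linf_norm UNIV Fb \<le> 4 * Linf_norm {-1..1} F \<and>
      Linf_norm UNIV (fourier Fb) \<le> 4 * Linf_norm {-1..1} F \<and>
      Linf_norm UNIV (D (fourier Fb)) \<le> 4 * Linf_norm {-1..1} F" for Fb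
  define Q where "Q Fb \<longleftrightarrow> unit_bandlimited_approx F \<epsilon> c Fb \<and>
      (\<forall>x. norm (Fb x) \<le> 4 * unit_sup F) \<and> (\<forall>\<xi>. norm (fourier Fb \<xi>) \<le> 4 * unit_sup F) \<and>
      (\<forall>\<xi>. norm (D (fourier Fb) \<xi>) \<le> 4 * unit_sup F)" for Fb
  have PQ: "P Fb \<longleftrightarrow> Q Fb" if "Fb \<in> schwartz" for Fb
  proof -
    have diff: "continuous_on {-1..1} (\<lambda>x. F x - Fb x)"
      by (rule continuous_on_diff[OF F continuous_on_schwartz[OF that]])
    have cont: "continuous_on UNIV Fb" "continuous_on UNIV (fourier Fb)" "continuous_on UNIV (D (fourier Fb))"
      by (rule continuous_on_schwartz, simp only: that schwartz_fourier schwartz_D)+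
    show ?thesis
      unfolding P_def Q_def unit_bandlimited_approx_def Linf_norm_unit_eq[OF F] four
        times_ereal.simps Linf_norm_unit_le_iff[OF diff]
        cont[THEN Linf_norm_UNIV_le_iff] has_bandlimit_iff_fourier_eq_0[OF that]
      using that by blast
  qed
  have QS: "Fb \<in> schwartz" if "Q Fb" for Fb
    using that by (simp add: Q_def unit_bandlimited_approx_def)
  have "(\<exists>Fb\<in>schwartz. P Fb) \<longleftrightarrow> (\<exists>Fb. Q Fb)"
    using PQ QS by blast
  then show ?thesis
    unfolding admissible_bandlimit_def P_def Q_def by (rule arg_cong[where f = "\<lambda>b. 0 < c \<and> b"])
qed

text \<open>A Lipschitz extension with support in \<open>[-2,2]\<close> that does not exceed the supremum of \<open>F\<close>: constant
beyond the end points, then cut off linearly.\<close>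
definition unit_extension :: "(real \<Rightarrow> complex) \<Rightarrow> real \<Rightarrow> complex" where
  "unit_extension F x = F (max (- 1) (min 1 x)) * complex_of_real (max 0 (min 1 (2 - \<bar>x\<bar>)))"

lemma unit_extension_eq: "x \<in> {-1..1} \<Longrightarrow> unit_extension F x = F x"
  by (auto simp: unit_extension_def max_def min_def abs_if)

lemma unit_extension_eq_0: "2 \<le> \<bar>x\<bar> \<Longrightarrow> unit_extension F x = 0"
  by (auto simp: unit_extension_def)

lemma norm_unit_extension_le:
  assumes "continuous_on {-1..1} F"
  shows "norm (unit_extension F x) \<le> unit_sup F"
proof -
  have "norm (unit_extension F x) \<le> norm (F (max (- 1) (min 1 x))) * 1"
    unfolding unit_extension_def norm_mult by (intro mult_left_mono) auto
  also have "\<dots> \<le> unit_sup F"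
    using norm_le_unit_sup[OF assms, of "max (- 1) (min 1 x)"] by simp
  finally show ?thesis .
qed

lemma unit_extension_lipschitz:
  assumes F: "L-lipschitz_on {-1..1} F"
  shows "norm (unit_extension F x - unit_extension F y) \<le> (L + unit_sup F) * \<bar>x - y\<bar>"
proof -
  define p where "p x = max (- 1) (min 1 x)" for x :: real
  define t where "t x = max 0 (min 1 (2 - \<bar>x\<bar>))" for x :: real
  have p: "p x \<in> {-1..1}" "\<bar>p x - p y\<bar> \<le> \<bar>x - y\<bar>" for x y
    by (auto simp: p_def)
  have t: "\<bar>t x\<bar> \<le> 1" "\<bar>t x - t y\<bar> \<le> \<bar>x - y\<bar>" for x y
    by (auto simp: t_def max_def min_def abs_if)
  have L: "0 \<le> L" using F by (rule lipschitz_on_nonneg)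
  have "unit_extension F x - unit_extension F y =
      (F (p x) - F (p y)) * complex_of_real (t x) + F (p y) * complex_of_real (t x - t y)"
    by (simp add: unit_extension_def p_def t_def algebra_simps)
  also have "norm \<dots> \<le> norm (F (p x) - F (p y)) * \<bar>t x\<bar> + norm (F (p y)) * \<bar>t x - t y\<bar>"
    by (rule norm_triangle_le) (simp add: norm_mult flip: of_real_diff)
  also have "\<dots> \<le> (L * \<bar>x - y\<bar>) * 1 + unit_sup F * \<bar>x - y\<bar>"
  proof (intro add_mono mult_mono)
    have "norm (F (p x) - F (p y)) \<le> L * \<bar>p x - p y\<bar>"
      using lipschitz_onD[OF F p(1) p(1), of x y] by (simp add: dist_norm)
    also have "\<dots> \<le> L * \<bar>x - y\<bar>"
      using p(2) L by (rule mult_left_mono)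
    finally show "norm (F (p x) - F (p y)) \<le> L * \<bar>x - y\<bar>" .
    show "norm (F (p y)) \<le> unit_sup F"
      using norm_le_unit_sup[OF lipschitz_on_continuous_on[OF F] p(1)] .
  qed (use t L unit_sup_nonneg[OF lipschitz_on_continuous_on[OF F]] in auto)
  finally show ?thesis by (simp add: algebra_simps)
qed

lemma unit_extension_moments:
  assumes F: "L-lipschitz_on {-1..1} F"
  shows "rapidly_integrable (unit_extension F)"
    and "(LINT x|lborel. norm (unit_extension F x)) \<le> 4 * unit_sup F"
    and "(LINT x|lborel. norm (- \<i> * complex_of_real x * unit_extension F x)) \<le> 8 * unit_sup F"
proof -
  have F_cont: "continuous_on {-1..1} F" using F by (rule lipschitz_on_continuous_on)
  have "continuous_on UNIV (unit_extension F)"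
    by (rule lipschitz_on_continuous_on[of "L + unit_sup F"])
       (use unit_extension_lipschitz[OF F] lipschitz_on_nonneg[OF F] unit_sup_nonneg[OF F_cont] in
        \<open>simp add: lipschitz_on_def dist_norm\<close>)
  then have [measurable]: "unit_extension F \<in> borel_measurable borel"
    by (rule borel_measurable_continuous_onI)
  have ind_int: "integrable lborel (\<lambda>x::real. C * indicator {- 2..2::real} x :: real)" for C
    by (intro integrable_mult_right) (simp add: integrable_indicator_iff)
  have le: "norm (complex_of_real x ^ j * unit_extension F x) \<le> 2 ^ j * unit_sup F * indicator {- 2..2::real} x" for x j
  proof (cases "\<bar>x\<bar> \<le> 2")
    case True
    then have "\<bar>x\<bar> ^ j * norm (unit_extension F x) \<le> 2 ^ j * unit_sup F"
      by (intro mult_mono power_mono norm_unit_extension_le F_cont) auto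
    then show ?thesis using True by (simp add: norm_mult norm_power abs_le_iff)
  next
    case False
    then show ?thesis using unit_sup_nonneg[OF F_cont] by (simp add: unit_extension_eq_0)
  qed
  have int: "integrable lborel (\<lambda>x. complex_of_real x ^ j * unit_extension F x)" for j
    by (rule Bochner_Integration.integrable_bound[OF ind_int[of "2 ^ j * unit_sup F"]])
       (auto intro!: AE_I2 order_trans[OF le])
  then show "rapidly_integrable (unit_extension F)"
    unfolding rapidly_integrable_def by blast
  have "(LINT x|lborel. norm (complex_of_real x ^ j * unit_extension F x)) \<le>
      (LINT x|lborel. 2 ^ j * unit_sup F * indicator {- 2..2::real} x)" for j
    by (rule integral_mono[OF integrable_norm[OF int] ind_int le])
  then have "(LINT x|lborel. norm (complex_of_real x ^ j * unit_extension F x)) \<le> 2 ^ j * unit_sup F * 4" for j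
    by simp
  from this[of 0] this[of 1]
  show "(LINT x|lborel. norm (unit_extension F x)) \<le> 4 * unit_sup F"
    and "(LINT x|lborel. norm (- \<i> * complex_of_real x * unit_extension F x)) \<le> 8 * unit_sup F"
    by (simp_all add: norm_mult)
qed

lemma zero_approx:
  assumes F: "continuous_on {-1..1} F" and "unit_sup F = 0"
  shows "unit_bandlimited_approx F \<epsilon> c (\<lambda>x. 0)"
  using norm_le_unit_sup[OF F] assms(2)
  by (auto simp: unit_bandlimited_approx_def schwartz_zero fourier_def)

text \<open>Let \<open>N\<close> be the supremum of \<open>|F|\<close>. Multiply the transform of the extension by the bump function \<open>\<xi> \<mapsto> bump(\<delta>\<xi>)\<close>. The result has compact
support, and for small \<open>\<delta>\<close> the function itself changes little, since the extension is Lipschitz. The bounds on the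
transform and its derivative come from the moments of the extension, namely \<open>4N\<close> and \<open>8N\<close> divided by
\<open>2\<pi>\<close>, which leaves room for the derivative of the bump function.\<close>
lemma admissible_bandlimit_exists:
  assumes F: "L-lipschitz_on {-1..1} F" and \<epsilon>: "0 < \<epsilon>" "\<epsilon> < 1"
  shows "\<exists>c. admissible_bandlimit F \<epsilon> c"
proof -
  have F_cont: "continuous_on {-1..1} F" using F by (rule lipschitz_on_continuous_on)
  define N where "N = unit_sup F"
  have N0: "0 \<le> N" unfolding N_def using F_cont by (rule unit_sup_nonneg)
  show ?thesis
  proof (cases "N = 0")
    case True
    have "fourier (\<lambda>x. 0) = (\<lambda>\<xi>. 0)" by (simp add: fourier_def[abs_def])
    moreover have "D (\<lambda>x. 0) = (\<lambda>x. 0 :: complex)" by (rule D_eqI) auto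
    ultimately have "admissible_bandlimit F \<epsilon> 1"
      unfolding admissible_bandlimit_iff[OF F_cont]
      using zero_approx[OF F_cont] True by (intro conjI exI[of _ "\<lambda>x. 0"]) (auto simp: N_def)
    then show ?thesis by blast
  next
    case False
    then have N: "0 < N" using N0 by simp
    define \<beta> where "\<beta> x = complex_of_real (bump x)" for x
    have \<beta>: "\<beta> \<in> schwartz" unfolding \<beta>_def[abs_def] by (rule schwartz_bump)
    define K where "K z = 1 / (2 * pi) * inverse_fourier \<beta> z" for z
    have K: "K \<in> schwartz"
      unfolding K_def[abs_def] by (intro schwartz_cmult schwartz_inverse_fourier \<beta>)
    have K1: "(LINT z|lborel. K z) = 1"
    proof -
      have "(LINT z|lborel. K z) = fourier (inverse_fourier \<beta>) 0"
        by (simp add: K_def fourier_cis)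
      then show ?thesis by (simp add: fourier_inverse_fourier[OF \<beta>] \<beta>_def)
    qed
    define M where "M = (LINT z|lborel. norm (complex_of_real z * K z))"
    have M: "0 \<le> M" unfolding M_def by simp
    obtain B where B: "\<And>x. \<bar>x\<bar> ^ 0 * norm (D \<beta> x) \<le> B"
      using schwartz_bound[OF schwartz_D[OF \<beta>]] by blast
    have B0: "0 \<le> B" using order_trans[OF norm_ge_zero, of "D \<beta> 0" B] B[of 0] by simp
    have L: "0 \<le> L" using F by (rule lipschitz_on_nonneg)
    define A where "A = (L + N) * M"
    have A: "0 \<le> A" using L M N by (simp add: A_def)
    \<comment> \<open>The first bound on \<open>\<delta>\<close> controls the error of the approximation, the second one the derivative of \<open>\<beta>(\<delta>\<xi>)\<close>.\<close>
    define \<delta> where "\<delta> = min (\<epsilon> * N / (A + 1)) (1 / (B + 1))"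
    have \<delta>: "0 < \<delta>" using \<epsilon> N A B0 by (simp add: \<delta>_def)
    have "\<delta> * (A + 1) \<le> \<epsilon> * N"
      using A by (simp add: \<delta>_def min_le_iff_disj flip: pos_le_divide_eq)
    then have \<delta>A: "A * \<delta> \<le> \<epsilon> * N" using \<delta> by (simp add: algebra_simps)
    have "\<delta> * (B + 1) \<le> 1"
      using B0 by (simp add: \<delta>_def min_le_iff_disj flip: pos_le_divide_eq)
    then have \<delta>B: "\<delta> * B \<le> 1" using \<delta> by (simp add: algebra_simps)
    let ?E = "unit_extension F"
    define H where "H = fourier ?E"
    note E = unit_extension_moments[OF F, folded N_def]
    have norm_H: "norm (H \<xi>) \<le> N" for \<xi>
    proof -
      have "norm (H \<xi>) \<le> 1 / (2 * pi) * (4 * N)"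
        unfolding H_def by (rule order_trans[OF norm_fourier_le mult_left_mono[OF E(2)]]) simp
      also have "\<dots> \<le> N" using N pi_gt3 by (simp add: field_simps)
      finally show ?thesis .
    qed
    have H_deriv: "(H has_vector_derivative fourier (\<lambda>x. - \<i> * complex_of_real x * ?E x) \<xi>) (at \<xi>)" for \<xi>
      unfolding H_def by (rule fourier_has_vector_derivative[OF rapidly_integrableD[OF E(1)]])
    have norm_H': "norm (fourier (\<lambda>x. - \<i> * complex_of_real x * ?E x) \<xi>) \<le> 2 * N" for \<xi>
    proof -
      have "norm (fourier (\<lambda>x. - \<i> * complex_of_real x * ?E x) \<xi>) \<le> 1 / (2 * pi) * (8 * N)"
        by (rule order_trans[OF norm_fourier_le mult_left_mono[OF E(3)]]) simp
      also have "\<dots> \<le> 2 * N" using N pi_gt3 by (simp add: field_simps)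
      finally show ?thesis .
    qed
    define G where "G \<xi> = \<beta> (0 + \<delta> * \<xi>) * H \<xi>" for \<xi>
    have G: "G \<in> schwartz"
      unfolding G_def[abs_def] H_def
      using \<delta> by (intro schwartz_mult_moderate schwartz_affine \<beta> moderate_fourier E) simp
    define Fb where "Fb = inverse_fourier G"
    have Fb: "Fb \<in> schwartz" unfolding Fb_def using G by (rule schwartz_inverse_fourier)
    have fFb: "fourier Fb = G" unfolding Fb_def using G by (rule fourier_inverse_fourier)
    have Fb_near: "norm (Fb x - ?E x) \<le> \<epsilon> * N" for x
    proof -
      have "Fb x = (LINT \<xi>|lborel. H \<xi> * \<beta> (\<delta> * \<xi>) * cis (\<xi> * x))"
        by (simp add: Fb_def inverse_fourier_def G_def mult_ac)
      also have "\<dots> = (LINT z|lborel. ?E (x - \<delta> * z) * K z)"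
        unfolding H_def
        by (rule integral_fourier_times_multiplier[OF rapidly_integrableD(1)[OF E(1)]
              schwartz_integrable[OF \<beta>] _ \<delta>])
           (simp add: K_def inverse_fourier_def)
      finally have "norm (Fb x - ?E x) \<le> (L + N) * \<delta> * M"
        using norm_approximate_identity_le[OF unit_extension_lipschitz[OF F] schwartz_integrable[OF K]
            schwartz_integrable_times_x[OF K] K1, of \<delta> x] \<delta> by (simp add: M_def N_def)
      also have "\<dots> = A * \<delta>" by (simp add: A_def)
      finally show ?thesis using \<delta>A by simp
    qed
    have norm_\<beta>: "norm (\<beta> x) \<le> 1" for x
      by (simp add: \<beta>_def bump_nonneg bump_le_1)
    have "admissible_bandlimit F \<epsilon> (1 / \<delta>)"
      unfolding admissible_bandlimit_iff[OF F_cont] unit_bandlimited_approx_def N_def[symmetric]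
    proof (intro conjI exI[of _ Fb] Fb allI impI ballI)
      show "0 < 1 / \<delta>" using \<delta> by simp
      show "fourier Fb \<xi> = 0" if "1 / \<delta> < \<bar>\<xi>\<bar>" for \<xi>
      proof -
        have "1 \<le> \<bar>\<delta> * \<xi>\<bar>"
          using that \<delta> by (simp add: abs_mult pos_divide_less_eq mult.commute)
        then show ?thesis by (simp add: fFb G_def \<beta>_def bump_eq_0)
      qed
      show "norm (F x - Fb x) \<le> \<epsilon> * N" if "x \<in> {-1..1}" for x
        using Fb_near[of x] unit_extension_eq[OF that, of F] by (simp add: norm_minus_commute)
      show "norm (Fb x) \<le> 4 * N" for x
      proof -
        have "norm (Fb x) \<le> norm (Fb x - ?E x) + norm (?E x)"
          using norm_triangle_ineq[of "Fb x - ?E x" "?E x"] by simp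
        also have "\<dots> \<le> \<epsilon> * N + N"
          using Fb_near norm_unit_extension_le[OF F_cont] by (intro add_mono) (auto simp: N_def)
        also have "\<dots> \<le> 1 * N + N" using \<epsilon> N by (intro add_mono mult_right_mono) auto
        finally show ?thesis using N by simp
      qed
      show "norm (fourier Fb \<xi>) \<le> 4 * N" for \<xi>
      proof -
        have "norm (fourier Fb \<xi>) \<le> 1 * N"
          unfolding fFb G_def norm_mult by (intro mult_mono norm_\<beta> norm_H) auto
        then show ?thesis using N by simp
      qed
      show "norm (D (fourier Fb) \<xi>) \<le> 4 * N" for \<xi>
      proof -
        have "((\<lambda>\<xi>. \<beta> (0 + \<delta> * \<xi>)) has_vector_derivative \<delta> *\<^sub>R D \<beta> (0 + \<delta> * \<xi>)) (at \<xi>)"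
          by (rule vector_diff_chain_at[of "\<lambda>\<xi>. 0 + \<delta> * \<xi>", unfolded o_def])
             (auto intro!: derivative_eq_intros schwartz_has_vector_derivative \<beta>)
        from has_vector_derivative_mult[OF this H_deriv]
        have "D G \<xi> = \<beta> (0 + \<delta> * \<xi>) * fourier (\<lambda>x. - \<i> * complex_of_real x * ?E x) \<xi> +
            \<delta> *\<^sub>R D \<beta> (0 + \<delta> * \<xi>) * H \<xi>"
          unfolding G_def[abs_def] by (rule vector_derivative_at)
        also have "norm \<dots> \<le> 1 * (2 * N) + 1 * N"
        proof (intro norm_triangle_le add_mono)
          show "norm (\<beta> (0 + \<delta> * \<xi>) * fourier (\<lambda>x. - \<i> * complex_of_real x * ?E x) \<xi>) \<le> 1 * (2 * N)"
            unfolding norm_mult by (intro mult_mono norm_\<beta> norm_H') auto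
          have "norm (\<delta> *\<^sub>R D \<beta> (0 + \<delta> * \<xi>)) \<le> \<delta> * B"
            using B[of "0 + \<delta> * \<xi>"] \<delta> by simp
          also have "\<dots> \<le> 1" by (rule \<delta>B)
          finally show "norm (\<delta> *\<^sub>R D \<beta> (0 + \<delta> * \<xi>) * H \<xi>) \<le> 1 * N"
            unfolding norm_mult by (intro mult_mono norm_H) auto
        qed
        finally show ?thesis unfolding fFb using N by simp
      qed
    qed
    then show ?thesis by blast
  qed
qed

lemma approx_bandlimit_nonneg:
  assumes "L-lipschitz_on {-1..1} F" "0 < \<epsilon>" "\<epsilon> < 1"
  shows "0 \<le> approx_bandlimit F \<epsilon>"
  unfolding approx_bandlimit_def using admissible_bandlimit_exists[OF assms]
  by (intro cInf_greatest) (auto simp: admissible_bandlimit_def)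

lemma norm_le_bandlimit_times_fourier_bound:
  assumes \<phi>: "\<phi> \<in> schwartz" and c: "0 \<le> c" "\<And>\<xi>. c < \<bar>\<xi>\<bar> \<Longrightarrow> fourier \<phi> \<xi> = 0"
    and B: "\<And>\<xi>. norm (fourier \<phi> \<xi>) \<le> B"
  shows "norm (\<phi> x) \<le> 2 * c * B"
proof -
  have "norm (\<phi> x) = norm (LINT \<xi>|lborel. fourier \<phi> \<xi> * cis (\<xi> * x))"
    by (simp only: fourier_inversion[OF \<phi>])
  also have "\<dots> \<le> (LINT \<xi>|lborel. norm (fourier \<phi> \<xi> * cis (\<xi> * x)))"
    by (rule integral_norm_bound)
  also have "\<dots> \<le> (LINT \<xi>|lborel. B * indicator {-c..c} \<xi>)"
  proof (rule integral_mono')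
    show "integrable lborel (\<lambda>\<xi>. B * indicator {-c..c} \<xi> :: real)"
      by (intro integrable_mult_right) (simp add: integrable_indicator_iff emeasure_lborel_Icc_eq)
    show "norm (fourier \<phi> \<xi> * cis (\<xi> * x)) \<le> B * indicator {-c..c} \<xi>" for \<xi>
      using B[of \<xi>] c(2)[of \<xi>] by (cases "c < \<bar>\<xi>\<bar>") (auto simp: norm_mult indicator_def)
    show "0 \<le> B * indicator {-c..c} \<xi>" for \<xi> :: real
      using order_trans[OF norm_ge_zero B] by simp
  qed
  also have "\<dots> = 2 * c * B" using c(1) by simp
  finally show ?thesis .
qed

text \<open>At a point where \<open>|F|\<close> is maximal, an admissible function of bandwidth \<open>c\<close> has modulus at least
\<open>(1 - \<epsilon>) \<parallel>F\<parallel>\<close> and at most \<open>8 c \<parallel>F\<parallel>\<close>.\<close>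
lemma approx_bandlimit_pos:
  assumes F: "L-lipschitz_on {-1..1} F" and \<epsilon>: "0 < \<epsilon>" "\<epsilon> < 1" and N: "0 < unit_sup F"
  shows "0 < approx_bandlimit F \<epsilon>"
proof -
  have F_cont: "continuous_on {-1..1} F" using F by (rule lipschitz_on_continuous_on)
  have "(1 - \<epsilon>) / 8 \<le> c" if "admissible_bandlimit F \<epsilon> c" for c
  proof -
    from that obtain Fb where c: "0 < c" and Fb: "unit_bandlimited_approx F \<epsilon> c Fb"
      and le: "\<And>\<xi>. norm (fourier Fb \<xi>) \<le> 4 * unit_sup F"
      unfolding admissible_bandlimit_iff[OF F_cont] by blast
    from unit_sup_attained[OF F_cont] obtain x where x: "x \<in> {-1..1}" "unit_sup F = norm (F x)"
      by (elim bexE conjE)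
    have "norm (F x) \<le> norm (F x - Fb x) + norm (Fb x)"
      using norm_triangle_ineq[of "F x - Fb x" "Fb x"] by simp
    also have "\<dots> \<le> \<epsilon> * unit_sup F + 2 * c * (4 * unit_sup F)"
      using Fb c x(1) le unfolding unit_bandlimited_approx_def
      by (intro add_mono norm_le_bandlimit_times_fourier_bound) auto
    finally have "unit_sup F * 1 \<le> unit_sup F * (\<epsilon> + 8 * c)"
      unfolding x(2)[symmetric] by (simp add: algebra_simps)
    then have "1 \<le> \<epsilon> + 8 * c" using N by (simp only: mult_le_cancel_left_pos)
    then show ?thesis by simp
  qed
  then have "(1 - \<epsilon>) / 8 \<le> approx_bandlimit F \<epsilon>"
    unfolding approx_bandlimit_def using admissible_bandlimit_exists[OF F \<epsilon>]
    by (intro cInf_greatest) auto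
  moreover have "0 < (1 - \<epsilon>) / 8" using \<epsilon> by simp
  ultimately show ?thesis by (rule less_le_trans[rotated])
qed

lemma fourier_dilation:
  assumes "0 < r"
  shows "fourier (\<lambda>x. \<phi> (r * x)) \<xi> = complex_of_real (1 / r) * fourier \<phi> (\<xi> / r)"
proof -
  have "(LINT x|lborel. \<phi> x * cis (- (\<xi> / r * x))) = r *\<^sub>R (LINT x|lborel. \<phi> (r * x) * cis (- (\<xi> * x)))"
    using assms by (subst lborel_integral_real_affine[of r _ 0]) auto
  then show ?thesis using assms by (simp add: fourier_cis scaleR_conv_of_real)
qed

text \<open>The infimum in the definition of the approximate bandlimit \<open>c\<close> may not be attained. At the price of an
arbitrarily small increase \<open>\<eta>\<close> of the relative error, it becomes attainable: an admissible function of
bandwidth \<open>c'\<close> close to \<open>c\<close>, dilated by \<open>r = c / c'\<close>, has bandwidth \<open>c\<close>, and on \<open>[-1,1]\<close> it is as close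
to \<open>F(r x)\<close> as before, while \<open>|F(x) - F(r x)| \<le> L (1 - r)\<close>.\<close>
lemma approx_at_approx_bandlimit:
  assumes F: "L-lipschitz_on {-1..1} F" and \<epsilon>: "0 < \<epsilon>" "\<epsilon> < 1" and \<eta>: "0 < \<eta>"
  shows "\<exists>Fb. unit_bandlimited_approx F (\<epsilon> + \<eta>) (approx_bandlimit F \<epsilon>) Fb"
proof -
  have F_cont: "continuous_on {-1..1} F" using F by (rule lipschitz_on_continuous_on)
  define N where "N = unit_sup F"
  define c where "c = approx_bandlimit F \<epsilon>"
  show ?thesis
  proof (cases "N = 0")
    case True
    then show ?thesis using zero_approx[OF F_cont] by (auto simp: N_def)
  next
    case False
    then have N: "0 < N" using unit_sup_nonneg[OF F_cont] by (simp add: N_def)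
    have c: "0 < c" unfolding c_def using N by (intro approx_bandlimit_pos[OF F \<epsilon>]) (simp add: N_def)
    have L: "0 \<le> L" using F by (rule lipschitz_on_nonneg)
    define \<kappa> where "\<kappa> = \<eta> * N * c / (L + 1)"
    have \<kappa>: "0 < \<kappa>" unfolding \<kappa>_def using \<eta> N c L by simp
    have "Inf {c. admissible_bandlimit F \<epsilon> c} < c + \<kappa>"
      using \<kappa> by (simp add: c_def approx_bandlimit_def)
    then obtain c' where c': "admissible_bandlimit F \<epsilon> c'" "c' < c + \<kappa>"
      using admissible_bandlimit_exists[OF F \<epsilon>]
      by (subst (asm) cInf_less_iff) (auto simp: admissible_bandlimit_def bdd_below_def intro: less_imp_le)
    have cc': "c \<le> c'"
      unfolding c_def approx_bandlimit_def using c'(1)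
      by (intro cInf_lower) (auto simp: admissible_bandlimit_def bdd_below_def intro: less_imp_le)
    from c'(1) obtain Fb where Fb: "unit_bandlimited_approx F \<epsilon> c' Fb"
      unfolding admissible_bandlimit_iff[OF F_cont] by blast
    define r where "r = c / c'"
    have r: "0 < r" "r \<le> 1" using c cc' by (simp_all add: r_def)
    have Lr: "L * (1 - r) \<le> \<eta> * N"
    proof -
      have "1 - r = (c' - c) / c'" using c cc' by (simp add: r_def field_simps)
      also have "\<dots> \<le> \<kappa> / c" using c c' cc' by (intro frac_le) auto
      also have "\<dots> = \<eta> * N / (L + 1)" using c by (simp add: \<kappa>_def)
      finally have "(L + 1) * (1 - r) \<le> \<eta> * N" using L by (simp add: field_simps)
      then show ?thesis using r(2) by (simp add: algebra_simps)
    qed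
    have "unit_bandlimited_approx F (\<epsilon> + \<eta>) c (\<lambda>x. Fb (0 + r * x))"
      unfolding unit_bandlimited_approx_def
    proof (intro conjI allI impI ballI)
      show "(\<lambda>x. Fb (0 + r * x)) \<in> schwartz"
        using Fb r unfolding unit_bandlimited_approx_def by (intro schwartz_affine) auto
      show "fourier (\<lambda>x. Fb (0 + r * x)) \<xi> = 0" if "c < \<bar>\<xi>\<bar>" for \<xi>
      proof -
        have "c' < \<bar>\<xi> / r\<bar>"
          using that c cc' by (simp add: r_def abs_mult field_simps)
        then show ?thesis
          using Fb fourier_dilation[OF r(1), of Fb \<xi>] by (simp add: unit_bandlimited_approx_def)
      qed
      fix x :: real assume x: "x \<in> {-1..1}"
      have rx: "r * x \<in> {-1..1}"
      proof -
        have "\<bar>r * x\<bar> \<le> 1 * 1"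
          unfolding abs_mult using r x by (intro mult_mono) auto
        then show ?thesis by (auto simp: abs_le_iff)
      qed
      have "norm (F x - Fb (r * x)) \<le> norm (F x - F (r * x)) + norm (F (r * x) - Fb (r * x))"
        using norm_triangle_ineq[of "F x - F (r * x)" "F (r * x) - Fb (r * x)"] by simp
      also have "\<dots> \<le> \<eta> * N + \<epsilon> * N"
      proof (rule add_mono)
        have "norm (F x - F (r * x)) \<le> L * \<bar>x - r * x\<bar>"
          using lipschitz_onD[OF F x rx] by (simp add: dist_norm)
        also have "\<bar>x - r * x\<bar> = (1 - r) * \<bar>x\<bar>"
          using r(2) by (simp add: abs_mult flip: left_diff_distrib[of 1 r x, simplified])
        also have "L * ((1 - r) * \<bar>x\<bar>) \<le> L * ((1 - r) * 1)"
          using L r x by (intro mult_left_mono) auto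
        finally show "norm (F x - F (r * x)) \<le> \<eta> * N" using Lr by simp
        show "norm (F (r * x) - Fb (r * x)) \<le> \<epsilon> * N"
          using Fb rx unfolding unit_bandlimited_approx_def N_def by blast
      qed
      finally show "norm (F x - Fb (0 + r * x)) \<le> (\<epsilon> + \<eta>) * unit_sup F"
        by (simp add: N_def algebra_simps)
    qed
    then show ?thesis unfolding c_def by blast
  qed
qed

section \<open>Picard iteration with band-limited data\<close>

text \<open>The derivatives of the Picard iterates of \<open>p' + i h p = f\<close> with \<open>p(0) = 0\<close>. Unlike the iterates
themselves they are Schwartz functions. The iterates are \<open>antideriv (picard_deriv f h n)\<close>.\<close>
primrec picard_deriv :: "(real \<Rightarrow> complex) \<Rightarrow> (real \<Rightarrow> complex) \<Rightarrow> nat \<Rightarrow> real \<Rightarrow> complex" where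
  "picard_deriv f h 0 = f"
| "picard_deriv f h (Suc n) = (\<lambda>x. f x + (- \<i>) * (h x * antideriv (picard_deriv f h n) x))"

lemma schwartz_picard_deriv:
  assumes "f \<in> schwartz" "h \<in> schwartz"
  shows "picard_deriv f h n \<in> schwartz"
proof (induction n)
  case (Suc n)
  then show ?case
    unfolding picard_deriv.simps by (intro schwartz_add schwartz_cmult schwartz_mult_antideriv assms)
qed (simp add: assms)

lemma fourier_picard_deriv_eq_0:
  assumes f: "f \<in> schwartz" "\<And>\<xi>. c < \<bar>\<xi>\<bar> \<Longrightarrow> fourier f \<xi> = 0"
    and h: "h \<in> schwartz" "\<And>\<xi>. d < \<bar>\<xi>\<bar> \<Longrightarrow> fourier h \<xi> = 0" and d: "0 \<le> d"
    and \<xi>: "c + real n * d < \<bar>\<xi>\<bar>"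
  shows "fourier (picard_deriv f h n) \<xi> = 0"
  using \<xi>
proof (induction n arbitrary: \<xi>)
  case 0
  then show ?case by (simp add: f)
next
  case (Suc n)
  let ?u = "picard_deriv f h n"
  have u: "?u \<in> schwartz" using f(1) h(1) by (rule schwartz_picard_deriv)
  have w: "(\<lambda>x. h x * antideriv ?u x) \<in> schwartz" using h(1) u by (rule schwartz_mult_antideriv)
  have "0 \<le> real (Suc n) * d" using d by simp
  then have "fourier f \<xi> = 0" using Suc.prems by (intro f(2)) linarith
  moreover have "fourier (\<lambda>x. h x * antideriv ?u x) \<xi> = 0"
  proof (rule fourier_mult_antideriv_eq_0[where d = d and c = "c + real n * d"])
    show "d + (c + real n * d) < \<bar>\<xi>\<bar>" using Suc.prems by (simp add: algebra_simps)
  qed (use h u Suc.IH in auto)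
  ultimately show ?case
    unfolding picard_deriv.simps fourier_add_cmult(1)[OF f(1) schwartz_cmult[OF w]] fourier_add_cmult(2)[OF w w]
    by simp
qed

text \<open>On \<open>[-1,1]\<close> the operator \<open>u \<mapsto> \<integral>\<^sub>0\<^sup>x u\<close> has norm at most 1 because the interval reaches only up to distance 1
from the starting point 0.\<close>
lemma norm_antideriv_le_unit:
  assumes "u \<in> schwartz" "\<And>x. x \<in> {-1..1} \<Longrightarrow> norm (u x) \<le> B" "x \<in> {-1..1}"
  shows "norm (antideriv u x) \<le> B"
proof -
  have "norm (antideriv u x - antideriv u 0) \<le> B * \<bar>x - 0\<bar>"
    using assms by (intro vector_derivative_bound[of "{-1..1}" _ u])
      (auto intro: has_vector_derivative_at_within antideriv_has_vector_derivative)
  also have "\<dots> \<le> B * 1"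
    using assms(3) order_trans[OF norm_ge_zero assms(2)[OF assms(3)]] by (intro mult_left_mono) auto
  finally show ?thesis by simp
qed

lemma antideriv_diff:
  assumes "u \<in> schwartz" "v \<in> schwartz"
  shows "antideriv (\<lambda>x. u x - v x) x = antideriv u x - antideriv v x"
proof -
  have "((\<lambda>x. antideriv (\<lambda>x. u x - v x) x - (antideriv u x - antideriv v x))
      has_vector_derivative (u x - v x) - (u x - v x)) (at x within UNIV)" for x
    using assms
    by (intro has_vector_derivative_diff antideriv_has_vector_derivative schwartz_diff) auto
  then have "norm ((antideriv (\<lambda>x. u x - v x) x - (antideriv u x - antideriv v x)) -
      (antideriv (\<lambda>x. u x - v x) 0 - (antideriv u 0 - antideriv v 0))) \<le> 0 * \<bar>x - 0\<bar>"
    by (rule vector_derivative_bound[of UNIV]) auto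
  then show ?thesis by simp
qed

context
  fixes f h :: "real \<Rightarrow> complex" and a b :: real
  assumes f: "f \<in> schwartz" "\<And>x. x \<in> {-1..1} \<Longrightarrow> norm (f x) \<le> b"
    and h: "h \<in> schwartz" "\<And>x. x \<in> {-1..1} \<Longrightarrow> norm (h x) \<le> a" and a: "a < 1"
begin

private lemma ab_nonneg: "0 \<le> a" "0 \<le> b"
  using order_trans[OF norm_ge_zero h(2)[of 0]] order_trans[OF norm_ge_zero f(2)[of 0]] by simp_all

lemma norm_picard_deriv_le: "x \<in> {-1..1} \<Longrightarrow> norm (picard_deriv f h n x) \<le> b / (1 - a)"
proof (induction n arbitrary: x)
  case 0
  have "b \<le> b / (1 - a)"
    using a ab_nonneg by (simp add: le_divide_eq mult_left_le)
  then show ?case using f(2)[OF 0] by simp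
next
  case (Suc n)
  let ?u = "picard_deriv f h n"
  have u: "?u \<in> schwartz" using f(1) h(1) by (rule schwartz_picard_deriv)
  have "norm (picard_deriv f h (Suc n) x) \<le> norm (f x) + norm (h x) * norm (antideriv ?u x)"
    unfolding picard_deriv.simps by (rule norm_triangle_le) (simp add: norm_mult)
  also have "\<dots> \<le> b + a * (b / (1 - a))"
    using Suc ab_nonneg by (intro add_mono mult_mono f h norm_antideriv_le_unit[OF u]) auto
  also have "\<dots> = b / (1 - a)" using a by (simp add: field_simps)
  finally show ?case .
qed

lemma norm_picard_le: "x \<in> {-1..1} \<Longrightarrow> norm (antideriv (picard_deriv f h n) x) \<le> b / (1 - a)"
  using f(1) h(1) by (intro norm_antideriv_le_unit schwartz_picard_deriv norm_picard_deriv_le)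

lemma norm_picard_0_le: "x \<in> {-1..1} \<Longrightarrow> norm (antideriv (picard_deriv f h 0) x) \<le> b"
  using norm_antideriv_le_unit[OF f] by simp

lemma norm_picard_diff_le:
  "x \<in> {-1..1} \<Longrightarrow>
    norm (antideriv (picard_deriv f h (Suc n)) x - antideriv (picard_deriv f h n) x) \<le> a ^ Suc n * b"
proof (induction n arbitrary: x)
  case 0
  have u: "picard_deriv f h n \<in> schwartz" for n using f(1) h(1) by (rule schwartz_picard_deriv)
  have "norm (antideriv (\<lambda>x. picard_deriv f h (Suc 0) x - picard_deriv f h 0 x) x) \<le> a * b"
  proof (rule norm_antideriv_le_unit[OF schwartz_diff[OF u u] _ 0])
    fix y :: real assume y: "y \<in> {-1..1}"
    have "norm (h y * antideriv f y) \<le> a * b"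
      unfolding norm_mult using y ab_nonneg h(2)[OF y] norm_picard_0_le[OF y] by (intro mult_mono) auto
    then show "norm (picard_deriv f h (Suc 0) y - picard_deriv f h 0 y) \<le> a * b"
      by (simp add: norm_mult)
  qed
  then show ?case by (simp only: antideriv_diff[OF u u] power_Suc0_right)
next
  case (Suc n)
  have u: "picard_deriv f h n \<in> schwartz" for n using f(1) h(1) by (rule schwartz_picard_deriv)
  have "norm (antideriv (\<lambda>x. picard_deriv f h (Suc (Suc n)) x - picard_deriv f h (Suc n) x) x) \<le>
      a * (a ^ Suc n * b)"
  proof (rule norm_antideriv_le_unit[OF schwartz_diff[OF u u] _ Suc.prems])
    fix y :: real assume y: "y \<in> {-1..1}"
    have "picard_deriv f h (Suc (Suc n)) y - picard_deriv f h (Suc n) y =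
        - \<i> * (h y * (antideriv (picard_deriv f h (Suc n)) y - antideriv (picard_deriv f h n) y))"
      unfolding picard_deriv.simps(2)[of f h "Suc n"] picard_deriv.simps(2)[of f h n]
      by (simp add: algebra_simps)
    also have "norm \<dots> = norm (h y) *
        norm (antideriv (picard_deriv f h (Suc n)) y - antideriv (picard_deriv f h n) y)"
      by (simp add: norm_mult)
    also have "\<dots> \<le> a * (a ^ Suc n * b)"
      using ab_nonneg by (intro mult_mono h(2)[OF y] Suc.IH[OF y]) auto
    finally show "norm (picard_deriv f h (Suc (Suc n)) y - picard_deriv f h (Suc n) y) \<le>
        a * (a ^ Suc n * b)" .
  qed
  then show ?case by (simp only: antideriv_diff[OF u u] power_Suc[of a "Suc n"] mult.assoc)
qed

text \<open>Since \<open>p\<^sub>n' = f - i h p\<^sub>n\<^sub>-\<^sub>1\<close>, the residual at \<open>x\<close> is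
\<open>-(F - f) + i (G - h) p\<^sub>n\<^sub>-\<^sub>1 + i G (p\<^sub>n - p\<^sub>n\<^sub>-\<^sub>1)\<close>. Putting \<open>G\<close> and not \<open>h\<close> in front of the last difference saves a
factor: \<open>G\<close> is bounded by \<open>G\<^sub>1\<close>, but \<open>h\<close> only by \<open>(1 + \<epsilon>') G\<^sub>1\<close>, where \<open>\<epsilon>'\<close> is its relative error. For
\<open>n = 0\<close>, read \<open>p\<^sub>-\<^sub>1 = 0\<close> and drop the middle term.\<close>
lemma norm_picard_residual_le:
  assumes x: "x \<in> {-1..1}" and F: "norm (F - f x) \<le> e" and G: "norm (G - h x) \<le> e'" "norm G \<le> a'"
  shows "norm (picard_deriv f h n x + \<i> * G * antideriv (picard_deriv f h n) x - F) \<le>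
    e + e' * (b / (1 - a)) + a' * (a ^ n * b)"
proof (cases n)
  case 0
  have "0 \<le> e'" using order_trans[OF norm_ge_zero G(1)] .
  then have e': "0 \<le> e' * (b / (1 - a))" using a ab_nonneg by simp
  have "picard_deriv f h n x + \<i> * G * antideriv (picard_deriv f h n) x - F =
      - (F - f x) + \<i> * G * antideriv (picard_deriv f h 0) x"
    by (simp add: 0)
  also have "norm \<dots> \<le> norm (F - f x) + norm G * norm (antideriv (picard_deriv f h 0) x)"
    by (rule norm_triangle_le) (simp add: norm_mult norm_minus_commute)
  also have "\<dots> \<le> e + a' * b"
    using order_trans[OF norm_ge_zero G(2)]
    by (intro add_mono mult_mono F G norm_picard_0_le x) auto
  finally show ?thesis using e' by (simp add: 0)
next
  case (Suc k)
  let ?P = "\<lambda>n. antideriv (picard_deriv f h n) x"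
  have "picard_deriv f h n x + \<i> * G * ?P n - F =
      - (F - f x) + (\<i> * ((G - h x) * ?P k) + \<i> * (G * (?P (Suc k) - ?P k)))"
    by (simp add: Suc algebra_simps)
  also have "norm \<dots> \<le> norm (F - f x) + (norm (G - h x) * norm (?P k) + norm G * norm (?P (Suc k) - ?P k))"
    by (intro norm_triangle_le add_mono) (simp_all add: norm_mult norm_minus_commute)
  also have "\<dots> \<le> e + (e' * (b / (1 - a)) + a' * (a ^ Suc k * b))"
    using order_trans[OF norm_ge_zero G(2)] order_trans[OF norm_ge_zero G(1)]
    by (intro add_mono mult_mono F G norm_picard_le norm_picard_diff_le x) auto
  finally show ?thesis by (simp add: Suc)
qed

end

text \<open>For \<open>b = 0\<close> the quotient is 0 because \<open>ln 0 = 0\<close>, and the first power is already small.\<close>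
lemma power_floor_ln_le:
  fixes b \<epsilon> :: real
  assumes b: "0 \<le> b" "b < 1" and \<epsilon>: "0 < \<epsilon>" "\<epsilon> < 1"
  shows "0 \<le> \<lfloor>ln \<epsilon> / ln b\<rfloor>" "b ^ Suc (nat \<lfloor>ln \<epsilon> / ln b\<rfloor>) \<le> \<epsilon>"
proof -
  have ln_b: "ln b \<le> 0" using b by (cases "b = 0") auto
  have ln_\<epsilon>: "ln \<epsilon> < 0" using \<epsilon> by simp
  show nn: "0 \<le> \<lfloor>ln \<epsilon> / ln b\<rfloor>"
    using ln_b ln_\<epsilon> by (simp add: divide_nonpos_nonpos)
  show "b ^ Suc (nat \<lfloor>ln \<epsilon> / ln b\<rfloor>) \<le> \<epsilon>"
  proof (cases "b = 0")
    case False
    then have b0: "0 < b" "ln b < 0" using b by auto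
    let ?n = "nat \<lfloor>ln \<epsilon> / ln b\<rfloor>"
    have "ln \<epsilon> / ln b < real (Suc ?n)"
      using nn by linarith
    then have "real (Suc ?n) * ln b < ln \<epsilon>"
      using b0(2) by (simp only: neg_divide_less_eq)
    then have "ln (b ^ Suc ?n) < ln \<epsilon>"
      by (simp only: ln_realpow)
    then show ?thesis
      using ln_less_cancel_iff[of "b ^ Suc ?n" \<epsilon>] zero_less_power[OF b0(1), of "Suc ?n"] \<epsilon>(1) by linarith
  qed (use \<epsilon> in simp)
qed

text \<open>The bounds of the Picard iteration, divided by \<open>\<parallel>f\<parallel>\<close>, for approximations with relative error
\<open>m - 1 = \<epsilon> + \<epsilon>(1 - \<epsilon>)/4\<close>. With \<open>m = 2\<close> and error \<open>\<epsilon>\<close> the three terms on the left are at most \<open>\<epsilon>\<close>,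
\<open>\<epsilon> G \<cdot> 2 / (1 - 2G)\<close> and \<open>\<epsilon>\<close>. As in fact \<open>m < 2\<close>, the bounds on the last two improve by the factor
\<open>m / 2\<close>, and this gain pays for the increase of the error.\<close>
lemma slack_inequality:
  fixes G \<epsilon> m :: real
  assumes G: "0 \<le> G" "G < 1 / 2" and \<epsilon>: "0 < \<epsilon>" "\<epsilon> < 1"
    and pow: "(2 * G) ^ Suc n \<le> \<epsilon>" and m: "m = 1 + (\<epsilon> + \<epsilon> * (1 - \<epsilon>) / 4)"
  shows "m * G < 1" "m / (1 - m * G) \<le> 2 / (1 - 2 * G)"
    "(m - 1) + (m - 1) * G * (m / (1 - m * G)) + G * ((m * G) ^ n * m) \<le> 2 * \<epsilon> * (1 + G / (1 - 2 * G))"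
proof -
  define d where "d = 1 - \<epsilon>"
  have d: "0 \<le> d" "d \<le> 1" "\<epsilon> = 1 - d" using \<epsilon> by (auto simp: d_def)
  have d_pow: "0 \<le> d\<^sup>2" "0 \<le> d ^ 3" using d(1) by simp_all
  have m': "m - 1 = \<epsilon> * (1 + d / 4)" by (simp add: m d_def algebra_simps)
  have m1: "1 \<le> m" using \<epsilon> by (simp add: m)
  have "m = 2 - 3 * d / 4 - d\<^sup>2 / 4"
    by (simp add: m d(3) power2_eq_square field_simps)
  then have m2: "m \<le> 2" using d(1) zero_le_power2[of d] by linarith
  have "m * G \<le> 2 * G" using m2 G by (intro mult_right_mono) auto
  then have mG: "1 - 2 * G \<le> 1 - m * G" and "0 < 1 - 2 * G" using G by auto
  then show "m * G < 1" by simp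
  show frac: "m / (1 - m * G) \<le> 2 / (1 - 2 * G)"
    using m1 m2 mG \<open>0 < 1 - 2 * G\<close> by (intro frac_le) auto
  \<comment> \<open>Here the choice of the number of iterations enters; the factor \<open>m / 2 < 1\<close> is the gain.\<close>
  have "(m * G) ^ Suc n \<le> (m / 2) * \<epsilon>"
  proof -
    have "(m * G) ^ Suc n = (m / 2) ^ Suc n * (2 * G) ^ Suc n"
      by (simp only: power_mult_distrib[symmetric]) simp
    also have "\<dots> \<le> (m / 2) * \<epsilon>"
    proof (intro mult_mono pow)
      show "(m / 2) ^ Suc n \<le> m / 2"
        using power_decreasing[of 1 "Suc n" "m / 2"] m1 m2 by simp
    qed (use m1 G in auto)
    finally show ?thesis .
  qed
  then have third: "G * ((m * G) ^ n * m) \<le> (m / 2) * \<epsilon>" by (simp add: mult_ac)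
  have m_d: "m = 1 + \<epsilon> * (1 + d / 4)" using m' by simp
  have "(m - 1) * m = \<epsilon> * (2 - d / 4 - 7 * d\<^sup>2 / 16 - d ^ 3 / 16)"
    unfolding m' unfolding m_d d(3) by (simp add: power2_eq_square power3_eq_cube field_simps)
  also have "\<dots> \<le> \<epsilon> * 2"
    using \<epsilon> d(1) d_pow by (intro mult_left_mono) linarith+
  finally have mm: "(m - 1) * m \<le> 2 * \<epsilon>" by simp
  have G_frac: "G / (1 - m * G) \<le> G / (1 - 2 * G)"
    using mG \<open>0 < 1 - 2 * G\<close> G by (intro frac_le) auto
  have "(m - 1) * G * (m / (1 - m * G)) = ((m - 1) * m) * (G / (1 - m * G))" by simp
  also have "\<dots> \<le> (2 * \<epsilon>) * (G / (1 - 2 * G))"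
    using \<epsilon> G mG \<open>0 < 1 - 2 * G\<close> by (intro mult_mono[OF mm G_frac]) auto
  finally have second: "(m - 1) * G * (m / (1 - m * G)) \<le> 2 * \<epsilon> * (G / (1 - 2 * G))" .
  have "(m - 1) + (m / 2) * \<epsilon> = \<epsilon> * (2 - d / 8 - d\<^sup>2 / 8)"
    unfolding m' unfolding m_d d(3) by (simp add: power2_eq_square field_simps)
  also have "\<dots> \<le> \<epsilon> * 2" using \<epsilon> d(1) d_pow by (intro mult_left_mono) linarith+
  finally have "(m - 1) + (m / 2) * \<epsilon> \<le> 2 * \<epsilon>" by simp
  with second third
  show "(m - 1) + (m - 1) * G * (m / (1 - m * G)) + G * ((m * G) ^ n * m) \<le> 2 * \<epsilon> * (1 + G / (1 - 2 * G))"
    by (simp add: distrib_left)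
qed

theorem theorem5:
  fixes f :: "real \<Rightarrow> complex" and g :: "real \<Rightarrow> real"
    and G1 \<epsilon> cf cg :: real and n :: int
  assumes f_smooth: "smoothly_extendable f"
    and g_smooth: "smoothly_extendable g"
    and G1: "G1 = (SUP x\<in>{-1..1}. \<bar>unit_deriv g x\<bar>)"
    and G1_less: "G1 < 1 / 2"
    and eps: "0 < \<epsilon>" "\<epsilon> < 1"
    and n: "n = \<lfloor>ln \<epsilon> / ln (2 * G1)\<rfloor>"
    and cf: "cf = approx_bandlimit f \<epsilon>"
    and cg: "cg = approx_bandlimit (\<lambda>x. complex_of_real (unit_deriv g x)) \<epsilon>"
  shows "\<exists>p :: real \<Rightarrow> complex.
    smooth_on UNIV p \<and>
    tempered_function p \<and>
    tempered_distribution (dist_fourier (dist_of p)) \<and>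
    dist_order (dist_fourier (dist_of p)) \<le> 1 \<and>
    dist_support (dist_fourier (dist_of p)) \<subseteq> {- cf - real_of_int n * cg .. cf + real_of_int n * cg} \<and>
    (\<forall>x\<in>{-1..1}.
      ereal (norm (vector_derivative p (at x)
                   + \<i> * complex_of_real (unit_deriv g x) * p x - f x))
      \<le> ereal (2 * \<epsilon> * (1 + G1 / (1 - 2 * G1))) * Linf_norm {-1..1} f) \<and>
    Linf_norm {-1..1} p \<le> ereal (2 / (1 - 2 * G1)) * Linf_norm {-1..1} f \<and>
    Linf_norm {-1..1} (\<lambda>x. vector_derivative p (at x))
      \<le> ereal (4 * (1 + G1 / (1 - 2 * G1))) * Linf_norm {-1..1} f"
proof -
  define g' where "g' x = complex_of_real (unit_deriv g x)" for x
  define N where "N = unit_sup f"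
  obtain Lf where Lf: "Lf-lipschitz_on {-1..1} f"
    using smoothly_extendable_lipschitz(1)[OF f_smooth] by (elim exE)
  obtain Lg where "Lg-lipschitz_on {-1..1} (unit_deriv g)"
    using smoothly_extendable_lipschitz(2)[OF g_smooth] by (elim exE)
  then have Lg: "Lg-lipschitz_on {-1..1} g'"
    by (simp add: lipschitz_on_def g'_def dist_norm flip: of_real_diff)
  have f_cont: "continuous_on {-1..1} f" using Lf by (rule lipschitz_on_continuous_on)
  have g'_cont: "continuous_on {-1..1} g'" using Lg by (rule lipschitz_on_continuous_on)
  have G1': "unit_sup g' = G1" by (simp add: unit_sup_def g'_def G1)
  have G1_nonneg: "0 \<le> G1" using unit_sup_nonneg[OF g'_cont] by (simp add: G1')
  have N_nonneg: "0 \<le> N" using unit_sup_nonneg[OF f_cont] by (simp add: N_def)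
  define k where "k = nat n"
  have pow: "(2 * G1) ^ Suc k \<le> \<epsilon>" and n_k: "real_of_int n = real k"
    using power_floor_ln_le[of "2 * G1" \<epsilon>] G1_nonneg G1_less eps by (simp_all add: k_def n)
  define m where "m = 1 + (\<epsilon> + \<epsilon> * (1 - \<epsilon>) / 4)"
  note m = slack_inequality[OF G1_nonneg G1_less eps pow m_def]
  have eta: "0 < \<epsilon> * (1 - \<epsilon>) / 4" using eps by simp
  have m1: "\<epsilon> + \<epsilon> * (1 - \<epsilon>) / 4 = m - 1" by (simp add: m_def)
  \<comment> \<open>Approximations at bandwidth exactly \<open>cf\<close> and \<open>cg\<close>, with slightly relaxed error.\<close>
  obtain fb where fb: "unit_bandlimited_approx f (m - 1) cf fb"
    using approx_at_approx_bandlimit[OF Lf eps eta] unfolding m1 cf by (elim exE)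
  obtain hb where hb: "unit_bandlimited_approx g' (m - 1) cg hb"
    using approx_at_approx_bandlimit[OF Lg eps eta] unfolding m1 cg g'_def[abs_def] by (elim exE)
  have cg_nonneg: "0 \<le> cg"
    using approx_bandlimit_nonneg[OF Lg eps] unfolding cg g'_def[abs_def] .
  have fb_S: "fb \<in> schwartz" and fb_supp: "\<And>\<xi>. cf < \<bar>\<xi>\<bar> \<Longrightarrow> fourier fb \<xi> = 0"
    and fb_near: "\<And>x. x \<in> {-1..1} \<Longrightarrow> norm (f x - fb x) \<le> (m - 1) * N"
    using fb unfolding unit_bandlimited_approx_def N_def by blast+
  have hb_S: "hb \<in> schwartz" and hb_supp: "\<And>\<xi>. cg < \<bar>\<xi>\<bar> \<Longrightarrow> fourier hb \<xi> = 0"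
    and hb_near: "\<And>x. x \<in> {-1..1} \<Longrightarrow> norm (g' x - hb x) \<le> (m - 1) * G1"
    using hb unfolding unit_bandlimited_approx_def G1' by blast+
  have norm_approx: "norm (v :: complex) \<le> m * B" if "norm (u - v) \<le> (m - 1) * B" "norm u \<le> B" for u v B
  proof -
    have "norm v \<le> norm u + norm (u - v)"
      using norm_triangle_ineq4[of u "u - v"] by simp
    also have "\<dots> \<le> B + (m - 1) * B" using that by (rule add_mono[rotated])
    finally show ?thesis by (simp add: algebra_simps)
  qed
  have fb_le: "norm (fb x) \<le> m * N" if "x \<in> {-1..1}" for x
    using norm_approx[OF fb_near[OF that]] norm_le_unit_sup[OF f_cont that] by (simp add: N_def)
  have hb_le: "norm (hb x) \<le> m * G1" if "x \<in> {-1..1}" for x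
    using norm_approx[OF hb_near[OF that]] norm_le_unit_sup[OF g'_cont that] by (simp add: G1')
  note picard = fb_S fb_le hb_S hb_le m(1)
  define u where "u = picard_deriv fb hb k"
  define p where "p = antideriv u"
  have u: "u \<in> schwartz" unfolding u_def using fb_S hb_S by (rule schwartz_picard_deriv)
  have u_supp: "fourier u \<xi> = 0" if "cf + real k * cg < \<bar>\<xi>\<bar>" for \<xi>
    unfolding u_def using fb_S fb_supp hb_S hb_supp cg_nonneg that by (rule fourier_picard_deriv_eq_0)
  have Dp: "D p = u" unfolding p_def using u by (rule D_antideriv)
  have size: "m * N / (1 - m * G1) \<le> 2 / (1 - 2 * G1) * N"
    using mult_right_mono[OF m(2) N_nonneg] by simp
  have two_four: "2 / (1 - 2 * G1) * N \<le> 4 * (1 + G1 / (1 - 2 * G1)) * N"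
  proof (rule mult_right_mono[OF _ N_nonneg])
    have "4 * (1 + G1 / (1 - 2 * G1)) = (4 - 4 * G1) / (1 - 2 * G1)"
      using G1_less by (simp add: field_simps)
    then show "2 / (1 - 2 * G1) \<le> 4 * (1 + G1 / (1 - 2 * G1))"
      using G1_less by (simp add: divide_right_mono)
  qed
  note Linf_f = Linf_norm_unit_eq[OF f_cont, folded N_def]
  show ?thesis
  proof (intro exI[of _ p] conjI ballI)
    show smooth_p: "smooth_on UNIV p"
      unfolding p_def by (intro moderate_smooth moderate_antideriv u)
    show "tempered_function p"
      unfolding p_def using u by (rule tempered_function_antideriv)
    show "tempered_distribution (dist_fourier (dist_of p))"
      unfolding p_def using u by (rule tempered_distribution_fourier_antideriv)
    show "dist_order (dist_fourier (dist_of p)) \<le> 1"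
      unfolding p_def using u by (rule dist_order_fourier_antideriv_le_1)
    show "dist_support (dist_fourier (dist_of p)) \<subseteq> {- cf - real_of_int n * cg .. cf + real_of_int n * cg}"
      using dist_support_fourier_antideriv[of u "cf + real k * cg", OF u u_supp] by (simp add: p_def n_k)
    show "ereal (norm (vector_derivative p (at x) + \<i> * complex_of_real (unit_deriv g x) * p x - f x))
        \<le> ereal (2 * \<epsilon> * (1 + G1 / (1 - 2 * G1))) * Linf_norm {-1..1} f" if x: "x \<in> {-1..1}" for x
    proof -
      have "norm (u x + \<i> * g' x * p x - f x) \<le>
          (m - 1) * N + (m - 1) * G1 * (m * N / (1 - m * G1)) + G1 * ((m * G1) ^ k * (m * N))"
        unfolding p_def u_def
        using norm_le_unit_sup[OF g'_cont x]
        by (intro norm_picard_residual_le[OF picard x fb_near[OF x] hb_near[OF x]]) (simp_all add: G1')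
      also have "\<dots> = ((m - 1) + (m - 1) * G1 * (m / (1 - m * G1)) + G1 * ((m * G1) ^ k * m)) * N"
      proof -
        define q where "q = m / (1 - m * G1)"
        have "m * N / (1 - m * G1) = q * N" by (simp add: q_def)
        then show ?thesis unfolding q_def[symmetric] by (simp add: algebra_simps)
      qed
      also have "\<dots> \<le> 2 * \<epsilon> * (1 + G1 / (1 - 2 * G1)) * N"
        by (rule mult_right_mono[OF m(3) N_nonneg])
      finally show ?thesis
        using fun_cong[OF Dp, of x] by (simp add: Linf_f g'_def)
    qed
    show "Linf_norm {-1..1} p \<le> ereal (2 / (1 - 2 * G1)) * Linf_norm {-1..1} f"
      unfolding Linf_f times_ereal.simps Linf_norm_unit_le_iff[OF smooth_on_imp_continuous_on[OF smooth_p]]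
      using order_trans[OF norm_picard_le[OF picard] size] by (simp add: p_def u_def)
    show "Linf_norm {-1..1} (D p) \<le> ereal (4 * (1 + G1 / (1 - 2 * G1))) * Linf_norm {-1..1} f"
      unfolding Linf_f times_ereal.simps Dp Linf_norm_unit_le_iff[OF continuous_on_schwartz[OF u]]
      using order_trans[OF norm_picard_deriv_le[OF picard] order_trans[OF size two_four]]
      by (simp add: u_def)
  qed
qed

end
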